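(* Let $R$ be a commutative ring with unity, let $I$ be an ideal of $R$, and let $(P,\langle,\rangle)$ be a symplectic $R$-module with $P$ of rank $2n$. Then $V(P,IP,\langle,\rangle)$ is a normal subgroup of the group of isometries $\mathrm{Sp}(P,\langle,\rangle)$.
   Context: Symplectic modules. A symplectic $R$-module is a pair $(P,\langle,\rangle)$ where $P$ is a finitely generated projective $R$-module of even rank and $\langle,\rangle:P\times P\to R$ is an alternating bilinear form ($\langle p,p\rangle=0$ for all $p$) that is nondegenerate, i.e. $x\mapsto\langle x,-\rangle$ is an isomorphism $P\to P^*=\mathrm{Hom}_R(P,R)$. $\mathrm{Sp}(P,\langle,\rangle)$ is the group of $R$-linear automorphisms of $P$ preserving $\langle,\rangle$. $P[X]=P\otimes_R R[X]$ carries the form $\langle\sum_i p_iX^i,\sum_j q_jX^j\rangle_{\otimes R[X]}=\sum_{i,j}\langle p_i,q_j\rangle X^{i+j}$, making it a symplectic $R[X]$-module. For an $R[X]$-linear map $\alpha(X):P[X]\to P[X]$ and $a\in R$, $\alpha(a):P\to P$ is $p\mapsto$ the value at $X=a$ of $\alpha(X)(p)\in P[X]$. Elementary symplectic groups. Let $A$ be a commutative ring and $\varphi$ an invertible alternating matrix of size $2n$ over $A$ (alternating: $\varphi=\nu_0-\nu_0^t$ for some matrix $\nu_0$). Let $\mathrm{Sp}_\varphi(A)=\{\alpha\in \mathrm{GL}_{2n}(A):\alpha^t\varphi\alpha=\varphi\}$. Write $\varphi=\begin{pmatrix}0&-c^t\\ c&\nu\end{pmatrix}$ and $\varphi^{-1}=\begin{pmatrix}0&d^t\\-d&\mu\end{pmatrix}$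 with $c,d\in A^{2n-1}$ (columns) and $\nu,\mu\in \mathrm{M}_{2n-1}(A)$. For $v\in A^{2n-1}$ put $C_\varphi(v)=\begin{pmatrix}1&0\\ v&I_{2n-1}+dv^t\nu\end{pmatrix}$ and $R_\varphi(v)=\begin{pmatrix}1&v^t\\0&I_{2n-1}+\mu vc^t\end{pmatrix}$; these lie in $\mathrm{Sp}_\varphi(A)$. $\mathrm{ESp}_\varphi(A)$ is the subgroup of $\mathrm{Sp}_\varphi(A)$ generated by all $C_\varphi(v),R_\varphi(v)$, $v\in A^{2n-1}$. For an ideal $J$ of $A$, $\mathrm{ESp}_\varphi(A,J)$ is the normal closure in $\mathrm{ESp}_\varphi(A)$ of the subgroup generated by all $C_\varphi(v),R_\varphi(v)$ with $v\in J^{2n-1}$. If $\varphi$ is a matrix over $R$ and $A$ is an $R$-algebra, $\mathrm{ESp}_{\varphi\otimes A}(A,J)$ means this group for the image of $\varphi$ over $A$. The relative Vaserstein group. $V(P,IP,\langle,\rangle)$ is the set of all $\alpha(1)$, where $\alpha(X)\in\mathrm{Sp}(P[X],\langle,\rangle_{\otimes R[X]})$ satisfies $\alpha(0)=\mathrm{Id}$ and, for every prime ideal $\mathfrak p$ of $R$, $\alpha(X)_{\mathfrak p}\in\mathrm{ESp}_{\varphi\otimes R_{\mathfrak p}[X]}(R_{\mathfrak p}[X],I_{\mathfrak p}[X])$. Here $I_{\mathfrak p}=IR_{\mathfrak p}$, $\alpha(X)_{\mathfrak p}$ is the localization of $\alpha(X)$ written as a matrix with respect to an $R_{\mathfrak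 p}$-basis of the free module $P_{\mathfrak p}$ in which the localized form $\langle,\rangle$ has Gram matrix $\varphi$ (alternating, over $R_{\mathfrak p}$) of Pfaffian $1$; the condition does not depend on the choice of such a basis. *)

theory Defs
  imports
    "HOL-Algebra.Bij"
    "HOL-Algebra.Generated_Groups"
    "HOL-Algebra.UnivPoly"
    "HOL-Combinatorics.Permutations"
    "Jordan_Normal_Form.Matrix"
begin

section \<open>Modules\<close>

text \<open>A module is a record that also has the fields of a ring.  For the modules constructed below
  the multiplication and the one of that record play no role and are left unspecified.\<close>

definition ring_module :: "('a, 'm) ring_scheme \<Rightarrow> ('a, 'a) module" where
  "ring_module R = \<lparr>carrier = carrier R, monoid.mult = undefined, monoid.one = undefined,
     ring.zero = \<zero>\<^bsub>R\<^esub>, ring.add = ring.add R, module.smult = monoid.mult R\<rparr>"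

definition free_module :: "('a, 'm) ring_scheme \<Rightarrow> nat \<Rightarrow> ('a, nat \<Rightarrow> 'a) module" where
  "free_module R k = \<lparr>carrier = {..<k} \<rightarrow>\<^sub>E carrier R, monoid.mult = undefined, monoid.one = undefined,
     ring.zero = (\<lambda>i\<in>{..<k}. \<zero>\<^bsub>R\<^esub>), ring.add = (\<lambda>x y. \<lambda>i\<in>{..<k}. x i \<oplus>\<^bsub>R\<^esub> y i),
     module.smult = (\<lambda>a x. \<lambda>i\<in>{..<k}. a \<otimes>\<^bsub>R\<^esub> x i)\<rparr>"

text \<open>Homomorphisms are extensional, so that equal maps are equal as functions.\<close>

definition module_hom ::
  "('a, 'm) ring_scheme \<Rightarrow> ('a, 'b, 'u) module_scheme \<Rightarrow> ('a, 'c, 'v) module_scheme \<Rightarrow> ('b \<Rightarrow> 'c) set"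
where
  "module_hom R M N = {f \<in> carrier M \<rightarrow>\<^sub>E carrier N.
     (\<forall>x\<in>carrier M. \<forall>y\<in>carrier M. f (x \<oplus>\<^bsub>M\<^esub> y) = f x \<oplus>\<^bsub>N\<^esub> f y) \<and>
     (\<forall>a\<in>carrier R. \<forall>x\<in>carrier M. f (a \<odot>\<^bsub>M\<^esub> x) = a \<odot>\<^bsub>N\<^esub> f x)}"

text \<open>Finitely generated projective: a direct summand (up to isomorphism) of some \<open>R\<^sup>k\<close>.\<close>

definition fg_projective :: "('a, 'm) ring_scheme \<Rightarrow> ('a, 'b, 'u) module_scheme \<Rightarrow> bool" where
  "fg_projective R M \<longleftrightarrow> Module.module R M \<and>
     (\<exists>k. \<exists>s\<in>module_hom R M (free_module R k). \<exists>r\<in>module_hom R (free_module R k) M.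
        \<forall>x\<in>carrier M. r (s x) = x)"

definition module_basis ::
  "('a, 'm) ring_scheme \<Rightarrow> ('a, 'b, 'u) module_scheme \<Rightarrow> nat \<Rightarrow> (nat \<Rightarrow> 'b) \<Rightarrow> bool"
where
  "module_basis R M N b \<longleftrightarrow> b \<in> {..<N} \<rightarrow> carrier M \<and>
     (\<forall>x\<in>carrier M. \<exists>!a. a \<in> {..<N} \<rightarrow>\<^sub>E carrier R \<and>
        x = (\<Oplus>\<^bsub>M\<^esub>i\<in>{..<N}. a i \<odot>\<^bsub>M\<^esub> b i))"


section \<open>Localization\<close>

text \<open>The fraction \<open>x/s\<close> is the equivalence class of \<open>(x, s)\<close>, where \<open>(x, s) \<sim> (y, t)\<close> iff
  \<open>utx = usy\<close> for some \<open>u \<in> S\<close>.\<close>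

definition fraction ::
  "('a, 'b, 'u) module_scheme \<Rightarrow> 'a set \<Rightarrow> 'b \<Rightarrow> 'a \<Rightarrow> ('b \<times> 'a) set"
where
  "fraction M S x s = {(y, t). y \<in> carrier M \<and> t \<in> S \<and>
     (\<exists>u\<in>S. u \<odot>\<^bsub>M\<^esub> (t \<odot>\<^bsub>M\<^esub> x) = u \<odot>\<^bsub>M\<^esub> (s \<odot>\<^bsub>M\<^esub> y))}"

text \<open>The unions below run over all representatives of the arguments.  When \<open>S\<close> is a multiplicative
  set, all members of such a union coincide.\<close>

definition loc_module ::
  "('a, 'm) ring_scheme \<Rightarrow> 'a set \<Rightarrow> ('a, 'b, 'u) module_scheme
     \<Rightarrow> (('a \<times> 'a) set, ('b \<times> 'a) set) module"
where
  "loc_module R S M = \<lparr>carrier = {fraction M S x s | x s. x \<in> carrier M \<and> s \<in> S},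
     monoid.mult = undefined, monoid.one = undefined,
     ring.zero = fraction M S \<zero>\<^bsub>M\<^esub> \<one>\<^bsub>R\<^esub>,
     ring.add = (\<lambda>z w. \<Union>(x, s)\<in>z. \<Union>(y, t)\<in>w.
              fraction M S (t \<odot>\<^bsub>M\<^esub> x \<oplus>\<^bsub>M\<^esub> s \<odot>\<^bsub>M\<^esub> y) (s \<otimes>\<^bsub>R\<^esub> t)),
     module.smult = (\<lambda>c z. \<Union>(a, s)\<in>c. \<Union>(x, t)\<in>z. fraction M S (a \<odot>\<^bsub>M\<^esub> x) (s \<otimes>\<^bsub>R\<^esub> t))\<rparr>"

definition loc_ring :: "('a, 'm) ring_scheme \<Rightarrow> 'a set \<Rightarrow> ('a \<times> 'a) set ring" where
  "loc_ring R S = (let L = loc_module R S (ring_module R) in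
     \<lparr>carrier = carrier L, monoid.mult = module.smult L, monoid.one = fraction (ring_module R) S \<one>\<^bsub>R\<^esub> \<one>\<^bsub>R\<^esub>,
      ring.zero = ring.zero L, ring.add = ring.add L\<rparr>)"

definition loc_form ::
  "('a, 'm) ring_scheme \<Rightarrow> 'a set \<Rightarrow> ('b \<Rightarrow> 'b \<Rightarrow> 'a)
     \<Rightarrow> ('b \<times> 'a) set \<Rightarrow> ('b \<times> 'a) set \<Rightarrow> ('a \<times> 'a) set"
where
  "loc_form R S B z w = (\<Union>(x, s)\<in>z. \<Union>(y, t)\<in>w. fraction (ring_module R) S (B x y) (s \<otimes>\<^bsub>R\<^esub> t))"

definition loc_ideal :: "('a, 'm) ring_scheme \<Rightarrow> 'a set \<Rightarrow> 'a set \<Rightarrow> ('a \<times> 'a) set set" where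
  "loc_ideal R S I = genideal (loc_ring R S) ((\<lambda>a. fraction (ring_module R) S a \<one>\<^bsub>R\<^esub>) ` I)"

abbreviation prime_compl :: "('a, 'm) ring_scheme \<Rightarrow> 'a set \<Rightarrow> 'a set" where
  "prime_compl R \<pp> \<equiv> carrier R - \<pp>"

text \<open>Constant rank \<open>N\<close>: every localization at a prime is free of rank \<open>N\<close>.\<close>

definition has_rank :: "('a, 'm) ring_scheme \<Rightarrow> ('a, 'b, 'u) module_scheme \<Rightarrow> nat \<Rightarrow> bool" where
  "has_rank R M N \<longleftrightarrow> (\<forall>\<pp>. primeideal \<pp> R \<longrightarrow>
     (\<exists>b. module_basis (loc_ring R (prime_compl R \<pp>)) (loc_module R (prime_compl R \<pp>) M) N b))"


section \<open>Symplectic modules\<close>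

definition symplectic_module ::
  "('a, 'm) ring_scheme \<Rightarrow> ('a, 'b, 'u) module_scheme \<Rightarrow> ('b \<Rightarrow> 'b \<Rightarrow> 'a) \<Rightarrow> bool"
where
  "symplectic_module R P B \<longleftrightarrow>
     cring R \<and> Module.module R P \<and> fg_projective R P \<and> (\<exists>n. has_rank R P (2 * n)) \<and>
     (\<forall>x\<in>carrier P. (\<lambda>y\<in>carrier P. B x y) \<in> module_hom R P (ring_module R)) \<and>
     (\<forall>y\<in>carrier P. (\<lambda>x\<in>carrier P. B x y) \<in> module_hom R P (ring_module R)) \<and>
     (\<forall>x\<in>carrier P. B x x = \<zero>\<^bsub>R\<^esub>) \<and>
     bij_betw (\<lambda>x. \<lambda>y\<in>carrier P. B x y) (carrier P) (module_hom R P (ring_module R))"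

definition isometry_group ::
  "('a, 'm) ring_scheme \<Rightarrow> ('a, 'b, 'u) module_scheme \<Rightarrow> ('b \<Rightarrow> 'b \<Rightarrow> 'a) \<Rightarrow> ('b \<Rightarrow> 'b) monoid"
where
  "isometry_group R P B = (BijGroup (carrier P))
     \<lparr>carrier := {\<alpha> \<in> Bij (carrier P). \<alpha> \<in> module_hom R P P \<and>
        (\<forall>x\<in>carrier P. \<forall>y\<in>carrier P. B (\<alpha> x) (\<alpha> y) = B x y)}\<rparr>"


section \<open>Polynomial extension\<close>

text \<open>\<open>M[X]\<close>, the module \<open>M \<otimes> R[X]\<close> over the ring \<open>UP R\<close>: an element \<open>\<Sum>m\<^sub>i X\<^sup>i\<close> is the finitely
  supported sequence \<open>i \<mapsto> m\<^sub>i\<close> of its coefficients, as for the elements of \<open>UP R\<close>.\<close>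

definition poly_module ::
  "('a, 'b, 'u) module_scheme \<Rightarrow> (nat \<Rightarrow> 'a, nat \<Rightarrow> 'b) module"
where
  "poly_module M = \<lparr>carrier = up M, monoid.mult = undefined, monoid.one = undefined,
     ring.zero = (\<lambda>i. \<zero>\<^bsub>M\<^esub>), ring.add = (\<lambda>f g i. f i \<oplus>\<^bsub>M\<^esub> g i),
     module.smult = (\<lambda>p f k. \<Oplus>\<^bsub>M\<^esub>i\<in>{..k}. p i \<odot>\<^bsub>M\<^esub> f (k - i))\<rparr>"

definition poly_form ::
  "('a, 'm) ring_scheme \<Rightarrow> ('b \<Rightarrow> 'b \<Rightarrow> 'a) \<Rightarrow> (nat \<Rightarrow> 'b) \<Rightarrow> (nat \<Rightarrow> 'b) \<Rightarrow> (nat \<Rightarrow> 'a)"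
where
  "poly_form R B f g = (\<lambda>k. \<Oplus>\<^bsub>R\<^esub>i\<in>{..k}. B (f i) (g (k - i)))"

definition const_poly :: "('b, 'u) ring_scheme \<Rightarrow> 'b \<Rightarrow> nat \<Rightarrow> 'b" where
  "const_poly M x = (\<lambda>i. if i = 0 then x else \<zero>\<^bsub>M\<^esub>)"

definition poly_ideal :: "('a, 'm) ring_scheme \<Rightarrow> 'a set \<Rightarrow> (nat \<Rightarrow> 'a) set" where
  "poly_ideal R J = {f \<in> up R. \<forall>i. f i \<in> J}"

text \<open>\<open>\<alpha>(a)\<close> for an endomorphism \<open>\<alpha>(X)\<close> of \<open>P[X]\<close>: substitute \<open>X = a\<close> in the image of a constant.\<close>

definition eval_map ::
  "('a, 'm) ring_scheme \<Rightarrow> ('a, 'b, 'u) module_scheme \<Rightarrow> ((nat \<Rightarrow> 'b) \<Rightarrow> (nat \<Rightarrow> 'b)) \<Rightarrow> 'a \<Rightarrow> 'b \<Rightarrow> 'b"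
where
  "eval_map R P \<alpha> a = (\<lambda>x\<in>carrier P. let q = \<alpha> (const_poly P x) in
     \<Oplus>\<^bsub>P\<^esub>i\<in>{i. q i \<noteq> \<zero>\<^bsub>P\<^esub>}. (a [^]\<^bsub>R\<^esub> i) \<odot>\<^bsub>P\<^esub> q i)"


section \<open>Matrices over a ring with explicit carrier\<close>

text \<open>The arithmetic of the type \<open>mat\<close> is that of a type class and cannot be used here.\<close>

definition mat_monoid :: "('a, 'm) ring_scheme \<Rightarrow> nat \<Rightarrow> 'a mat monoid" where
  "mat_monoid A N = \<lparr>carrier = {M \<in> carrier_mat N N. \<forall>i<N. \<forall>j<N. M $$ (i, j) \<in> carrier A},
     monoid.mult = (\<lambda>M M'. mat N N (\<lambda>(i, j). \<Oplus>\<^bsub>A\<^esub>k\<in>{..<N}. M $$ (i, k) \<otimes>\<^bsub>A\<^esub> M' $$ (k, j))),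
     monoid.one = mat N N (\<lambda>(i, j). if i = j then \<one>\<^bsub>A\<^esub> else \<zero>\<^bsub>A\<^esub>)\<rparr>"

text \<open>Pfaffian of an alternating matrix of size \<open>2n\<close>.  A perfect matching
  \<open>{{\<pi>(0),\<pi>(1)}, {\<pi>(2),\<pi>(3)}, \<dots>}\<close> of the indices corresponds to exactly one permutation \<open>\<pi>\<close>
  in the index set of the sum.\<close>

definition pfaffian :: "('a, 'm) ring_scheme \<Rightarrow> nat \<Rightarrow> 'a mat \<Rightarrow> 'a" where
  "pfaffian A n \<phi> =
     (\<Oplus>\<^bsub>A\<^esub>\<pi>\<in>{\<pi>. \<pi> permutes {..<2 * n} \<and> (\<forall>i<n. \<pi> (2 * i) < \<pi> (2 * i + 1)) \<and>
                 (\<forall>j<n. \<forall>i<j. \<pi> (2 * i) < \<pi> (2 * j))}.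
        let p = (\<Otimes>\<^bsub>A\<^esub>i\<in>{..<n}. \<phi> $$ (\<pi> (2 * i), \<pi> (2 * i + 1)))
        in if evenperm \<pi> then p else \<ominus>\<^bsub>A\<^esub> p)"

definition Sp_mat :: "('a, 'm) ring_scheme \<Rightarrow> 'a mat \<Rightarrow> 'a mat monoid" where
  "Sp_mat A \<phi> = (let G = mat_monoid A (dim_row \<phi>) in
     G\<lparr>carrier := {\<alpha> \<in> Units G. transpose_mat \<alpha> \<otimes>\<^bsub>G\<^esub> \<phi> \<otimes>\<^bsub>G\<^esub> \<alpha> = \<phi>}\<rparr>)"

text \<open>With \<open>\<phi> = (0, -c\<^sup>t; c, \<nu>)\<close> and \<open>\<phi>\<^sup>-\<^sup>1 = (0, d\<^sup>t; -d, \<mu>)\<close> in block form,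
  \<open>C_mat\<close> is \<open>(1, 0; v, I + d v\<^sup>t \<nu>)\<close> and \<open>R_mat\<close> is \<open>(1, v\<^sup>t; 0, I + \<mu> v c\<^sup>t)\<close>, written out
  entrywise.  Row and column 0 of the full matrix belong to the block of size 1, so that the
  indices of the vectors and of the blocks of size \<open>N - 1\<close> are shifted by one.
  For \<open>N = 0\<close> both are the empty matrix.\<close>

definition C_mat :: "('a, 'm) ring_scheme \<Rightarrow> 'a mat \<Rightarrow> 'a vec \<Rightarrow> 'a mat" where
  "C_mat A \<phi> v =
    (let N = dim_row \<phi>;
         d = (\<lambda>i. (inv\<^bsub>mat_monoid A N\<^esub> \<phi>) $$ (0, Suc i));
         \<nu> = (\<lambda>i j. \<phi> $$ (Suc i, Suc j))
     in mat N N (\<lambda>(i, j).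
          if i = 0 then (if j = 0 then \<one>\<^bsub>A\<^esub> else \<zero>\<^bsub>A\<^esub>)
          else if j = 0 then v $ (i - 1)
          else (if i = j then \<one>\<^bsub>A\<^esub> else \<zero>\<^bsub>A\<^esub>) \<oplus>\<^bsub>A\<^esub>
               d (i - 1) \<otimes>\<^bsub>A\<^esub> (\<Oplus>\<^bsub>A\<^esub>k\<in>{..<N - 1}. v $ k \<otimes>\<^bsub>A\<^esub> \<nu> k (j - 1))))"

definition R_mat :: "('a, 'm) ring_scheme \<Rightarrow> 'a mat \<Rightarrow> 'a vec \<Rightarrow> 'a mat" where
  "R_mat A \<phi> v =
    (let N = dim_row \<phi>;
         c = (\<lambda>i. \<phi> $$ (Suc i, 0));
         \<mu> = (\<lambda>i j. (inv\<^bsub>mat_monoid A N\<^esub> \<phi>) $$ (Suc i, Suc j))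
     in mat N N (\<lambda>(i, j).
          if j = 0 then (if i = 0 then \<one>\<^bsub>A\<^esub> else \<zero>\<^bsub>A\<^esub>)
          else if i = 0 then v $ (j - 1)
          else (if i = j then \<one>\<^bsub>A\<^esub> else \<zero>\<^bsub>A\<^esub>) \<oplus>\<^bsub>A\<^esub>
               (\<Oplus>\<^bsub>A\<^esub>k\<in>{..<N - 1}. \<mu> (i - 1) k \<otimes>\<^bsub>A\<^esub> v $ k) \<otimes>\<^bsub>A\<^esub> c (j - 1)))"

definition ESp_gens :: "('a, 'm) ring_scheme \<Rightarrow> 'a mat \<Rightarrow> 'a set \<Rightarrow> 'a mat set" where
  "ESp_gens A \<phi> J =
     (let V = {v \<in> carrier_vec (dim_row \<phi> - 1). \<forall>i<dim_row \<phi> - 1. v $ i \<in> J}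
      in C_mat A \<phi> ` V \<union> R_mat A \<phi> ` V)"

definition ESp :: "('a, 'm) ring_scheme \<Rightarrow> 'a mat \<Rightarrow> 'a mat monoid" where
  "ESp A \<phi> = (Sp_mat A \<phi>)\<lparr>carrier := generate (Sp_mat A \<phi>) (ESp_gens A \<phi> (carrier A))\<rparr>"

definition normal_closure :: "('g, 'm) monoid_scheme \<Rightarrow> 'g set \<Rightarrow> 'g set" where
  "normal_closure G H = generate G {g \<otimes>\<^bsub>G\<^esub> h \<otimes>\<^bsub>G\<^esub> inv\<^bsub>G\<^esub> g | g h. g \<in> carrier G \<and> h \<in> H}"

definition ESp_rel :: "('a, 'm) ring_scheme \<Rightarrow> 'a mat \<Rightarrow> 'a set \<Rightarrow> 'a mat set" where
  "ESp_rel A \<phi> J = normal_closure (ESp A \<phi>) (generate (ESp A \<phi>) (ESp_gens A \<phi> J))"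


section \<open>The relative Vaserstein group\<close>

text \<open>\<open>\<beta>\<close> is the localization of the endomorphism \<open>\<alpha>\<close> of \<open>P[X]\<close>: the (unique) linear endomorphism of
  \<open>P\<^sub>\<pp>[X]\<close> over \<open>R\<^sub>\<pp>[X]\<close> that is compatible with \<open>\<alpha>\<close> under \<open>P[X] \<rightarrow> P\<^sub>\<pp>[X]\<close>.\<close>

definition is_localized_map ::
  "('a, 'm) ring_scheme \<Rightarrow> ('a, 'b, 'u) module_scheme \<Rightarrow> 'a set \<Rightarrow> ((nat \<Rightarrow> 'b) \<Rightarrow> (nat \<Rightarrow> 'b))
     \<Rightarrow> ((nat \<Rightarrow> ('b \<times> 'a) set) \<Rightarrow> (nat \<Rightarrow> ('b \<times> 'a) set)) \<Rightarrow> bool"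
where
  "is_localized_map R P S \<alpha> \<beta> \<longleftrightarrow>
     (let PX = poly_module (loc_module R S P);
          \<iota> = (\<lambda>q::nat \<Rightarrow> 'b. \<lambda>i. fraction P S (q i) \<one>\<^bsub>R\<^esub>)
      in \<beta> \<in> module_hom (UP (loc_ring R S)) PX PX \<and>
         (\<forall>q\<in>carrier (poly_module P). \<beta> (\<iota> q) = \<iota> (\<alpha> q)))"

definition is_matrix_of ::
  "('a, 'm) ring_scheme \<Rightarrow> ('a, 'b, 'u) module_scheme \<Rightarrow> nat \<Rightarrow> (nat \<Rightarrow> 'b) \<Rightarrow> ('b \<Rightarrow> 'b) \<Rightarrow> 'a mat \<Rightarrow> bool"
where
  "is_matrix_of A M N b \<beta> T \<longleftrightarrow> T \<in> carrier (mat_monoid A N) \<and>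
     (\<forall>j<N. \<beta> (b j) = (\<Oplus>\<^bsub>M\<^esub>i\<in>{..<N}. T $$ (i, j) \<odot>\<^bsub>M\<^esub> b i))"

definition gram_matrix :: "nat \<Rightarrow> ('b \<Rightarrow> 'b \<Rightarrow> 'a) \<Rightarrow> (nat \<Rightarrow> 'b) \<Rightarrow> 'a mat" where
  "gram_matrix N B b = mat N N (\<lambda>(i, j). B (b i) (b j))"

text \<open>The condition on \<open>\<alpha>(X)\<close> at the prime with complement \<open>S\<close>.  A basis \<open>b\<close> of \<open>P\<^sub>\<pp>\<close> is at the same
  time a basis of \<open>P\<^sub>\<pp>[X]\<close>.  The Gram matrix \<open>\<phi>\<close> is alternating and invertible because the form
  is alternating and nondegenerate.  Which basis with Pfaffian 1 is taken does not matter.\<close>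

definition locally_elementary ::
  "('a, 'm) ring_scheme \<Rightarrow> ('a, 'b, 'u) module_scheme \<Rightarrow> ('b \<Rightarrow> 'b \<Rightarrow> 'a) \<Rightarrow> nat \<Rightarrow> 'a set \<Rightarrow> 'a set
     \<Rightarrow> ((nat \<Rightarrow> 'b) \<Rightarrow> (nat \<Rightarrow> 'b)) \<Rightarrow> bool"
where
  "locally_elementary R P B n I S \<alpha> \<longleftrightarrow>
     (let RS = loc_ring R S; PS = loc_module R S P in
      \<exists>b \<phi> \<beta> T.
        module_basis RS PS (2 * n) b \<and>
        \<phi> = gram_matrix (2 * n) (loc_form R S B) b \<and>
        pfaffian RS n \<phi> = \<one>\<^bsub>RS\<^esub> \<and>
        is_localized_map R P S \<alpha> \<beta> \<and>
        is_matrix_of (UP RS) (poly_module PS) (2 * n) (const_poly PS \<circ> b) \<beta> T \<and>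
        T \<in> ESp_rel (UP RS) (map_mat (const_poly RS) \<phi>) (poly_ideal RS (loc_ideal R S I)))"

text \<open>\<open>V(P, IP, \<langle>,\<rangle>)\<close> for \<open>P\<close> of rank \<open>2n\<close>; the submodule \<open>IP\<close> enters only through the ideal \<open>I\<close>.\<close>

definition vaserstein_group ::
  "('a, 'm) ring_scheme \<Rightarrow> ('a, 'b, 'u) module_scheme \<Rightarrow> ('b \<Rightarrow> 'b \<Rightarrow> 'a) \<Rightarrow> nat \<Rightarrow> 'a set \<Rightarrow> ('b \<Rightarrow> 'b) set"
where
  "vaserstein_group R P B n I = {eval_map R P \<alpha> \<one>\<^bsub>R\<^esub> | \<alpha>.
     \<alpha> \<in> carrier (isometry_group (UP R) (poly_module P) (poly_form R B)) \<and>
     eval_map R P \<alpha> \<zero>\<^bsub>R\<^esub> = \<one>\<^bsub>isometry_group R P B\<^esub> \<and>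
     (\<forall>\<pp>. primeideal \<pp> R \<longrightarrow> locally_elementary R P B n I (prime_compl R \<pp>) \<alpha>)}"

end

theory Submission
  imports Defs
begin

text \<open>Let \<open>e\<close> be the first vector of a basis of a free symplectic module and \<open>D\<close> the first vector of
  the dual basis with respect to the form.  The matrices \<open>C_mat\<close> and \<open>R_mat\<close> represent
  transvections \<open>y \<mapsto> y + \<langle>D,y\<rangle>w + (\<langle>w,y\<rangle> + c\<langle>D,y\<rangle>)D\<close> along \<open>D\<close> and along \<open>e\<close>.  Hence the elementary
  group depends on the pair \<open>(D, e)\<close> only, and even only on the lines spanned by \<open>D\<close> and \<open>e\<close>.
  If \<open>\<langle>D,e\<rangle> = \<langle>D',e\<rangle>\<close>, a transvection along \<open>e\<close> maps \<open>D\<close> to \<open>D'\<close> and fixes \<open>e\<close>, so that the pairs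
  \<open>(D, e)\<close> and \<open>(D', e)\<close> have the same relative elementary group.  Over a local ring any two pairs
  are connected by such steps, because some \<open>x\<close> satisfies \<open>\<langle>D,x\<rangle>, \<langle>D',x\<rangle> \<in> R\<^sup>\<times>\<close>.  So the local
  condition on \<open>\<alpha>(X)\<close> says that its localization lies in one fixed subgroup, which is
  normalized by the isometries of the localized module; it is therefore stable under products, inverses and
  conjugation by isometries of \<open>P\<close>.  Evaluation at \<open>X = 1\<close> is a group homomorphism, and the
  identity satisfies the local condition because a symplectic basis has Pfaffian \<open>1\<close>.\<close>

text \<open>The definition of the local condition admits another basis, hence another matrix group,
  for every \<open>\<alpha>\<close> and every prime, and two maps can only be multiplied inside one
  group. This is why matrices are traded for the endomorphisms that they represent: a change of
  basis is then invisible, and all that is left of a basis is a pair of vectors. The obstacle to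
  connecting two pairs is that \<open>R\<^sub>\<pp>[X]\<close> is not local. The connecting vector
  is therefore sought in \<open>P\<^sub>\<pp>\<close> and used as a constant of
  \<open>P\<^sub>\<pp>[X]\<close>, where the units of \<open>R\<^sub>\<pp>\<close> are still units.
  For normality, an isometry \<open>g\<close> of \<open>P\<close> is extended to \<open>P[X]\<close>
  coefficientwise. This extension has the value \<open>g\<close> at every point, so conjugation by
  it turns a path from the identity to \<open>h\<close> into one from the identity to the conjugate
  of \<open>h\<close> by \<open>g\<close>. The localized extension moves a constant pair to a
  constant pair, so that the same connecting argument applies again.\<close>

lemma foldSetD_cong:
  assumes "(A, x) \<in> foldSetD D f e" "\<And>a. a \<in> A \<Longrightarrow> f a = g a"
  shows "(A, x) \<in> foldSetD D g e"
  using assms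
proof (induction rule: foldSetD.induct)
  case emptyI then show ?case by (auto intro: foldSetD.intros)
next
  case (insertI x y A) then show ?case by (metis foldSetD.insertI insertCI)
qed

text \<open>The fold relation consults the summands on the index set only. Sums that are undefined
  therefore agree as well, and no closure condition has to be discharged at the many places where a
  summand is rewritten.\<close>

lemma finsum_eqI:
  assumes "A = B" "\<And>i. i \<in> B \<Longrightarrow> f i = g i"
  shows "finsum G f A = finsum G g B"
proof -
  have "(A, x) \<in> foldSetD D (h \<circ> f) e \<longleftrightarrow> (A, x) \<in> foldSetD D (h \<circ> g) e" for x D e and h :: "'b \<Rightarrow> 'b \<Rightarrow> 'b"
    using foldSetD_cong[of A x D "h \<circ> f" e "h \<circ> g"] foldSetD_cong[of A x D "h \<circ> g" e "h \<circ> f"] assms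
    by auto
  then show ?thesis
    using assms by (simp add: finsum_def finprod_def foldD_def)
qed

lemma finsum_eq_cong:
  assumes "A = B" "\<And>i. i \<in> B =simp=> f i = g i"
  shows "finsum G f A = finsum G g B"
  using assms by (intro finsum_eqI) (auto simp: simp_implies_def)


section \<open>Closures in groups\<close>

text \<open>The shape of \<open>ESp_rel\<close> in an arbitrary group, with the normal closure
  formed inside the subgroup generated by \<open>A\<close> rather than in \<open>G\<close>. In terms
  of two sets of generators it can be carried along homomorphisms, in particular from isometries to
  matrices.\<close>

definition relative_closure :: "('g, 'm) monoid_scheme \<Rightarrow> 'g set \<Rightarrow> 'g set \<Rightarrow> 'g set" where
  "relative_closure G A H =
     normal_closure (G\<lparr>carrier := generate G A\<rparr>) (generate (G\<lparr>carrier := generate G A\<rparr>) H)"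

lemma ESp_rel_eq:
  "ESp_rel A \<phi> J = relative_closure (Sp_mat A \<phi>) (ESp_gens A \<phi> (carrier A)) (ESp_gens A \<phi> J)"
  by (simp add: ESp_rel_def relative_closure_def ESp_def)

lemma (in group) generate_group:
  assumes "A \<subseteq> carrier G"
  shows "group (G\<lparr>carrier := generate G A\<rparr>)"
  using subgroup.subgroup_is_group[OF generate_is_subgroup[OF assms] is_group] .

lemma (in group) normal_closure_normal:
  assumes "H \<subseteq> carrier G"
  shows "normal_closure G H \<lhd> G"
  unfolding normal_closure_def
proof (rule normal_generateI)
  show "{g \<otimes> h \<otimes> inv g |g h. g \<in> carrier G \<and> h \<in> H} \<subseteq> carrier G"
    using assms by auto
next
  fix x g
  assume "x \<in> {g \<otimes> h \<otimes> inv g |g h. g \<in> carrier G \<and> h \<in> H}" and g: "g \<in> carrier G"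
  then obtain k h where k: "k \<in> carrier G" "h \<in> H" "x = k \<otimes> h \<otimes> inv k"
    by auto
  then have "h \<in> carrier G" using assms by auto
  then have "g \<otimes> x \<otimes> inv g = (g \<otimes> k) \<otimes> h \<otimes> inv (g \<otimes> k)"
    using k g by (simp add: m_assoc inv_mult_group)
  then show "g \<otimes> x \<otimes> inv g \<in> {g \<otimes> h \<otimes> inv g |g h. g \<in> carrier G \<and> h \<in> H}"
    using k g by blast
qed

lemma (in group) relative_closure_normal:
  assumes "A \<subseteq> carrier G" "H \<subseteq> generate G A"
  shows "relative_closure G A H \<lhd> (G\<lparr>carrier := generate G A\<rparr>)"
proof -
  interpret E: group "G\<lparr>carrier := generate G A\<rparr>"
    by (rule generate_group[OF assms(1)])
  have "generate (G\<lparr>carrier := generate G A\<rparr>) H \<subseteq> generate G A"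
    using E.generate_incl[of H] assms(2) by simp
  then show ?thesis
    unfolding relative_closure_def by (intro E.normal_closure_normal) simp
qed

lemma (in group) relative_closure_subgroup:
  assumes "A \<subseteq> carrier G" "H \<subseteq> generate G A"
  shows "subgroup (relative_closure G A H) G"
  using incl_subgroup[OF generate_is_subgroup[OF assms(1)]]
    normal_imp_subgroup[OF relative_closure_normal[OF assms]] by blast

text \<open>Conjugates are mapped to conjugates; surjectivity provides a preimage of each
  conjugating element of \<open>H\<close>.\<close>

lemma (in group_hom) normal_closure_img:
  assumes "X \<subseteq> carrier G" "h ` carrier G = carrier H"
  shows "h ` normal_closure G (generate G X) = normal_closure H (generate H (h ` X))"
proof -
  let ?C = "{g \<otimes> x \<otimes> inv g |g x. g \<in> carrier G \<and> x \<in> generate G X}"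
  let ?D = "{g \<otimes>\<^bsub>H\<^esub> x \<otimes>\<^bsub>H\<^esub> inv\<^bsub>H\<^esub> g |g x. g \<in> carrier H \<and> x \<in> generate H (h ` X)}"
  have gX: "generate G X \<subseteq> carrier G"
    using G.generate_incl assms(1) by blast
  then have sub: "?C \<subseteq> carrier G" by auto
  have gen: "generate H (h ` X) = h ` generate G X"
    using generate_img[OF assms(1)] by simp
  have conj: "h (g \<otimes> x \<otimes> inv g) = h g \<otimes>\<^bsub>H\<^esub> h x \<otimes>\<^bsub>H\<^esub> inv\<^bsub>H\<^esub> h g"
    if "g \<in> carrier G" "x \<in> generate G X" for g x
    using that gX by (auto simp: subset_iff)
  have "h ` ?C = ?D"
    unfolding gen assms(2)[symmetric] using conj by (auto simp: image_iff) (metis conj)+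
  then show ?thesis
    unfolding normal_closure_def using generate_img[OF sub] by simp
qed

text \<open>Both closures live in generated subgroups, and \<open>h\<close> maps the subgroup
  generated by \<open>A\<close> onto the one generated by the image of \<open>A\<close>. The
  surjective case applies to this restriction.\<close>

lemma (in group_hom) relative_closure_img:
  assumes A: "A \<subseteq> carrier G" and X: "X \<subseteq> generate G A"
  shows "h ` relative_closure G A X = relative_closure H (h ` A) (h ` X)"
proof -
  let ?G = "G\<lparr>carrier := generate G A\<rparr>" and ?H = "H\<lparr>carrier := generate H (h ` A)\<rparr>"
  have hA: "h ` A \<subseteq> carrier H" using A by auto
  have img: "h ` generate G A = generate H (h ` A)"
    using generate_img[OF A] by simp
  have inc: "generate G A \<subseteq> carrier G" using G.generate_incl[OF A] .
  interpret E: group_hom ?G ?H h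
  proof (intro group_hom.intro group_hom_axioms.intro)
    show "group ?G" "group ?H"
      using G.generate_group[OF A] H.generate_group[OF hA] by auto
    show "h \<in> hom ?G ?H"
      using img inc by (force simp: hom_def subset_iff)
  qed
  show ?thesis
    unfolding relative_closure_def using E.normal_closure_img[of X] X img by simp
qed

lemma (in group) conj_hom:
  assumes "k \<in> carrier G"
  shows "group_hom G G (\<lambda>x. k \<otimes> x \<otimes> inv k)"
proof (intro group_hom.intro group_hom_axioms.intro is_group)
  show "(\<lambda>x. k \<otimes> x \<otimes> inv k) \<in> hom G G"
  proof (rule homI)
    fix x y assume xy: "x \<in> carrier G" "y \<in> carrier G"
    have "k \<otimes> x \<otimes> inv k \<otimes> (k \<otimes> y \<otimes> inv k) = k \<otimes> x \<otimes> (inv k \<otimes> k) \<otimes> y \<otimes> inv k"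
      using xy assms by (simp only: m_assoc m_closed inv_closed)
    then show "k \<otimes> (x \<otimes> y) \<otimes> inv k = k \<otimes> x \<otimes> inv k \<otimes> (k \<otimes> y \<otimes> inv k)"
      using xy assms by (simp add: m_assoc)
  qed (use assms in auto)
qed

text \<open>The closure of the conjugated generators is the conjugate of the closure, and the
  closure is normal in the subgroup that contains \<open>k\<close>.\<close>

lemma (in group) relative_closure_conj:
  assumes A: "A \<subseteq> carrier G" and X: "X \<subseteq> generate G A" and k: "k \<in> generate G A"
  shows "relative_closure G ((\<lambda>x. k \<otimes> x \<otimes> inv k) ` A) ((\<lambda>x. k \<otimes> x \<otimes> inv k) ` X)
    = relative_closure G A X"
proof -
  let ?c = "\<lambda>x. k \<otimes> x \<otimes> inv k" and ?K = "relative_closure G A X"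
  let ?E = "G\<lparr>carrier := generate G A\<rparr>"
  have kG: "k \<in> carrier G" using k generate_incl[OF A] by auto
  interpret c: group_hom G G ?c by (rule conj_hom[OF kG])
  interpret N: normal ?K ?E by (rule relative_closure_normal[OF A X])
  have inv: "inv\<^bsub>?E\<^esub> x = inv x" if "x \<in> generate G A" for x
    using m_inv_consistent[OF generate_is_subgroup[OF A] that] .
  have KG: "?K \<subseteq> carrier G" using relative_closure_subgroup[OF A X] subgroup.subset by blast
  have ik: "inv k \<in> generate G A" using generate_m_inv_closed[OF A k] .
  have cl: "?c x \<in> ?K" if "x \<in> ?K" for x
    using N.inv_op_closed2[of k x] that k by (simp add: inv)
  have cl': "inv k \<otimes> x \<otimes> k \<in> ?K" if "x \<in> ?K" for x
    using N.inv_op_closed1[of k x] that k by (simp add: inv)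
  have "?c ` ?K = ?K"
  proof (intro equalityI subsetI)
    fix x assume x: "x \<in> ?K"
    then have xG: "x \<in> carrier G" using KG by auto
    have "?c (inv k \<otimes> x \<otimes> k) = (k \<otimes> inv k) \<otimes> x \<otimes> (k \<otimes> inv k)"
      using kG xG by (simp only: m_assoc m_closed inv_closed)
    then have "x = ?c (inv k \<otimes> x \<otimes> k)" using kG xG by simp
    then show "x \<in> ?c ` ?K" using cl'[OF x] by blast
  qed (use cl in auto)
  then show ?thesis using c.relative_closure_img[OF A X] by simp
qed


section \<open>Modules with an alternating form\<close>

lemma module_homD:
  assumes "f \<in> module_hom R M N"
  shows "x \<in> carrier M \<Longrightarrow> f x \<in> carrier N"
    and "x \<in> carrier M \<Longrightarrow> y \<in> carrier M \<Longrightarrow> f (x \<oplus>\<^bsub>M\<^esub> y) = f x \<oplus>\<^bsub>N\<^esub> f y"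
    and "a \<in> carrier R \<Longrightarrow> x \<in> carrier M \<Longrightarrow> f (a \<odot>\<^bsub>M\<^esub> x) = a \<odot>\<^bsub>N\<^esub> f x"
    and "f \<in> extensional (carrier M)"
  using assms by (auto simp: module_hom_def PiE_def)

lemma module_homI:
  assumes "\<And>x. x \<in> carrier M \<Longrightarrow> f x \<in> carrier N"
    and "\<And>x y. x \<in> carrier M \<Longrightarrow> y \<in> carrier M \<Longrightarrow> f (x \<oplus>\<^bsub>M\<^esub> y) = f x \<oplus>\<^bsub>N\<^esub> f y"
    and "\<And>a x. a \<in> carrier R \<Longrightarrow> x \<in> carrier M \<Longrightarrow> f (a \<odot>\<^bsub>M\<^esub> x) = a \<odot>\<^bsub>N\<^esub> f x"
    and "f \<in> extensional (carrier M)"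
  shows "f \<in> module_hom R M N"
  using assms by (auto simp: module_hom_def PiE_def)

lemma module_hom_zero:
  assumes "Module.module R M" "Module.module R N" "f \<in> module_hom R M N"
  shows "f \<zero>\<^bsub>M\<^esub> = \<zero>\<^bsub>N\<^esub>"
proof -
  interpret M: Module.module R M by fact
  interpret N: Module.module R N by fact
  have "f (\<zero>\<^bsub>R\<^esub> \<odot>\<^bsub>M\<^esub> \<zero>\<^bsub>M\<^esub>) = \<zero>\<^bsub>R\<^esub> \<odot>\<^bsub>N\<^esub> f \<zero>\<^bsub>M\<^esub>"
    using module_homD(3)[OF assms(3)] by blast
  then show ?thesis using module_homD(1)[OF assms(3)] by simp
qed

lemma module_hom_finsum:
  assumes "Module.module R M" "Module.module R N" "f \<in> module_hom R M N"
    and "finite A" "g \<in> A \<rightarrow> carrier M"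
  shows "f (\<Oplus>\<^bsub>M\<^esub>i\<in>A. g i) = (\<Oplus>\<^bsub>N\<^esub>i\<in>A. f (g i))"
proof -
  interpret M: Module.module R M by fact
  interpret N: Module.module R N by fact
  note f = module_homD[OF assms(3)]
  show ?thesis using assms(4,5)
  proof (induction A rule: finite_induct)
    case empty
    then show ?case using module_hom_zero[OF assms(1-3)] by simp
  next
    case (insert a A)
    then have "(\<Oplus>\<^bsub>M\<^esub>i\<in>A. g i) \<in> carrier M" by (intro M.finsum_closed) auto
    with insert f show ?case by (auto simp: Pi_def)
  qed
qed

lemma isometry_iff:
  "f \<in> carrier (isometry_group R M F) \<longleftrightarrow> f \<in> module_hom R M M \<and>
     bij_betw f (carrier M) (carrier M) \<and> (\<forall>x\<in>carrier M. \<forall>y\<in>carrier M. F (f x) (f y) = F x y)"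
  by (auto simp: isometry_group_def Bij_def module_hom_def PiE_def)

lemma isometry_mult:
  assumes "f \<in> carrier (isometry_group R M F)" "g \<in> carrier (isometry_group R M F)"
  shows "f \<otimes>\<^bsub>isometry_group R M F\<^esub> g = compose (carrier M) f g"
  using assms by (auto simp: isometry_group_def BijGroup_def)

lemma isometry_one: "\<one>\<^bsub>isometry_group R M F\<^esub> = (\<lambda>x\<in>carrier M. x)"
  by (simp add: isometry_group_def BijGroup_def)

text \<open>The locale is instantiated by \<open>P\<close>, \<open>P[X]\<close>,
  \<open>P\<^sub>\<pp>\<close> and \<open>P\<^sub>\<pp>[X]\<close>. Nondegeneracy is only asked for
  as separation of points, which is also the main device for proving equations between vectors:
  paired with an arbitrary \<open>z\<close> they become identities in the ring. That functionals are
  represented by vectors is supplied separately, by dual bases and dual systems.\<close>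

locale form_module = Module.module R M
  for R :: "('a, 'm) ring_scheme" (structure) and M :: "('a, 'b, 'u) module_scheme" (structure) +
  fixes F :: "'b \<Rightarrow> 'b \<Rightarrow> 'a"
  assumes F_closed [simp, intro]: "x \<in> carrier M \<Longrightarrow> y \<in> carrier M \<Longrightarrow> F x y \<in> carrier R"
    and F_add_l [simp]: "x \<in> carrier M \<Longrightarrow> y \<in> carrier M \<Longrightarrow> z \<in> carrier M \<Longrightarrow>
      F (x \<oplus>\<^bsub>M\<^esub> y) z = F x z \<oplus> F y z"
    and F_add_r [simp]: "x \<in> carrier M \<Longrightarrow> y \<in> carrier M \<Longrightarrow> z \<in> carrier M \<Longrightarrow>
      F z (x \<oplus>\<^bsub>M\<^esub> y) = F z x \<oplus> F z y"
    and F_smult_l [simp]: "a \<in> carrier R \<Longrightarrow> x \<in> carrier M \<Longrightarrow> y \<in> carrier M \<Longrightarrow>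
      F (a \<odot>\<^bsub>M\<^esub> x) y = a \<otimes> F x y"
    and F_smult_r [simp]: "a \<in> carrier R \<Longrightarrow> x \<in> carrier M \<Longrightarrow> y \<in> carrier M \<Longrightarrow>
      F x (a \<odot>\<^bsub>M\<^esub> y) = a \<otimes> F x y"
    and F_alt [simp]: "x \<in> carrier M \<Longrightarrow> F x x = \<zero>"
    and F_nondegenerate: "x \<in> carrier M \<Longrightarrow> y \<in> carrier M \<Longrightarrow>
      (\<And>z. z \<in> carrier M \<Longrightarrow> F z x = F z y) \<Longrightarrow> x = y"
begin

lemma is_module: "Module.module R M" ..

lemma F_zero [simp]:
  assumes "x \<in> carrier M"
  shows "F \<zero>\<^bsub>M\<^esub> x = \<zero>" "F x \<zero>\<^bsub>M\<^esub> = \<zero>"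
  using F_smult_l[of \<zero> "\<zero>\<^bsub>M\<^esub>" x] F_smult_r[of \<zero> x "\<zero>\<^bsub>M\<^esub>"] assms by auto

lemma F_minus [simp]:
  assumes "x \<in> carrier M" "y \<in> carrier M"
  shows "F (\<ominus>\<^bsub>M\<^esub> x) y = \<ominus> F x y" "F y (\<ominus>\<^bsub>M\<^esub> x) = \<ominus> F y x"
proof -
  have "F (\<ominus>\<^bsub>M\<^esub> x) y \<oplus> F x y = \<zero>" "F y (\<ominus>\<^bsub>M\<^esub> x) \<oplus> F y x = \<zero>"
    using assms by (simp_all add: F_add_l[symmetric] F_add_r[symmetric] M.l_neg del: F_add_l F_add_r)
  then show "F (\<ominus>\<^bsub>M\<^esub> x) y = \<ominus> F x y" "F y (\<ominus>\<^bsub>M\<^esub> x) = \<ominus> F y x"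
    using assms by (simp_all add: R.minus_equality)
qed

lemma F_skew:
  assumes "x \<in> carrier M" "y \<in> carrier M"
  shows "F y x = \<ominus> F x y"
proof -
  have "F (y \<oplus>\<^bsub>M\<^esub> x) (y \<oplus>\<^bsub>M\<^esub> x) = F y y \<oplus> F x y \<oplus> (F y x \<oplus> F x x)"
    using assms by (simp del: F_alt)
  then have "\<zero> = F x y \<oplus> F y x"
    using assms by simp
  then show ?thesis using assms by (metis F_closed R.minus_equality R.a_comm)
qed

lemma F_finsum_l:
  assumes "finite A" "g \<in> A \<rightarrow> carrier M" "y \<in> carrier M"
  shows "F (\<Oplus>\<^bsub>M\<^esub>i\<in>A. g i) y = (\<Oplus>i\<in>A. F (g i) y)"
  using assms by (induction A rule: finite_induct) (auto simp: Pi_def)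

lemma F_finsum_r:
  assumes "finite A" "g \<in> A \<rightarrow> carrier M" "y \<in> carrier M"
  shows "F y (\<Oplus>\<^bsub>M\<^esub>i\<in>A. g i) = (\<Oplus>i\<in>A. F y (g i))"
  using assms by (induction A rule: finite_induct) (auto simp: Pi_def)

abbreviation Iso where "Iso \<equiv> isometry_group R M F"

lemma isometry_group: "group Iso"
proof -
  let ?H = "carrier Iso"
  interpret B: group "BijGroup (carrier M)" by (rule group_BijGroup)
  have sub: "subgroup ?H (BijGroup (carrier M))"
  proof (rule B.subgroupI)
    show "?H \<subseteq> carrier (BijGroup (carrier M))"
      by (auto simp: isometry_group_def BijGroup_def)
    have "(\<lambda>x\<in>carrier M. x) \<in> ?H"
      by (auto simp: isometry_iff module_hom_def bij_betw_def inj_on_def)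
    then show "?H \<noteq> {}" by blast
  next
    fix f assume f: "f \<in> ?H"
    then have hom: "f \<in> module_hom R M M" and bij: "bij_betw f (carrier M) (carrier M)"
      and iso: "\<And>x y. x \<in> carrier M \<Longrightarrow> y \<in> carrier M \<Longrightarrow> F (f x) (f y) = F x y"
      by (auto simp: isometry_iff)
    have fB: "f \<in> Bij (carrier M)" using f by (simp add: isometry_group_def)
    let ?g = "\<lambda>x\<in>carrier M. inv_into (carrier M) f x"
    have g: "?g x \<in> carrier M" "f (?g x) = x" if "x \<in> carrier M" for x
      using that bij by (auto simp: bij_betw_def inv_into_into f_inv_into_f)
    have gu: "?g x = y" if "y \<in> carrier M" "f y = x" for x y
      using that bij by (auto simp: bij_betw_def inv_into_f_f)
    note fl = module_homD[OF hom]
    have "?g \<in> ?H"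
      unfolding isometry_iff
    proof (intro conjI ballI)
      show "?g \<in> module_hom R M M"
      proof (rule module_homI)
        show "?g (x \<oplus>\<^bsub>M\<^esub> y) = ?g x \<oplus>\<^bsub>M\<^esub> ?g y" if "x \<in> carrier M" "y \<in> carrier M" for x y
          using that g fl by (intro gu) (auto simp del: restrict_apply)
        show "?g (a \<odot>\<^bsub>M\<^esub> x) = a \<odot>\<^bsub>M\<^esub> ?g x" if "a \<in> carrier R" "x \<in> carrier M" for x a
          using that g fl by (intro gu) (auto simp del: restrict_apply)
      qed (use g in auto)
      show "bij_betw ?g (carrier M) (carrier M)"
        using restrict_inv_into_Bij[OF fB] by (simp add: Bij_def)
      show "F (?g x) (?g y) = F x y" if "x \<in> carrier M" "y \<in> carrier M" for x y
        using iso[of "?g x" "?g y"] g that by simp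
    qed
    then show "inv\<^bsub>BijGroup (carrier M)\<^esub> f \<in> ?H"
      using inv_BijGroup[OF fB] by simp
  next
    fix f g assume f: "f \<in> ?H" and g: "g \<in> ?H"
    have "compose (carrier M) f g \<in> ?H"
      using f g unfolding isometry_iff
      by (auto simp: module_hom_def bij_betw_compose PiE_def Pi_def compose_eq)
    then show "f \<otimes>\<^bsub>BijGroup (carrier M)\<^esub> g \<in> ?H"
      using f g by (simp add: isometry_group_def BijGroup_def)
  qed
  have eq: "Iso = BijGroup (carrier M)\<lparr>carrier := ?H\<rparr>" by (simp add: isometry_group_def)
  show ?thesis using subgroup.subgroup_is_group[OF sub group_BijGroup] by (simp only: eq[symmetric])
qed

sublocale I: group Iso by (rule isometry_group)

lemma isometryD:
  assumes "f \<in> carrier Iso"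
  shows "x \<in> carrier M \<Longrightarrow> f x \<in> carrier M"
    and "x \<in> carrier M \<Longrightarrow> y \<in> carrier M \<Longrightarrow> f (x \<oplus>\<^bsub>M\<^esub> y) = f x \<oplus>\<^bsub>M\<^esub> f y"
    and "a \<in> carrier R \<Longrightarrow> x \<in> carrier M \<Longrightarrow> f (a \<odot>\<^bsub>M\<^esub> x) = a \<odot>\<^bsub>M\<^esub> f x"
    and "x \<in> carrier M \<Longrightarrow> y \<in> carrier M \<Longrightarrow> F (f x) (f y) = F x y"
    and "f \<in> extensional (carrier M)"
  using assms by (auto simp: isometry_iff module_hom_def PiE_def)

lemma isometry_inv:
  assumes "f \<in> carrier Iso" "x \<in> carrier M"
  shows "f ((inv\<^bsub>Iso\<^esub> f) x) = x" "(inv\<^bsub>Iso\<^esub> f) (f x) = x"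
proof -
  have "compose (carrier M) f (inv\<^bsub>Iso\<^esub> f) = (\<lambda>x\<in>carrier M. x)"
    "compose (carrier M) (inv\<^bsub>Iso\<^esub> f) f = (\<lambda>x\<in>carrier M. x)"
    using isometry_mult[of f R M F "inv\<^bsub>Iso\<^esub> f"] isometry_mult[of "inv\<^bsub>Iso\<^esub> f" R M F f] assms(1)
    by (simp_all add: isometry_one)
  then show "f ((inv\<^bsub>Iso\<^esub> f) x) = x" "(inv\<^bsub>Iso\<^esub> f) (f x) = x"
    using assms(2) by (metis compose_eq restrict_apply')+
qed

lemma isometry_mult_apply:
  assumes "f \<in> carrier Iso" "g \<in> carrier Iso" "x \<in> carrier M"
  shows "(f \<otimes>\<^bsub>Iso\<^esub> g) x = f (g x)"
  using assms by (simp add: isometry_mult compose_def)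

end

section \<open>Transvections\<close>

context form_module
begin

text \<open>The Eichler-Siegel transvection for an alternating form; it is an isometry when
  \<open>w\<close> is orthogonal to \<open>D\<close>. For \<open>w = 0\<close> it is the classical
  symplectic transvection \<open>y \<mapsto> y + c\<langle>D,y\<rangle>D\<close>.\<close>

definition transvection where
  "transvection D w c =
     (\<lambda>y\<in>carrier M. y \<oplus>\<^bsub>M\<^esub> (F D y \<odot>\<^bsub>M\<^esub> w \<oplus>\<^bsub>M\<^esub> (F w y \<oplus> c \<otimes> F D y) \<odot>\<^bsub>M\<^esub> D))"

lemma transvection_apply:
  "y \<in> carrier M \<Longrightarrow> transvection D w c y
    = y \<oplus>\<^bsub>M\<^esub> (F D y \<odot>\<^bsub>M\<^esub> w \<oplus>\<^bsub>M\<^esub> (F w y \<oplus> c \<otimes> F D y) \<odot>\<^bsub>M\<^esub> D)"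
  by (simp add: transvection_def)

lemma transvection_closed [simp]:
  assumes "D \<in> carrier M" "w \<in> carrier M" "c \<in> carrier R" "y \<in> carrier M"
  shows "transvection D w c y \<in> carrier M"
  using assms by (simp add: transvection_apply)

text \<open>The parameters \<open>(w, c)\<close> multiply as in a Heisenberg group whose cocycle is
  the form itself. The cocycle vanishes on \<open>w\<close> and \<open>- w\<close>, which gives the
  inverses below.\<close>

lemma transvection_compose:
  assumes "D \<in> carrier M" "w \<in> carrier M" "w' \<in> carrier M" "c \<in> carrier R" "c' \<in> carrier R"
    and "F D w = \<zero>" "F D w' = \<zero>" "y \<in> carrier M"
  shows "transvection D w c (transvection D w' c' y)
    = transvection D (w \<oplus>\<^bsub>M\<^esub> w') (c \<oplus> c' \<oplus> F w w') y"
proof (rule F_nondegenerate)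
  fix z assume z: "z \<in> carrier M"
  have wD: "F w D = \<zero>" "F w' D = \<zero>" using assms F_skew[of D w] F_skew[of D w'] by simp_all
  show "F z (transvection D w c (transvection D w' c' y))
    = F z (transvection D (w \<oplus>\<^bsub>M\<^esub> w') (c \<oplus> c' \<oplus> F w w') y)"
    using assms z wD by (simp add: transvection_apply R.l_distr R.r_distr R.a_ac R.m_ac)
qed (use assms in auto)

lemma transvection_form:
  assumes "D \<in> carrier M" "w \<in> carrier M" "c \<in> carrier R" "F D w = \<zero>" "x \<in> carrier M" "y \<in> carrier M"
  shows "F (transvection D w c x) (transvection D w c y) = F x y"
proof -
  have wD: "F w D = \<zero>" using assms F_skew[of D w] by simp
  \<comment> \<open>Here \<open>k = F x y\<close>, while \<open>a, b\<close> are the pairings of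
    \<open>D\<close> and \<open>p, q\<close> those of \<open>w\<close> with \<open>x\<close> and
    \<open>y\<close>. The second bracket comes from the part of the image of \<open>y\<close> and
    carries the signs of skew symmetry.\<close>
  have ring: "k \<oplus> (a \<otimes> q \<oplus> (p \<oplus> c \<otimes> a) \<otimes> b) \<oplus>
      (b \<otimes> (\<ominus> p) \<oplus> (q \<oplus> c \<otimes> b) \<otimes> (\<ominus> a)) = k"
    if "k \<in> carrier R" "a \<in> carrier R" "b \<in> carrier R" "p \<in> carrier R" "q \<in> carrier R" for k a b p q
    using that assms(3) by algebra
  show ?thesis
    using ring[of "F x y" "F D x" "F D y" "F w x" "F w y"] assms wD F_skew[of D x] F_skew[of w x]
    by (simp add: transvection_apply)
qed

lemma transvection_zero:
  assumes "D \<in> carrier M" "y \<in> carrier M"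
  shows "transvection D \<zero>\<^bsub>M\<^esub> \<zero> y = y"
  using assms by (simp add: transvection_apply)

lemma transvection_inverse:
  assumes "D \<in> carrier M" "w \<in> carrier M" "c \<in> carrier R" "F D w = \<zero>" "y \<in> carrier M"
  shows "transvection D w c (transvection D (\<ominus>\<^bsub>M\<^esub> w) (\<ominus> c) y) = y"
    and "transvection D (\<ominus>\<^bsub>M\<^esub> w) (\<ominus> c) (transvection D w c y) = y"
  using assms by (simp_all add: transvection_compose M.r_neg M.l_neg R.r_neg R.l_neg transvection_zero)

lemma transvection_isometry:
  assumes "D \<in> carrier M" "w \<in> carrier M" "c \<in> carrier R" "F D w = \<zero>"
  shows "transvection D w c \<in> carrier Iso"
  unfolding isometry_iff
proof (intro conjI ballI)
  show "transvection D w c \<in> module_hom R M M"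
  proof (rule module_homI)
    fix x y assume xy: "x \<in> carrier M" "y \<in> carrier M"
    show "transvection D w c (x \<oplus>\<^bsub>M\<^esub> y) = transvection D w c x \<oplus>\<^bsub>M\<^esub> transvection D w c y"
      by (rule F_nondegenerate)
        (use xy assms in \<open>simp_all add: transvection_apply R.l_distr R.r_distr R.a_ac\<close>)
  next
    fix a x assume ax: "a \<in> carrier R" "x \<in> carrier M"
    show "transvection D w c (a \<odot>\<^bsub>M\<^esub> x) = a \<odot>\<^bsub>M\<^esub> transvection D w c x"
      by (rule F_nondegenerate)
        (use ax assms in \<open>simp_all add: transvection_apply R.l_distr R.r_distr R.a_ac R.m_ac\<close>)
  qed (use assms in \<open>auto simp: transvection_def\<close>)
  show "bij_betw (transvection D w c) (carrier M) (carrier M)"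
    by (rule bij_betw_byWitness[where f' = "transvection D (\<ominus>\<^bsub>M\<^esub> w) (\<ominus> c)"])
      (use assms in \<open>auto simp: transvection_inverse\<close>)
qed (use assms in \<open>auto simp: transvection_form\<close>)

text \<open>That all \<open>F w y\<close> lie in \<open>J\<close> says, without a basis, that
  \<open>w\<close> lies in \<open>J M\<close>: relative to a dual basis it means that the
  coordinates of \<open>w\<close> are in \<open>J\<close>.\<close>

definition transvections where
  "transvections D J = {transvection D w c | w c. w \<in> carrier M \<and> F D w = \<zero> \<and>
     (\<forall>y\<in>carrier M. F w y \<in> J) \<and> c \<in> J \<inter> carrier R}"

lemma transvectionsI:
  assumes "w \<in> carrier M" "F D w = \<zero>" "\<And>y. y \<in> carrier M \<Longrightarrow> F w y \<in> J" "c \<in> J" "c \<in> carrier R"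
  shows "transvection D w c \<in> transvections D J"
  using assms by (auto simp: transvections_def)

lemma transvections_subset: "D \<in> carrier M \<Longrightarrow> transvections D J \<subseteq> carrier Iso"
  by (auto simp: transvections_def transvection_isometry)

lemma transvections_mono:
  "J \<subseteq> K \<Longrightarrow> transvections D J \<subseteq> transvections D K"
  by (fastforce simp: transvections_def)

text \<open>The inverse of an isometry is its adjoint, so the functionals given by \<open>D\<close>
  and \<open>w\<close>, composed with the inverse of \<open>h\<close>, are those given by
  \<open>h D\<close> and \<open>h w\<close>.\<close>

lemma transvection_conj:
  assumes "h \<in> carrier Iso" "D \<in> carrier M" "w \<in> carrier M" "c \<in> carrier R" "F D w = \<zero>"
  shows "h \<otimes>\<^bsub>Iso\<^esub> transvection D w c \<otimes>\<^bsub>Iso\<^esub> inv\<^bsub>Iso\<^esub> h = transvection (h D) (h w) c"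
proof
  fix y
  let ?T = "transvection D w c" and ?k = "inv\<^bsub>Iso\<^esub> h"
  have T: "?T \<in> carrier Iso" and k: "?k \<in> carrier Iso"
    using transvection_isometry assms by auto
  note hD = isometryD[OF assms(1)] and kD = isometryD[OF k]
  have hh: "F (h x) z = F x (?k z)" if "x \<in> carrier M" "z \<in> carrier M" for x z
    using hD(4)[of x "?k z"] isometry_inv(1)[OF assms(1) that(2)] kD(1) that by simp
  show "(h \<otimes>\<^bsub>Iso\<^esub> ?T \<otimes>\<^bsub>Iso\<^esub> ?k) y = transvection (h D) (h w) c y"
  proof (cases "y \<in> carrier M")
    case True
    then have "(h \<otimes>\<^bsub>Iso\<^esub> ?T \<otimes>\<^bsub>Iso\<^esub> ?k) y = h (?T (?k y))"
      using assms T k kD(1) by (simp add: isometry_mult_apply)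
    also have "\<dots> = transvection (h D) (h w) c y"
      using True assms hD kD(1) by (simp add: transvection_apply isometry_inv hh)
    finally show ?thesis .
  next
    case False
    have "h \<otimes>\<^bsub>Iso\<^esub> ?T \<otimes>\<^bsub>Iso\<^esub> ?k \<in> carrier Iso" using assms T k by simp
    from isometryD(5)[OF this] False show ?thesis
      by (simp add: extensional_def transvection_def)
  qed
qed

lemma transvections_conj:
  assumes h: "h \<in> carrier Iso" and D: "D \<in> carrier M"
  shows "(\<lambda>x. h \<otimes>\<^bsub>Iso\<^esub> x \<otimes>\<^bsub>Iso\<^esub> inv\<^bsub>Iso\<^esub> h) ` transvections D J = transvections (h D) J"
proof -
  let ?k = "inv\<^bsub>Iso\<^esub> h"
  have k: "?k \<in> carrier Iso" using h by auto
  note hD = isometryD[OF h] and kD = isometryD[OF k] and hk = isometry_inv[OF h]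
  have adj: "F (h x) z = F x (?k z)" if "x \<in> carrier M" "z \<in> carrier M" for x z
    using hD(4)[of x "?k z"] hk(1)[OF that(2)] kD(1) that by simp
  have adj': "F (?k x) z = F x (h z)" if "x \<in> carrier M" "z \<in> carrier M" for x z
    using adj[of "?k x" "h z"] hk(1)[OF that(1)] hk(2)[OF that(2)] kD(1) hD(1) that by simp
  show ?thesis
  proof (intro equalityI subsetI)
    fix x assume "x \<in> (\<lambda>x. h \<otimes>\<^bsub>Iso\<^esub> x \<otimes>\<^bsub>Iso\<^esub> ?k) ` transvections D J"
    then obtain w c where w: "w \<in> carrier M" "F D w = \<zero>" "\<forall>y\<in>carrier M. F w y \<in> J" "c \<in> J" "c \<in> carrier R"
      and x: "x = h \<otimes>\<^bsub>Iso\<^esub> transvection D w c \<otimes>\<^bsub>Iso\<^esub> ?k"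
      by (auto simp: transvections_def)
    have "x = transvection (h D) (h w) c" using x transvection_conj h D w by simp
    moreover have "h w \<in> carrier M" "F (h D) (h w) = \<zero>" "\<forall>y\<in>carrier M. F (h w) y \<in> J"
      using hD(1,4) w D kD(1) by (auto simp: adj)
    ultimately show "x \<in> transvections (h D) J" using w by (auto simp: transvections_def)
  next
    fix x assume "x \<in> transvections (h D) J"
    then obtain w c where w: "w \<in> carrier M" "F (h D) w = \<zero>" "\<forall>y\<in>carrier M. F w y \<in> J" "c \<in> J" "c \<in> carrier R"
      and x: "x = transvection (h D) w c"
      by (auto simp: transvections_def)
    have w': "?k w \<in> carrier M" "F D (?k w) = \<zero>" "\<forall>y\<in>carrier M. F (?k w) y \<in> J"
      using w D hD(1) kD(1) by (auto simp: adj' adj)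
    then have "x = h \<otimes>\<^bsub>Iso\<^esub> transvection D (?k w) c \<otimes>\<^bsub>Iso\<^esub> ?k"
      using transvection_conj[OF h D w'(1) w(5) w'(2)] hk(1)[OF w(1)] x by simp
    moreover have "transvection D (?k w) c \<in> transvections D J"
      using w' w by (auto simp: transvections_def)
    ultimately show "x \<in> (\<lambda>x. h \<otimes>\<^bsub>Iso\<^esub> x \<otimes>\<^bsub>Iso\<^esub> ?k) ` transvections D J" by blast
  qed
qed

text \<open>\<open>D\<close> occurs once next to \<open>w\<close> and twice next to
  \<open>c\<close>, so a scalar moves from \<open>D\<close> to \<open>w\<close> linearly and to
  \<open>c\<close> as its square. If it is a unit, the set of transvections depends on the line
  through \<open>D\<close> only.\<close>

lemma transvection_smult:
  assumes "a \<in> carrier R" "D \<in> carrier M" "w \<in> carrier M" "c \<in> carrier R"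
  shows "transvection (a \<odot>\<^bsub>M\<^esub> D) w c = transvection D (a \<odot>\<^bsub>M\<^esub> w) (a \<otimes> a \<otimes> c)"
proof
  fix y
  show "transvection (a \<odot>\<^bsub>M\<^esub> D) w c y = transvection D (a \<odot>\<^bsub>M\<^esub> w) (a \<otimes> a \<otimes> c) y"
  proof (cases "y \<in> carrier M")
    case True
    show ?thesis
      by (rule F_nondegenerate)
        (use True assms in \<open>simp_all add: transvection_apply R.l_distr R.r_distr R.a_ac R.m_ac\<close>)
  qed (simp add: transvection_def)
qed

lemma transvections_smult_subset:
  assumes "ideal J R" "a \<in> Units R" "D \<in> carrier M"
  shows "transvections (a \<odot>\<^bsub>M\<^esub> D) J \<subseteq> transvections D J"
proof
  interpret J: ideal J R by fact
  have a: "a \<in> carrier R" using assms by auto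
  fix x assume "x \<in> transvections (a \<odot>\<^bsub>M\<^esub> D) J"
  then obtain w c where w: "w \<in> carrier M" "F (a \<odot>\<^bsub>M\<^esub> D) w = \<zero>" "\<forall>y\<in>carrier M. F w y \<in> J" "c \<in> J" "c \<in> carrier R"
    and x: "x = transvection (a \<odot>\<^bsub>M\<^esub> D) w c"
    by (auto simp: transvections_def)
  have "F D (a \<odot>\<^bsub>M\<^esub> w) = \<zero>" using w a assms by simp
  moreover have "\<forall>y\<in>carrier M. F (a \<odot>\<^bsub>M\<^esub> w) y \<in> J" "a \<otimes> a \<otimes> c \<in> J"
    using w a by (auto simp: J.I_l_closed)
  ultimately show "x \<in> transvections D J"
    unfolding x transvection_smult[OF a assms(3) w(1) w(5)]
    using w a by (intro transvectionsI) auto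
qed

lemma transvections_smult:
  assumes "ideal J R" "a \<in> Units R" "D \<in> carrier M"
  shows "transvections (a \<odot>\<^bsub>M\<^esub> D) J = transvections D J"
proof
  have a: "a \<in> carrier R" using assms by auto
  have "transvections (inv a \<odot>\<^bsub>M\<^esub> (a \<odot>\<^bsub>M\<^esub> D)) J \<subseteq> transvections (a \<odot>\<^bsub>M\<^esub> D) J"
    using assms a by (intro transvections_smult_subset) auto
  then show "transvections D J \<subseteq> transvections (a \<odot>\<^bsub>M\<^esub> D) J"
    using assms a by (simp add: smult_assoc1[symmetric])
qed (rule transvections_smult_subset[OF assms])

definition pair_gens where
  "pair_gens D e J = transvections D J \<union> transvections e J"

text \<open>The counterpart of \<open>ESp_rel\<close> without matrices; for a basis \<open>b\<close>
  with dual basis \<open>D\<close> it is taken at the vectors \<open>D 0\<close> and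
  \<open>b 0\<close>.\<close>

definition elementary where
  "elementary D e J = relative_closure Iso (pair_gens D e (carrier R)) (pair_gens D e J)"

lemma pair_gens_subset:
  "D \<in> carrier M \<Longrightarrow> e \<in> carrier M \<Longrightarrow> pair_gens D e J \<subseteq> carrier Iso"
  using transvections_subset by (auto simp: pair_gens_def)

lemma pair_gens_generate:
  assumes "ideal J R"
  shows "pair_gens D e J \<subseteq> generate Iso (pair_gens D e (carrier R))"
proof -
  have "J \<subseteq> carrier R" using ideal.Icarr[OF assms] by auto
  then have "pair_gens D e J \<subseteq> pair_gens D e (carrier R)"
    using transvections_mono[of J "carrier R"] by (auto simp: pair_gens_def)
  then show ?thesis by (auto intro: generate.incl)
qed

lemma elementary_commute: "elementary D e J = elementary e D J"
  by (simp add: elementary_def pair_gens_def Un_commute)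

lemma elementary_smult:
  assumes "ideal J R" "a \<in> Units R" "D \<in> carrier M"
  shows "elementary (a \<odot>\<^bsub>M\<^esub> D) e J = elementary D e J"
  using transvections_smult[OF assms] transvections_smult[OF R.oneideal assms(2,3)]
  by (simp add: elementary_def pair_gens_def)

text \<open>A transvection along \<open>e\<close> fixes \<open>e\<close> and moves \<open>D\<close> to \<open>D'\<close>.\<close>

lemma elementary_change_one:
  assumes J: "ideal J R" and "D \<in> carrier M" "D' \<in> carrier M" "e \<in> carrier M"
    and De: "F D e = \<one>" "F D' e = \<one>"
  shows "elementary D' e J = elementary D e J"
proof -
  note M = assms(2-4)
  \<comment> \<open>\<open>?w\<close> is orthogonal to \<open>e\<close> because \<open>D\<close> and
    \<open>D'\<close> have the same pairing with \<open>e\<close>. As \<open>F e D = -1\<close>, the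
    vector \<open>D\<close> goes to \<open>D - ?w\<close> plus the multiple
    \<open>F ?w D - ?c\<close> of \<open>e\<close>, and \<open>?c\<close> is chosen to cancel this
    multiple.\<close>
  let ?w = "D \<oplus>\<^bsub>M\<^esub> (\<ominus>\<^bsub>M\<^esub> D')"
  let ?c = "F ?w D"
  let ?h = "transvection e ?w ?c"
  have ew: "F e ?w = \<zero>" using M De F_skew[of D e] F_skew[of D' e] by (simp add: R.l_neg)
  have h: "?h \<in> carrier Iso" using M ew by (intro transvection_isometry) auto
  have we: "F ?w e = \<zero>" using M De by (simp add: R.r_neg)
  have eD: "F e D = \<ominus> \<one>" using M De F_skew[of D e] by simp
  have he: "?h e = e" using M we by (simp add: transvection_apply)
  have hD: "?h D = D'"
  proof -
    have "?c \<oplus> ?c \<otimes> \<ominus> \<one> = \<zero>" using M by (simp add: R.r_minus R.r_neg R.l_neg)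
    then have "?h D = D \<oplus>\<^bsub>M\<^esub> ((\<ominus> \<one>) \<odot>\<^bsub>M\<^esub> ?w \<oplus>\<^bsub>M\<^esub> \<zero> \<odot>\<^bsub>M\<^esub> e)"
      using M eD by (simp only: transvection_apply)
    also have "\<dots> = D'"
      using M by (intro F_nondegenerate) (simp_all add: R.l_minus R.minus_add R.l_neg R.a_assoc[symmetric] R.r_neg)
    finally show ?thesis .
  qed
  \<comment> \<open>The entries of \<open>?h\<close> need not lie in \<open>J\<close>. It suffices
    that \<open>?h\<close> belongs to the absolute elementary group, in which the relative one is
    normal.\<close>
  have gen: "?h \<in> generate Iso (pair_gens D e (carrier R))"
    unfolding pair_gens_def using M ew by (intro generate.incl UnI2 transvectionsI) auto
  have "pair_gens D' e K = (\<lambda>x. ?h \<otimes>\<^bsub>Iso\<^esub> x \<otimes>\<^bsub>Iso\<^esub> inv\<^bsub>Iso\<^esub> ?h) ` pair_gens D e K" for K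
    unfolding pair_gens_def image_Un
    by (simp only: transvections_conj[OF h M(1)] transvections_conj[OF h M(3)] hD he)
  then show ?thesis
    unfolding elementary_def
    using I.relative_closure_conj[OF pair_gens_subset[OF M(1,3)] pair_gens_generate[OF J] gen] by simp
qed

lemma elementary_change_unit:
  assumes J: "ideal J R" and M: "D \<in> carrier M" "D' \<in> carrier M" "e \<in> carrier M"
    and De: "F D e \<in> Units R" "F D' e \<in> Units R"
  shows "elementary D' e J = elementary D e J"
proof -
  have "elementary (inv (F D' e) \<odot>\<^bsub>M\<^esub> D') e J = elementary (inv (F D e) \<odot>\<^bsub>M\<^esub> D) e J"
    using M De by (intro elementary_change_one[OF J]) auto
  then show ?thesis using elementary_smult[OF J] M De by simp
qed

text \<open>The chain is \<open>(D, e)\<close>, \<open>(D, x)\<close>, \<open>(D', x)\<close>,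
  \<open>(D', e')\<close>. Each step replaces one vector, while the other one pairs to units with
  the old and the new vector. By skew symmetry it does not matter which of the two places is
  changed.\<close>

lemma elementary_change_pair:
  assumes J: "ideal J R" and M: "D \<in> carrier M" "e \<in> carrier M" "D' \<in> carrier M" "e' \<in> carrier M" "x \<in> carrier M"
    and De: "F D e \<in> Units R" "F D' e' \<in> Units R" "F D x \<in> Units R" "F D' x \<in> Units R"
  shows "elementary D e J = elementary D' e' J"
proof -
  have unit: "F y z \<in> Units R" if "F z y \<in> Units R" "y \<in> carrier M" "z \<in> carrier M" for y z
    using F_skew[of z y] that by (metis R.Units_minus_one_closed R.Units_m_closed F_closed R.l_minus R.l_one R.one_closed)
  have "elementary D e J = elementary D x J"
    using elementary_change_unit[of J x e D] J M De unit elementary_commute by metis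
  also have "\<dots> = elementary D' x J"
    using elementary_change_unit[of J D' D x] J M De by metis
  also have "\<dots> = elementary D' e' J"
    using elementary_change_unit[of J e' x D'] J M De unit elementary_commute by metis
  finally show ?thesis .
qed

text \<open>If \<open>e'\<close> fails for \<open>D\<close> and \<open>e\<close> fails for
  \<open>D'\<close>, then \<open>e + e'\<close> works for both, its pairings being sums of a unit
  and a nonunit.\<close>

lemma common_unit:
  assumes loc: "\<And>a b. a \<in> carrier R \<Longrightarrow> b \<in> carrier R \<Longrightarrow> a \<oplus> b \<in> Units R \<Longrightarrow> a \<in> Units R \<or> b \<in> Units R"
    and M: "D \<in> carrier M" "e \<in> carrier M" "D' \<in> carrier M" "e' \<in> carrier M"
    and De: "F D e \<in> Units R" "F D' e' \<in> Units R"
  shows "\<exists>x\<in>carrier M. F D x \<in> Units R \<and> F D' x \<in> Units R"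
proof -
  \<comment> \<open>Otherwise the unit \<open>a = (a + b) - b\<close> would be a sum of two
    nonunits.\<close>
  have sum: "a \<oplus> b \<in> Units R" if "a \<in> Units R" "b \<in> carrier R" "b \<notin> Units R" for a b
  proof -
    have "a = (a \<oplus> b) \<oplus> \<ominus> b" using that R.Units_closed by (simp add: R.a_assoc R.r_neg)
    then have "a \<oplus> b \<in> Units R \<or> \<ominus> b \<in> Units R" using loc[of "a \<oplus> b" "\<ominus> b"] that R.Units_closed by auto
    moreover have "\<ominus> b \<notin> Units R"
      using that by (metis R.Units_minus_one_closed R.Units_m_closed R.l_minus R.l_one R.minus_minus R.one_closed R.a_inv_closed)
    ultimately show ?thesis by blast
  qed
  consider "F D e' \<in> Units R" | "F D' e \<in> Units R" | "F D e' \<notin> Units R" "F D' e \<notin> Units R" by blast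
  then show ?thesis
  proof cases
    case 3
    then have "F D (e \<oplus>\<^bsub>M\<^esub> e') \<in> Units R" "F D' (e \<oplus>\<^bsub>M\<^esub> e') \<in> Units R"
      using sum[of "F D e" "F D e'"] sum[of "F D' e'" "F D' e"] M De by (auto simp: R.a_comm)
    then show ?thesis using M by blast
  qed (use M De in auto)
qed

end

section \<open>Matrices over a commutative ring\<close>

lemma (in abelian_monoid) finsum_swap:
  assumes "finite A" "finite B" "\<And>i j. i \<in> A \<Longrightarrow> j \<in> B \<Longrightarrow> f i j \<in> carrier G"
  shows "(\<Oplus>i\<in>A. \<Oplus>j\<in>B. f i j) = (\<Oplus>j\<in>B. \<Oplus>i\<in>A. f i j)"
  using assms(1,3)
proof (induction A rule: finite_induct)
  case (insert a A)
  have "(\<Oplus>j\<in>B. \<Oplus>i\<in>insert a A. f i j) = (\<Oplus>j\<in>B. f a j \<oplus> (\<Oplus>i\<in>A. f i j))"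
    using insert by (intro finsum_eqI) (auto simp: Pi_def)
  also have "\<dots> = (\<Oplus>j\<in>B. f a j) \<oplus> (\<Oplus>j\<in>B. \<Oplus>i\<in>A. f i j)"
    using insert by (intro finsum_addf) (auto intro!: finsum_closed)
  finally show ?case using insert by (subst finsum_insert) (auto intro!: finsum_closed)
qed simp

lemma (in abelian_monoid) finsum_lessThan_Suc2:
  assumes "f \<in> {..<Suc m} \<rightarrow> carrier G"
  shows "(\<Oplus>i\<in>{..<Suc m}. f i) = f 0 \<oplus> (\<Oplus>i\<in>{..<m}. f (Suc i))"
proof -
  have "(\<Oplus>i\<in>insert 0 (Suc ` {..<m}). f i) = f 0 \<oplus> (\<Oplus>i\<in>Suc ` {..<m}. f i)"
    using assms by (subst finsum_insert) auto
  also have "(\<Oplus>i\<in>Suc ` {..<m}. f i) = (\<Oplus>i\<in>{..<m}. f (Suc i))"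
    using assms by (intro finsum_reindex) auto
  finally show ?thesis by (simp add: lessThan_Suc_eq_insert_0)
qed

lemma (in abelian_monoid) finsum_delta:
  assumes "j \<in> A" "finite A" "f j \<in> carrier G"
  shows "(\<Oplus>i\<in>A. if i = j then f i else \<zero>) = f j"
proof -
  have "(\<Oplus>i\<in>A. if i = j then f i else \<zero>) = (\<Oplus>i\<in>A. if j = i then f j else \<zero>)"
    using assms by (intro finsum_eqI) auto
  then show ?thesis using finsum_singleton[of j A "\<lambda>_. f j"] assms by auto
qed

lemma (in ideal) finsum_in_ideal:
  assumes "finite A" "\<And>i. i \<in> A \<Longrightarrow> f i \<in> I"
  shows "(\<Oplus>i\<in>A. f i) \<in> I"
  using assms
proof (induction A rule: finite_induct)
  case (insert a A)
  then show ?case by (subst finsum_insert) (auto simp: Pi_def)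
qed simp

lemma mat_monoid_simps:
  "carrier (mat_monoid A N) = {M \<in> carrier_mat N N. \<forall>i<N. \<forall>j<N. M $$ (i, j) \<in> carrier A}"
  "M \<otimes>\<^bsub>mat_monoid A N\<^esub> M' = mat N N (\<lambda>(i, j). \<Oplus>\<^bsub>A\<^esub>k\<in>{..<N}. M $$ (i, k) \<otimes>\<^bsub>A\<^esub> M' $$ (k, j))"
  "\<one>\<^bsub>mat_monoid A N\<^esub> = mat N N (\<lambda>(i, j). if i = j then \<one>\<^bsub>A\<^esub> else \<zero>\<^bsub>A\<^esub>)"
  by (simp_all add: mat_monoid_def)

context cring
begin

lemma mat_monoid_closed:
  assumes "X \<in> carrier (mat_monoid R N)" "Y \<in> carrier (mat_monoid R N)"
  shows "X \<otimes>\<^bsub>mat_monoid R N\<^esub> Y \<in> carrier (mat_monoid R N)"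
  using assms by (auto simp: mat_monoid_simps intro!: finsum_closed)

lemma finsum_unit_l:
  assumes "i \<in> A" "finite A" "f \<in> A \<rightarrow> carrier R"
  shows "(\<Oplus>k\<in>A. (if i = k then \<one> else \<zero>) \<otimes> f k) = f i"
proof -
  have "(\<Oplus>k\<in>A. (if i = k then \<one> else \<zero>) \<otimes> f k) = (\<Oplus>k\<in>A. if k = i then f k else \<zero>)"
    using assms by (intro finsum_eqI) (auto simp: Pi_def)
  then show ?thesis using finsum_delta[of i A f] assms by auto
qed

lemma finsum_unit_r:
  assumes "i \<in> A" "finite A" "f \<in> A \<rightarrow> carrier R"
  shows "(\<Oplus>k\<in>A. f k \<otimes> (if k = i then \<one> else \<zero>)) = f i"
proof -
  have "(\<Oplus>k\<in>A. f k \<otimes> (if k = i then \<one> else \<zero>)) = (\<Oplus>k\<in>A. if k = i then f k else \<zero>)"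
    using assms by (intro finsum_eqI) (auto simp: Pi_def)
  then show ?thesis using finsum_delta[of i A f] assms by auto
qed

lemma mat_monoid_assoc:
  assumes "X \<in> carrier (mat_monoid R N)" "Y \<in> carrier (mat_monoid R N)" "Z \<in> carrier (mat_monoid R N)"
  shows "X \<otimes>\<^bsub>mat_monoid R N\<^esub> Y \<otimes>\<^bsub>mat_monoid R N\<^esub> Z = X \<otimes>\<^bsub>mat_monoid R N\<^esub> (Y \<otimes>\<^bsub>mat_monoid R N\<^esub> Z)"
proof -
  have X: "\<And>i j. i < N \<Longrightarrow> j < N \<Longrightarrow> X $$ (i, j) \<in> carrier R"
    and Y: "\<And>i j. i < N \<Longrightarrow> j < N \<Longrightarrow> Y $$ (i, j) \<in> carrier R"
    and Z: "\<And>i j. i < N \<Longrightarrow> j < N \<Longrightarrow> Z $$ (i, j) \<in> carrier R"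
    using assms by (auto simp: mat_monoid_simps)
  have "(\<Oplus>k\<in>{..<N}. (\<Oplus>l\<in>{..<N}. X $$ (i, l) \<otimes> Y $$ (l, k)) \<otimes> Z $$ (k, j))
    = (\<Oplus>l\<in>{..<N}. X $$ (i, l) \<otimes> (\<Oplus>k\<in>{..<N}. Y $$ (l, k) \<otimes> Z $$ (k, j)))"
    if ij: "i < N" "j < N" for i j
  proof -
    have "(\<Oplus>k\<in>{..<N}. (\<Oplus>l\<in>{..<N}. X $$ (i, l) \<otimes> Y $$ (l, k)) \<otimes> Z $$ (k, j))
      = (\<Oplus>k\<in>{..<N}. \<Oplus>l\<in>{..<N}. X $$ (i, l) \<otimes> Y $$ (l, k) \<otimes> Z $$ (k, j))"
      using ij X Y Z by (intro finsum_eqI) (auto simp: finsum_ldistr Pi_def intro!: finsum_closed)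
    also have "\<dots> = (\<Oplus>l\<in>{..<N}. \<Oplus>k\<in>{..<N}. X $$ (i, l) \<otimes> Y $$ (l, k) \<otimes> Z $$ (k, j))"
      using ij X Y Z by (intro finsum_swap) auto
    also have "\<dots> = (\<Oplus>l\<in>{..<N}. X $$ (i, l) \<otimes> (\<Oplus>k\<in>{..<N}. Y $$ (l, k) \<otimes> Z $$ (k, j)))"
      using ij X Y Z
      by (intro finsum_eqI) (auto simp: finsum_rdistr Pi_def m_assoc intro!: finsum_closed finsum_eqI)
    finally show ?thesis .
  qed
  then show ?thesis
    by (intro eq_matI) (simp_all add: mat_monoid_simps cong: finsum_eq_cong)
qed

lemma mat_monoid: "monoid (mat_monoid R N)"
proof (rule monoidI)
  fix X assume X: "X \<in> carrier (mat_monoid R N)"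
  show "\<one>\<^bsub>mat_monoid R N\<^esub> \<otimes>\<^bsub>mat_monoid R N\<^esub> X = X"
    using X finsum_unit_l[of _ "{..<N}" "\<lambda>k. X $$ (k, _)"]
    by (intro eq_matI) (auto simp: mat_monoid_simps Pi_def cong: finsum_eq_cong)
  have "(\<Oplus>k\<in>{..<N}. X $$ (i, k) \<otimes> (if k = j then \<one> else \<zero>)) = X $$ (i, j)"
    if "i < N" "j < N" for i j
    using finsum_unit_r[of j "{..<N}" "\<lambda>k. X $$ (i, k)"] X that by (auto simp: mat_monoid_simps)
  then show "X \<otimes>\<^bsub>mat_monoid R N\<^esub> \<one>\<^bsub>mat_monoid R N\<^esub> = X"
    using X by (intro eq_matI) (auto simp: mat_monoid_simps Pi_def cong: finsum_eq_cong)
next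
  show "\<one>\<^bsub>mat_monoid R N\<^esub> \<in> carrier (mat_monoid R N)" by (auto simp: mat_monoid_simps)
qed (use mat_monoid_assoc mat_monoid_closed in auto)

lemma transpose_closed:
  "X \<in> carrier (mat_monoid R N) \<Longrightarrow> transpose_mat X \<in> carrier (mat_monoid R N)"
  by (auto simp: mat_monoid_simps)

lemma transpose_mult:
  assumes "X \<in> carrier (mat_monoid R N)" "Y \<in> carrier (mat_monoid R N)"
  shows "transpose_mat (X \<otimes>\<^bsub>mat_monoid R N\<^esub> Y)
    = transpose_mat Y \<otimes>\<^bsub>mat_monoid R N\<^esub> transpose_mat X"
  using assms
  by (intro eq_matI) (auto simp: mat_monoid_simps intro!: finsum_eqI m_comm)

lemma Sp_mat_group:
  assumes "\<phi> \<in> carrier (mat_monoid R N)"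
  shows "group (Sp_mat R \<phi>)"
proof -
  let ?G = "mat_monoid R N"
  interpret G: monoid ?G by (rule mat_monoid)
  have dim: "dim_row \<phi> = N" using assms by (auto simp: mat_monoid_simps)
  have car: "carrier (Sp_mat R \<phi>) = {\<alpha> \<in> Units ?G. transpose_mat \<alpha> \<otimes>\<^bsub>?G\<^esub> \<phi> \<otimes>\<^bsub>?G\<^esub> \<alpha> = \<phi>}"
    by (simp add: Sp_mat_def dim Let_def)
  have ops: "monoid.mult (Sp_mat R \<phi>) = monoid.mult ?G" "monoid.one (Sp_mat R \<phi>) = monoid.one ?G"
    by (simp_all add: Sp_mat_def dim Let_def)
  have tr: "transpose_mat (X \<otimes>\<^bsub>?G\<^esub> Y) \<otimes>\<^bsub>?G\<^esub> \<phi> \<otimes>\<^bsub>?G\<^esub> (X \<otimes>\<^bsub>?G\<^esub> Y)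
     = transpose_mat Y \<otimes>\<^bsub>?G\<^esub> (transpose_mat X \<otimes>\<^bsub>?G\<^esub> \<phi> \<otimes>\<^bsub>?G\<^esub> X) \<otimes>\<^bsub>?G\<^esub> Y"
    if "X \<in> carrier ?G" "Y \<in> carrier ?G" for X Y
    using that assms transpose_closed by (simp add: transpose_mult G.m_assoc)
  have one: "transpose_mat \<one>\<^bsub>?G\<^esub> = \<one>\<^bsub>?G\<^esub>"
    by (intro eq_matI) (auto simp: mat_monoid_simps)
  show ?thesis
  proof (rule groupI)
    show "\<exists>y\<in>carrier (Sp_mat R \<phi>). y \<otimes>\<^bsub>Sp_mat R \<phi>\<^esub> x = \<one>\<^bsub>Sp_mat R \<phi>\<^esub>" if "x \<in> carrier (Sp_mat R \<phi>)" for x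
    proof (intro bexI)
      have x: "x \<in> Units ?G" "transpose_mat x \<otimes>\<^bsub>?G\<^esub> \<phi> \<otimes>\<^bsub>?G\<^esub> x = \<phi>" using that car by auto
      then have xc: "x \<in> carrier ?G" "inv\<^bsub>?G\<^esub> x \<in> carrier ?G" by auto
      show "inv\<^bsub>?G\<^esub> x \<otimes>\<^bsub>Sp_mat R \<phi>\<^esub> x = \<one>\<^bsub>Sp_mat R \<phi>\<^esub>" using x by (simp add: ops)
      show "inv\<^bsub>?G\<^esub> x \<in> carrier (Sp_mat R \<phi>)"
        using tr[OF xc] x assms by (simp add: car one)
    qed
  qed (use assms tr in \<open>auto simp: car ops one G.m_assoc G.Units_closed\<close>)
qed

end


section \<open>Dual bases, coordinates and matrices of endomorphisms\<close>

context form_module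
begin

text \<open>The coordinate functions of \<open>b\<close> are represented by the vectors
  \<open>D i\<close>, with \<open>D i\<close> as the left argument of the form. Keeping this order
  throughout avoids signs.\<close>

definition dual_basis :: "nat \<Rightarrow> (nat \<Rightarrow> 'b) \<Rightarrow> (nat \<Rightarrow> 'b) \<Rightarrow> bool" where
  "dual_basis N b D \<longleftrightarrow> b \<in> {..<N} \<rightarrow> carrier M \<and> D \<in> {..<N} \<rightarrow> carrier M \<and>
     (\<forall>x\<in>carrier M. x = (\<Oplus>\<^bsub>M\<^esub>i\<in>{..<N}. F (D i) x \<odot>\<^bsub>M\<^esub> b i)) \<and>
     (\<forall>i<N. \<forall>j<N. F (D i) (b j) = (if i = j then \<one> else \<zero>))"

definition matrix_of where
  "matrix_of N b D f = mat N N (\<lambda>(i, j). F (D i) (f (b j)))"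

lemma dual_basisD:
  assumes "dual_basis N b D"
  shows "i < N \<Longrightarrow> b i \<in> carrier M" "i < N \<Longrightarrow> D i \<in> carrier M"
    "x \<in> carrier M \<Longrightarrow> (\<Oplus>\<^bsub>M\<^esub>i\<in>{..<N}. F (D i) x \<odot>\<^bsub>M\<^esub> b i) = x"
    "i < N \<Longrightarrow> j < N \<Longrightarrow> F (D i) (b j) = (if i = j then \<one> else \<zero>)"
  using assms by (auto simp: dual_basis_def)

context
  fixes N b D
  assumes db: "dual_basis N b D"
begin

lemmas basis_closed [simp] = dual_basisD(1)[OF db] and dual_closed [simp] = dual_basisD(2)[OF db]
lemmas basis_expand = dual_basisD(3)[OF db] and basis_dual = dual_basisD(4)[OF db]

lemma F_expand:
  assumes "x \<in> carrier M" "y \<in> carrier M"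
  shows "F y x = (\<Oplus>i\<in>{..<N}. F (D i) x \<otimes> F y (b i))"
proof -
  have "F y x = F y (\<Oplus>\<^bsub>M\<^esub>i\<in>{..<N}. F (D i) x \<odot>\<^bsub>M\<^esub> b i)" by (simp add: basis_expand assms)
  also have "\<dots> = (\<Oplus>i\<in>{..<N}. F y (F (D i) x \<odot>\<^bsub>M\<^esub> b i))"
    using assms by (intro F_finsum_r) auto
  also have "\<dots> = (\<Oplus>i\<in>{..<N}. F (D i) x \<otimes> F y (b i))"
    using assms by (intro finsum_eqI) auto
  finally show ?thesis .
qed

lemma F_expand_l:
  assumes "x \<in> carrier M" "y \<in> carrier M"
  shows "F x y = (\<Oplus>i\<in>{..<N}. F (D i) x \<otimes> F (b i) y)"
proof -
  have "F x y = F (\<Oplus>\<^bsub>M\<^esub>i\<in>{..<N}. F (D i) x \<odot>\<^bsub>M\<^esub> b i) y" by (simp add: basis_expand assms)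
  also have "\<dots> = (\<Oplus>i\<in>{..<N}. F (F (D i) x \<odot>\<^bsub>M\<^esub> b i) y)"
    using assms by (intro F_finsum_l) auto
  also have "\<dots> = (\<Oplus>i\<in>{..<N}. F (D i) x \<otimes> F (b i) y)"
    using assms by (intro finsum_eqI) auto
  finally show ?thesis .
qed

text \<open>\<open>D\<close> is a basis too, with coordinates \<open>F x (b i)\<close>. The
  parameter vectors of \<open>R_mat\<close> are coordinates of this kind, those of
  \<open>C_mat\<close> are coordinates with respect to \<open>b\<close>.\<close>

lemma expand_dual:
  assumes "x \<in> carrier M"
  shows "(\<Oplus>\<^bsub>M\<^esub>i\<in>{..<N}. F x (b i) \<odot>\<^bsub>M\<^esub> D i) = x"
proof (rule F_nondegenerate)
  fix z assume z: "z \<in> carrier M"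
  have "F (\<Oplus>\<^bsub>M\<^esub>i\<in>{..<N}. F x (b i) \<odot>\<^bsub>M\<^esub> D i) z = (\<Oplus>i\<in>{..<N}. F (F x (b i) \<odot>\<^bsub>M\<^esub> D i) z)"
    using assms z by (intro F_finsum_l) auto
  also have "\<dots> = (\<Oplus>i\<in>{..<N}. F (D i) z \<otimes> F x (b i))"
    using assms z by (intro finsum_eqI) (auto simp: R.m_comm)
  also have "\<dots> = F x z" using F_expand[OF z assms] by simp
  finally have "F (\<Oplus>\<^bsub>M\<^esub>i\<in>{..<N}. F x (b i) \<odot>\<^bsub>M\<^esub> D i) z = F x z" .
  then show "F z (\<Oplus>\<^bsub>M\<^esub>i\<in>{..<N}. F x (b i) \<odot>\<^bsub>M\<^esub> D i) = F z x"
    using F_skew[of "\<Oplus>\<^bsub>M\<^esub>i\<in>{..<N}. F x (b i) \<odot>\<^bsub>M\<^esub> D i" z] F_skew[of x z] assms z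
    by (simp add: Pi_def)
qed (use assms in \<open>auto intro!: M.finsum_closed\<close>)

lemma hom_expand:
  assumes "f \<in> module_hom R M M" "x \<in> carrier M"
  shows "f x = (\<Oplus>\<^bsub>M\<^esub>i\<in>{..<N}. F (D i) x \<odot>\<^bsub>M\<^esub> f (b i))"
proof -
  have "f x = f (\<Oplus>\<^bsub>M\<^esub>i\<in>{..<N}. F (D i) x \<odot>\<^bsub>M\<^esub> b i)" by (simp add: basis_expand assms)
  also have "\<dots> = (\<Oplus>\<^bsub>M\<^esub>i\<in>{..<N}. f (F (D i) x \<odot>\<^bsub>M\<^esub> b i))"
    using assms by (intro module_hom_finsum[OF is_module is_module]) auto
  also have "\<dots> = (\<Oplus>\<^bsub>M\<^esub>i\<in>{..<N}. F (D i) x \<odot>\<^bsub>M\<^esub> f (b i))"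
    using assms module_homD[OF assms(1)] by (intro finsum_eqI) auto
  finally show ?thesis .
qed

lemma F_hom_expand:
  assumes "f \<in> module_hom R M M" "x \<in> carrier M" "y \<in> carrier M"
  shows "F y (f x) = (\<Oplus>i\<in>{..<N}. F y (f (b i)) \<otimes> F (D i) x)"
proof -
  note f = module_homD[OF assms(1)]
  have "F y (f x) = F y (\<Oplus>\<^bsub>M\<^esub>i\<in>{..<N}. F (D i) x \<odot>\<^bsub>M\<^esub> f (b i))" by (simp add: hom_expand[OF assms(1,2)])
  also have "\<dots> = (\<Oplus>i\<in>{..<N}. F y (F (D i) x \<odot>\<^bsub>M\<^esub> f (b i)))"
    using assms f by (intro F_finsum_r) auto
  also have "\<dots> = (\<Oplus>i\<in>{..<N}. F y (f (b i)) \<otimes> F (D i) x)"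
    using assms f by (intro finsum_eqI) (auto simp: R.m_comm)
  finally show ?thesis .
qed

lemma matrix_of_closed:
  assumes "f \<in> module_hom R M M"
  shows "matrix_of N b D f \<in> carrier (mat_monoid R N)"
  using module_homD(1)[OF assms] by (auto simp: mat_monoid_simps matrix_of_def)

lemma matrix_of_compose:
  assumes "f \<in> module_hom R M M" "g \<in> module_hom R M M"
  shows "matrix_of N b D (compose (carrier M) f g)
    = matrix_of N b D f \<otimes>\<^bsub>mat_monoid R N\<^esub> matrix_of N b D g"
  using module_homD(1)[OF assms(2)] F_hom_expand[OF assms(1)]
  by (intro eq_matI) (simp_all add: mat_monoid_simps matrix_of_def compose_eq cong: finsum_eq_cong)

lemma matrix_of_inj:
  assumes "f \<in> module_hom R M M" "g \<in> module_hom R M M" "matrix_of N b D f = matrix_of N b D g"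
  shows "f = g"
proof -
  note f = module_homD[OF assms(1)] and g = module_homD[OF assms(2)]
  have "F (D i) (f (b j)) = F (D i) (g (b j))" if "i < N" "j < N" for i j
    using arg_cong[OF assms(3), of "\<lambda>X. X $$ (i, j)"] that by (simp add: matrix_of_def)
  then have "(\<Oplus>\<^bsub>M\<^esub>i\<in>{..<N}. F (D i) (f (b j)) \<odot>\<^bsub>M\<^esub> b i)
      = (\<Oplus>\<^bsub>M\<^esub>i\<in>{..<N}. F (D i) (g (b j)) \<odot>\<^bsub>M\<^esub> b i)" if "j < N" for j
    using that f(1) g(1) by (intro finsum_eqI) auto
  then have fg: "f (b j) = g (b j)" if "j < N" for j
    using that f(1) g(1) by (simp add: basis_expand)
  show ?thesis
  proof (rule extensionalityI[OF f(4) g(4)])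
    fix x assume x: "x \<in> carrier M"
    show "f x = g x" unfolding hom_expand[OF assms(1) x] hom_expand[OF assms(2) x]
      using fg g(1) x by (intro finsum_eqI) auto
  qed
qed

lemma is_matrix_of_iff:
  assumes "f \<in> module_hom R M M"
  shows "is_matrix_of R M N b f T \<longleftrightarrow> T = matrix_of N b D f"
proof
  note f = module_homD[OF assms]
  assume T: "is_matrix_of R M N b f T"
  then have Tc: "T \<in> carrier (mat_monoid R N)" by (simp add: is_matrix_of_def)
  then have Tij: "\<And>i j. i < N \<Longrightarrow> j < N \<Longrightarrow> T $$ (i, j) \<in> carrier R" by (auto simp: mat_monoid_simps)
  have "F (D i) (f (b j)) = T $$ (i, j)" if "i < N" "j < N" for i j
  proof -
    have "F (D i) (f (b j)) = F (D i) (\<Oplus>\<^bsub>M\<^esub>k\<in>{..<N}. T $$ (k, j) \<odot>\<^bsub>M\<^esub> b k)"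
      using T that by (simp add: is_matrix_of_def)
    also have "\<dots> = (\<Oplus>k\<in>{..<N}. F (D i) (T $$ (k, j) \<odot>\<^bsub>M\<^esub> b k))"
      using Tij that by (intro F_finsum_r) auto
    also have "\<dots> = (\<Oplus>k\<in>{..<N}. if k = i then T $$ (k, j) else \<zero>)"
      using Tij that by (intro finsum_eqI) (auto simp: basis_dual)
    also have "\<dots> = T $$ (i, j)" using Tij that by (intro R.finsum_delta) auto
    finally show ?thesis .
  qed
  then show "T = matrix_of N b D f"
    using Tc by (intro eq_matI) (auto simp: matrix_of_def mat_monoid_simps)
next
  note f = module_homD[OF assms]
  assume T: "T = matrix_of N b D f"
  have "(\<Oplus>\<^bsub>M\<^esub>i\<in>{..<N}. T $$ (i, j) \<odot>\<^bsub>M\<^esub> b i) = f (b j)" if "j < N" for j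
  proof -
    have "(\<Oplus>\<^bsub>M\<^esub>i\<in>{..<N}. T $$ (i, j) \<odot>\<^bsub>M\<^esub> b i) = (\<Oplus>\<^bsub>M\<^esub>i\<in>{..<N}. F (D i) (f (b j)) \<odot>\<^bsub>M\<^esub> b i)"
      using that f(1) by (intro finsum_eqI) (auto simp: T matrix_of_def)
    then show ?thesis using that f(1) by (simp add: basis_expand)
  qed
  then show "is_matrix_of R M N b f T"
    using matrix_of_closed[OF assms] T by (simp add: is_matrix_of_def)
qed

abbreviation gram where "gram \<equiv> gram_matrix N F b"

lemma gram_closed: "gram \<in> carrier (mat_monoid R N)"
  by (auto simp: gram_matrix_def mat_monoid_simps)

text \<open>The product with the Gram matrix is the expansion of \<open>D i\<close> in the basis,
  paired with \<open>b j\<close>. The indices are transposed: the block \<open>d\<close> of the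
  inverse consists of the values \<open>F (D (Suc i)) (D 0)\<close>, and \<open>\<mu>\<close> of
  \<open>F (D (Suc j)) (D (Suc i))\<close>.\<close>

lemma gram_inv: "inv\<^bsub>mat_monoid R N\<^esub> gram = mat N N (\<lambda>(i, j). F (D j) (D i))" (is "_ = ?\<psi>")
proof -
  interpret G: monoid "mat_monoid R N" by (rule R.mat_monoid)
  have c: "?\<psi> \<in> carrier (mat_monoid R N)" by (auto simp: mat_monoid_simps)
  have "(\<Oplus>k\<in>{..<N}. F (D k) (D i) \<otimes> F (b k) (b j)) = (if i = j then \<one> else \<zero>)" if "i < N" "j < N" for i j
    using F_expand_l[of "D i" "b j"] that by (simp add: basis_dual)
  then have l: "?\<psi> \<otimes>\<^bsub>mat_monoid R N\<^esub> gram = \<one>\<^bsub>mat_monoid R N\<^esub>"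
    by (intro eq_matI) (simp_all add: mat_monoid_simps gram_matrix_def cong: finsum_eq_cong)
  have "(\<Oplus>k\<in>{..<N}. F (b i) (b k) \<otimes> F (D j) (D k)) = (if i = j then \<one> else \<zero>)" if "i < N" "j < N" for i j
  proof -
    have "(\<Oplus>k\<in>{..<N}. F (b i) (b k) \<otimes> F (D j) (D k)) = (\<Oplus>k\<in>{..<N}. F (D k) (D j) \<otimes> F (b k) (b i))"
    proof (intro finsum_eqI)
      fix k assume k: "k \<in> {..<N}"
      show "F (b i) (b k) \<otimes> F (D j) (D k) = F (D k) (D j) \<otimes> F (b k) (b i)"
        using k that F_skew[of "D k" "D j"] F_skew[of "b k" "b i"]
        by (simp add: R.l_minus R.r_minus R.m_comm)
    qed (use that in auto)
    then show ?thesis using F_expand_l[of "D j" "b i"] that by (auto simp: basis_dual)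
  qed
  then have r: "gram \<otimes>\<^bsub>mat_monoid R N\<^esub> ?\<psi> = \<one>\<^bsub>mat_monoid R N\<^esub>"
    by (intro eq_matI) (simp_all add: mat_monoid_simps gram_matrix_def cong: finsum_eq_cong)
  show ?thesis using G.inv_unique'[OF gram_closed c r l] by simp
qed

lemma Sp_mat_gram:
  "carrier (Sp_mat R gram) = {\<alpha> \<in> Units (mat_monoid R N).
     transpose_mat \<alpha> \<otimes>\<^bsub>mat_monoid R N\<^esub> gram \<otimes>\<^bsub>mat_monoid R N\<^esub> \<alpha> = gram}"
  "monoid.mult (Sp_mat R gram) = monoid.mult (mat_monoid R N)"
  "monoid.one (Sp_mat R gram) = monoid.one (mat_monoid R N)"
  by (simp_all add: Sp_mat_def gram_matrix_def Let_def)

lemma matrix_of_one: "matrix_of N b D (\<lambda>x\<in>carrier M. x) = \<one>\<^bsub>mat_monoid R N\<^esub>"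
  by (intro eq_matI) (auto simp: matrix_of_def mat_monoid_simps basis_dual)

text \<open>Contraction with the Gram matrix undoes the expansion of the two images in the basis, so
  that the triple product has the entries \<open>F (f (b i)) (f (b j))\<close>. Invertibility comes
  from the matrix of the inverse isometry.\<close>

lemma matrix_of_isometry:
  assumes "f \<in> carrier Iso"
  shows "matrix_of N b D f \<in> carrier (Sp_mat R gram)"
proof -
  let ?G = "mat_monoid R N" and ?X = "matrix_of N b D f"
  have f: "f \<in> module_hom R M M" using assms by (simp add: isometry_iff)
  note fD = isometryD[OF assms]
  have k: "inv\<^bsub>Iso\<^esub> f \<in> carrier Iso" "inv\<^bsub>Iso\<^esub> f \<in> module_hom R M M"
    using assms I.inv_closed by (auto simp: isometry_iff)
  have eq: "compose (carrier M) f (inv\<^bsub>Iso\<^esub> f) = (\<lambda>x\<in>carrier M. x)"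
    "compose (carrier M) (inv\<^bsub>Iso\<^esub> f) f = (\<lambda>x\<in>carrier M. x)"
    using isometry_inv[OF assms] by (auto simp: compose_def)
  have "?X \<in> Units ?G"
    unfolding Units_def
    using matrix_of_closed[OF f] matrix_of_closed[OF k(2)] matrix_of_compose[OF f k(2)]
      matrix_of_compose[OF k(2) f] by (auto simp: eq matrix_of_one)
  moreover have "transpose_mat ?X \<otimes>\<^bsub>?G\<^esub> gram \<otimes>\<^bsub>?G\<^esub> ?X = gram"
  proof -
    have row: "(\<Oplus>k\<in>{..<N}. F (D k) (f (b i)) \<otimes> F (b k) (b l)) = F (f (b i)) (b l)" if "i < N" "l < N" for i l
      using F_expand_l[of "f (b i)" "b l"] that fD(1) by simp
    have "(\<Oplus>l\<in>{..<N}. F (f (b i)) (b l) \<otimes> F (D l) (f (b j))) = F (b i) (b j)" if "i < N" "j < N" for i j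
    proof -
      have "(\<Oplus>l\<in>{..<N}. F (f (b i)) (b l) \<otimes> F (D l) (f (b j)))
        = (\<Oplus>l\<in>{..<N}. F (D l) (f (b j)) \<otimes> F (f (b i)) (b l))"
        using that fD(1) by (intro finsum_eqI) (auto simp: R.m_comm)
      also have "\<dots> = F (f (b i)) (f (b j))" using that fD(1) by (simp add: F_expand[symmetric])
      finally show ?thesis using that fD(4) by simp
    qed
    then show ?thesis
      by (intro eq_matI)
        (simp_all add: mat_monoid_simps gram_matrix_def matrix_of_def row cong: finsum_eq_cong)
  qed
  ultimately show ?thesis by (simp add: Sp_mat_gram)
qed

lemma matrix_of_hom: "group_hom Iso (Sp_mat R gram) (matrix_of N b D)"
proof (intro group_hom.intro group_hom_axioms.intro isometry_group R.Sp_mat_group[OF gram_closed])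
  show "matrix_of N b D \<in> hom Iso (Sp_mat R gram)"
    using matrix_of_isometry
    by (auto simp: hom_def isometry_mult Sp_mat_gram isometry_iff intro!: matrix_of_compose)
qed

end

end

section \<open>The matrices \<open>C_mat\<close> and \<open>R_mat\<close> as transvections\<close>

context form_module
begin

text \<open>The multiple of \<open>D\<close> in \<open>w\<close> contributes \<open>t\<close> twice:
  once through \<open>F D y\<close> times the vector, and once through \<open>F w y\<close> times
  \<open>D\<close>.\<close>

lemma transvection_shift:
  assumes "D \<in> carrier M" "w \<in> carrier M" "c \<in> carrier R" "t \<in> carrier R"
  shows "transvection D (w \<oplus>\<^bsub>M\<^esub> t \<odot>\<^bsub>M\<^esub> D) c = transvection D w (c \<oplus> t \<oplus> t)"
proof
  fix y
  show "transvection D (w \<oplus>\<^bsub>M\<^esub> t \<odot>\<^bsub>M\<^esub> D) c y = transvection D w (c \<oplus> t \<oplus> t) y"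
  proof (cases "y \<in> carrier M")
    case True
    show ?thesis
      by (rule F_nondegenerate)
        (use True assms in \<open>simp_all add: transvection_apply R.l_distr R.r_distr R.a_ac R.m_ac\<close>)
  qed (simp add: transvection_def)
qed

text \<open>Adding a multiple of \<open>D\<close> to \<open>w\<close> changes \<open>c\<close> by any given amount, so that along \<open>D\<close> it
  suffices to consider the transvections whose parameter \<open>c\<close> is determined by \<open>w\<close> and a vector
  \<open>e\<close> paired with \<open>D\<close>.\<close>

lemma transvections_normalized:
  assumes J: "ideal J R" and M: "D \<in> carrier M" "e \<in> carrier M" and De: "F D e = \<one>"
  shows "transvections D J = {transvection D w (F e w) | w. w \<in> carrier M \<and> F D w = \<zero> \<and>
     (\<forall>y\<in>carrier M. F w y \<in> J)}"
proof (intro equalityI subsetI)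
  interpret J: ideal J R by fact
  have eD: "F e D = \<ominus> \<one>" using M De F_skew[of D e] by simp
  {
    fix x assume "x \<in> transvections D J"
    then obtain w c where w: "w \<in> carrier M" "F D w = \<zero>" "\<forall>y\<in>carrier M. F w y \<in> J" "c \<in> J" "c \<in> carrier R"
      and x: "x = transvection D w c"
      by (auto simp: transvections_def)
    \<comment> \<open>Since \<open>F e D = -1\<close>, passing from \<open>w\<close> to
      \<open>w'\<close> lowers the normalized parameter by \<open>t\<close>, while the shift adds
      \<open>t\<close> twice. The effective parameter is \<open>F e w + t\<close>, and solving for
      \<open>c\<close> requires no division by 2.\<close>
    define t where "t = c \<oplus> \<ominus> F e w"
    define w' where "w' = w \<oplus>\<^bsub>M\<^esub> t \<odot>\<^bsub>M\<^esub> D"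
    have ew: "F e w = \<ominus> F w e" using M w F_skew[of w e] by simp
    have t: "t \<in> carrier R" "t \<in> J"
      using w M by (auto simp: t_def ew intro!: J.a_closed J.a_inv_closed)
    have w': "w' \<in> carrier M" "F D w' = \<zero>" "\<forall>y\<in>carrier M. F w' y \<in> J"
      using w t M by (auto simp: w'_def J.I_r_closed)
    have ring: "(k \<oplus> (c \<oplus> \<ominus> k) \<otimes> \<ominus> \<one>) \<oplus> (c \<oplus> \<ominus> k) \<oplus> (c \<oplus> \<ominus> k) = c" if "k \<in> carrier R" for k
      using that w(5) by algebra
    have "transvection D w' (F e w') = transvection D w (F e w' \<oplus> t \<oplus> t)"
      using transvection_shift[of D w "F e w'" t] w w' t M by (simp add: w'_def)
    also have "F e w' \<oplus> t \<oplus> t = c"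
      using ring[of "F e w"] w M eD t by (simp add: w'_def t_def)
    finally have "x = transvection D w' (F e w')" using x by simp
    then show "x \<in> {transvection D w (F e w) | w. w \<in> carrier M \<and> F D w = \<zero> \<and>
     (\<forall>y\<in>carrier M. F w y \<in> J)}" using w' by blast
  next
    fix x assume "x \<in> {transvection D w (F e w) | w. w \<in> carrier M \<and> F D w = \<zero> \<and>
     (\<forall>y\<in>carrier M. F w y \<in> J)}"
    then obtain w where w: "w \<in> carrier M" "F D w = \<zero>" "\<forall>y\<in>carrier M. F w y \<in> J"
      and x: "x = transvection D w (F e w)" by blast
    have "F e w = \<ominus> F w e" using M w F_skew[of w e] by simp
    then show "x \<in> transvections D J"
      unfolding x using w M by (intro transvectionsI) auto
  }
qed

context
  fixes m b D
  assumes db: "dual_basis (Suc m) b D"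
begin

lemmas basis_vec = dual_basisD(1)[OF db] and dual_vec = dual_basisD(2)[OF db]
  and dual_eq = dual_basisD(4)[OF db]

abbreviation gram' where "gram' \<equiv> gram_matrix (Suc m) F b"

text \<open>\<open>w\<close> has coordinates \<open>(0, v)\<close> in the basis, so it is orthogonal
  to \<open>D 0\<close>. The choice \<open>c = F (b 0) w\<close> cancels \<open>F w (b 0)\<close>,
  so that \<open>b 0\<close> goes to \<open>b 0 + w\<close>, which is column 0. The other
  \<open>b j\<close> are orthogonal to \<open>D 0\<close> and are changed by
  \<open>F w (b j)\<close> times \<open>D 0\<close> only; in coordinates this is the rank one term
  \<open>d v\<^sup>t \<nu>\<close>.\<close>

lemma C_mat_gram:
  assumes v: "\<And>k. k < m \<Longrightarrow> v $ k \<in> carrier R"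
  defines "w \<equiv> (\<Oplus>\<^bsub>M\<^esub>k\<in>{..<m}. v $ k \<odot>\<^bsub>M\<^esub> b (Suc k))"
  shows "w \<in> carrier M" "F (D 0) w = \<zero>"
    "C_mat R gram' v = matrix_of (Suc m) b D (transvection (D 0) w (F (b 0) w))"
proof -
  show w: "w \<in> carrier M" unfolding w_def using v basis_vec by (intro M.finsum_closed) auto
  have Fw: "F w y = (\<Oplus>k\<in>{..<m}. v $ k \<otimes> F (b (Suc k)) y)" if "y \<in> carrier M" for y
  proof -
    have "F w y = (\<Oplus>k\<in>{..<m}. F (v $ k \<odot>\<^bsub>M\<^esub> b (Suc k)) y)"
      unfolding w_def using v basis_vec that by (intro F_finsum_l) auto
    also have "\<dots> = (\<Oplus>k\<in>{..<m}. v $ k \<otimes> F (b (Suc k)) y)"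
      using v basis_vec that by (intro finsum_eqI) auto
    finally show ?thesis .
  qed
  have FDw: "F (D i) w = (if i = 0 then \<zero> else v $ (i - 1))" if "i < Suc m" for i
  proof -
    have "F (D i) w = (\<Oplus>k\<in>{..<m}. F (D i) (v $ k \<odot>\<^bsub>M\<^esub> b (Suc k)))"
      unfolding w_def using v basis_vec dual_vec that by (intro F_finsum_r) auto
    also have "\<dots> = (\<Oplus>k\<in>{..<m}. if i = Suc k then v $ k else \<zero>)"
      using v basis_vec dual_vec that dual_eq by (intro finsum_eqI) auto
    also have "\<dots> = (if i = 0 then \<zero> else v $ (i - 1))"
    proof (cases i)
      case (Suc j)
      then have "(\<Oplus>k\<in>{..<m}. if i = Suc k then v $ k else \<zero>) = (\<Oplus>k\<in>{..<m}. if k = j then v $ k else \<zero>)"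
        by (intro finsum_eqI) auto
      then show ?thesis using R.finsum_delta[of j "{..<m}" "\<lambda>k. v $ k"] v Suc that by simp
    qed simp
    finally show ?thesis .
  qed
  then show Dw: "F (D 0) w = \<zero>" by simp
  have bw: "F w (b 0) \<oplus> F (b 0) w = \<zero>"
    using w basis_vec F_skew[of w "b 0"] by (simp add: R.r_neg)
  have c: "F (b 0) w \<in> carrier R" using w basis_vec by simp
  have ent: "F (D i) (transvection (D 0) w (F (b 0) w) (b j)) = C_mat R gram' v $$ (i, j)"
    if "i < Suc m" "j < Suc m" for i j
  proof (cases j)
    case 0
    have "F (D i) (transvection (D 0) w (F (b 0) w) (b 0)) = (if i = 0 then \<one> else \<zero>) \<oplus> F (D i) w"
      using that(1) bw w basis_vec dual_vec dual_eq by (simp add: transvection_apply)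
    then show ?thesis
      using 0 that FDw[of i] v by (auto simp: C_mat_def gram_matrix_def Let_def)
  next
    case (Suc j')
    then have "F (D i) (transvection (D 0) w (F (b 0) w) (b j))
      = (if i = j then \<one> else \<zero>) \<oplus> F w (b j) \<otimes> F (D i) (D 0)"
      using that w basis_vec dual_vec dual_eq by (simp add: transvection_apply)
    moreover have "F w (b j) = (\<Oplus>k\<in>{..<m}. v $ k \<otimes> gram' $$ (Suc k, j))"
      using that basis_vec by (simp add: Fw gram_matrix_def cong: finsum_eq_cong)
    moreover have "F w (b j) \<in> carrier R" using w basis_vec that by simp
    ultimately show ?thesis
      using Suc that basis_vec dual_vec gram_inv[OF db]
      by (auto simp: C_mat_def Let_def gram_matrix_def R.m_comm)
  qed
  show "C_mat R gram' v = matrix_of (Suc m) b D (transvection (D 0) w (F (b 0) w))"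
    using ent by (intro eq_matI) (auto simp: matrix_of_def C_mat_def gram_matrix_def Let_def)
qed

text \<open>Now \<open>v\<close> gives the coordinates of \<open>w\<close> in the dual basis, so
  that \<open>F w (b (Suc k))\<close> is the entry \<open>k\<close> of \<open>v\<close>. The choice
  \<open>c = F w (D 0)\<close> cancels the coefficient of \<open>b 0\<close> that comes from
  \<open>w\<close>, leaving row 0 equal to \<open>(1, v)\<close>. In the other rows the coefficient
  of \<open>w\<close> produces \<open>\<mu> v c\<^sup>t\<close>; two changes of sign compensate each
  other.\<close>

lemma R_mat_gram:
  assumes v: "\<And>k. k < m \<Longrightarrow> v $ k \<in> carrier R"
  defines "w \<equiv> (\<Oplus>\<^bsub>M\<^esub>k\<in>{..<m}. v $ k \<odot>\<^bsub>M\<^esub> D (Suc k))"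
  shows "w \<in> carrier M" "F (b 0) w = \<zero>"
    "R_mat R gram' v = matrix_of (Suc m) b D (transvection (b 0) w (F w (D 0)))"
proof -
  show w: "w \<in> carrier M" unfolding w_def using v dual_vec by (intro M.finsum_closed) auto
  have Fw: "F w y = (\<Oplus>k\<in>{..<m}. v $ k \<otimes> F (D (Suc k)) y)" if "y \<in> carrier M" for y
  proof -
    have "F w y = (\<Oplus>k\<in>{..<m}. F (v $ k \<odot>\<^bsub>M\<^esub> D (Suc k)) y)"
      unfolding w_def using v dual_vec that by (intro F_finsum_l) auto
    also have "\<dots> = (\<Oplus>k\<in>{..<m}. v $ k \<otimes> F (D (Suc k)) y)"
      using v dual_vec that by (intro finsum_eqI) auto
    finally show ?thesis .
  qed
  have Fwb: "F w (b i) = (if i = 0 then \<zero> else v $ (i - 1))" if "i < Suc m" for i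
  proof -
    have "F w (b i) = (\<Oplus>k\<in>{..<m}. if i = Suc k then v $ k else \<zero>)"
      unfolding Fw[OF basis_vec[OF that]] using v basis_vec dual_vec that dual_eq by (intro finsum_eqI) auto
    also have "\<dots> = (if i = 0 then \<zero> else v $ (i - 1))"
    proof (cases i)
      case (Suc j)
      then have "(\<Oplus>k\<in>{..<m}. if i = Suc k then v $ k else \<zero>) = (\<Oplus>k\<in>{..<m}. if k = j then v $ k else \<zero>)"
        by (intro finsum_eqI) auto
      then show ?thesis using R.finsum_delta[of j "{..<m}" "\<lambda>k. v $ k"] v Suc that by simp
    qed simp
    finally show ?thesis .
  qed
  show bw: "F (b 0) w = \<zero>" using Fwb[of 0] F_skew[of w "b 0"] w basis_vec by simp
  have c: "F w (D 0) \<in> carrier R" using w dual_vec by simp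
  have ent: "F (D i) (transvection (b 0) w (F w (D 0)) (b j)) = R_mat R gram' v $$ (i, j)"
    if "i < Suc m" "j < Suc m" for i j
  proof (cases j)
    case 0
    have "F (D i) (transvection (b 0) w (F w (D 0)) (b 0)) = (if i = 0 then \<one> else \<zero>)"
      using that(1) w basis_vec dual_vec dual_eq Fwb[of 0] by (simp add: transvection_apply)
    then show ?thesis
      using 0 that by (auto simp: R_mat_def gram_matrix_def Let_def)
  next
    case (Suc j')
    have vj: "v $ j' \<in> carrier R" using v Suc that by simp
    have k: "F (b 0) (b j) \<in> carrier R" "F (b j) (b 0) \<in> carrier R" using basis_vec that by auto
    show ?thesis
    proof (cases i)
      case 0
      have "F (D 0) (transvection (b 0) w (F w (D 0)) (b j))
        = F (b 0) (b j) \<otimes> F (D 0) w \<oplus> (v $ j' \<oplus> F w (D 0) \<otimes> F (b 0) (b j))"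
        using Suc that(2) w basis_vec dual_vec dual_eq Fwb[of j] vj by (simp add: transvection_apply)
      also have "\<dots> = v $ j'"
      proof -
        have "x \<otimes> \<ominus> y \<oplus> (z \<oplus> y \<otimes> x) = z" if "x \<in> carrier R" "y \<in> carrier R" "z \<in> carrier R" for x y z
          using that by algebra
        then show ?thesis using F_skew[of w "D 0"] w dual_vec vj k by simp
      qed
      finally show ?thesis using 0 Suc that by (auto simp: R_mat_def gram_matrix_def Let_def)
    next
      case (Suc i')
      then have "F (D i) (transvection (b 0) w (F w (D 0)) (b j))
        = (if i = j then \<one> else \<zero>) \<oplus> F (b 0) (b j) \<otimes> F (D i) w"
        using that w basis_vec dual_vec dual_eq by (simp add: transvection_apply)
      moreover have "F (b 0) (b j) \<otimes> F (D i) w = F w (D i) \<otimes> F (b j) (b 0)"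
        using F_skew[of w "D i"] F_skew[of "b j" "b 0"] w basis_vec dual_vec that k
        by (simp add: R.l_minus R.r_minus R.m_comm)
      moreover have "F w (D i) = (\<Oplus>k\<in>{..<m}. F (D (Suc k)) (D i) \<otimes> v $ k)"
        unfolding Fw[OF dual_vec[OF that(1)]] using v dual_vec that by (intro finsum_eqI) (auto simp: R.m_comm)
      ultimately show ?thesis
        using Suc \<open>j = Suc j'\<close> that gram_inv[OF db]
        by (auto simp: R_mat_def Let_def gram_matrix_def cong: finsum_eq_cong)
    qed
  qed
  show "R_mat R gram' v = matrix_of (Suc m) b D (transvection (b 0) w (F w (D 0)))"
    using ent by (intro eq_matI) (auto simp: matrix_of_def R_mat_def gram_matrix_def Let_def)
qed

text \<open>After normalization both sides are parametrized by the vectors \<open>w\<close>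
  orthogonal to \<open>D 0\<close>, or to \<open>b 0\<close>, whose coordinates lie in
  \<open>J\<close>. The coordinate 0 vanishes by orthogonality, and the remaining ones form
  \<open>v\<close>.\<close>

lemma ESp_gens_gram:
  assumes J: "ideal J R"
  shows "matrix_of (Suc m) b D ` pair_gens (D 0) (b 0) J = ESp_gens R gram' J"
proof -
  interpret J: ideal J R by fact
  let ?V = "{v \<in> carrier_vec m. \<forall>i<m. v $ i \<in> J}" and ?mat = "matrix_of (Suc m) b D"
  have JR: "x \<in> carrier R" if "x \<in> J" for x using that by (rule J.Icarr)
  have D0: "D 0 \<in> carrier M" and b0: "b 0 \<in> carrier M" and Db: "F (D 0) (b 0) = \<one>"
    using dual_vec basis_vec dual_eq by auto
  \<comment> \<open>For transvections along \<open>b 0\<close> the partner is \<open>- D 0\<close>,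
    because of skew symmetry. The normalized parameter \<open>F (- D 0) w\<close> is then
    \<open>F w (D 0)\<close>, as in \<open>R_mat_gram\<close>.\<close>
  have bD: "F (b 0) (\<ominus>\<^bsub>M\<^esub> D 0) = \<one>" using F_skew[of "D 0" "b 0"] D0 b0 Db by simp
  have FJ: "F (\<Oplus>\<^bsub>M\<^esub>k\<in>{..<m}. v $ k \<odot>\<^bsub>M\<^esub> x k) y \<in> J"
    if "v \<in> ?V" "y \<in> carrier M" "\<And>k. k < m \<Longrightarrow> x k \<in> carrier M" for v x y
  proof -
    have "F (\<Oplus>\<^bsub>M\<^esub>k\<in>{..<m}. v $ k \<odot>\<^bsub>M\<^esub> x k) y = (\<Oplus>k\<in>{..<m}. F (v $ k \<odot>\<^bsub>M\<^esub> x k) y)"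
      using that JR by (intro F_finsum_l) auto
    also have "\<dots> \<in> J" using that JR by (intro J.finsum_in_ideal) (auto intro!: J.I_r_closed)
    finally show ?thesis .
  qed
  have C: "?mat ` transvections (D 0) J = C_mat R gram' ` ?V"
    unfolding transvections_normalized[OF J D0 b0 Db]
  proof (intro equalityI subsetI)
    fix T assume "T \<in> ?mat ` {transvection (D 0) w (F (b 0) w) |w. w \<in> carrier M \<and> F (D 0) w = \<zero> \<and> (\<forall>y\<in>carrier M. F w y \<in> J)}"
    then obtain w where w: "w \<in> carrier M" "F (D 0) w = \<zero>" "\<forall>y\<in>carrier M. F w y \<in> J"
      and T: "T = ?mat (transvection (D 0) w (F (b 0) w))" by blast
    define v where "v = vec m (\<lambda>k. F (D (Suc k)) w)"
    have "F (D (Suc k)) w \<in> J" if "k < m" for k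
      using w dual_vec that F_skew[of w "D (Suc k)"] by auto
    then have v: "v \<in> ?V" by (auto simp: v_def)
    have "w = (\<Oplus>\<^bsub>M\<^esub>i\<in>{..<Suc m}. F (D i) w \<odot>\<^bsub>M\<^esub> b i)" using dual_basisD(3)[OF db w(1)] by simp
    also have "\<dots> = F (D 0) w \<odot>\<^bsub>M\<^esub> b 0 \<oplus>\<^bsub>M\<^esub> (\<Oplus>\<^bsub>M\<^esub>k\<in>{..<m}. F (D (Suc k)) w \<odot>\<^bsub>M\<^esub> b (Suc k))"
      using w basis_vec dual_vec by (intro M.finsum_lessThan_Suc2) auto
    also have "\<dots> = (\<Oplus>\<^bsub>M\<^esub>k\<in>{..<m}. F (D (Suc k)) w \<odot>\<^bsub>M\<^esub> b (Suc k))"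
      using w basis_vec dual_vec by (simp add: Pi_def)
    also have "\<dots> = (\<Oplus>\<^bsub>M\<^esub>k\<in>{..<m}. v $ k \<odot>\<^bsub>M\<^esub> b (Suc k))"
      by (intro finsum_eqI) (auto simp: v_def)
    finally have "T = C_mat R gram' v" using C_mat_gram(3)[of v] v JR T by auto
    then show "T \<in> C_mat R gram' ` ?V" using v by blast
  next
    fix T assume "T \<in> C_mat R gram' ` ?V"
    then obtain v where v: "v \<in> ?V" and T: "T = C_mat R gram' v" by blast
    have vk: "k < m \<Longrightarrow> v $ k \<in> carrier R" for k using v JR by auto
    let ?w = "\<Oplus>\<^bsub>M\<^esub>k\<in>{..<m}. v $ k \<odot>\<^bsub>M\<^esub> b (Suc k)"
    have "F ?w y \<in> J" if "y \<in> carrier M" for y using FJ[OF v that] basis_vec by simp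
    then have "transvection (D 0) ?w (F (b 0) ?w) \<in> {transvection (D 0) w (F (b 0) w) |w.
        w \<in> carrier M \<and> F (D 0) w = \<zero> \<and> (\<forall>y\<in>carrier M. F w y \<in> J)}"
      using C_mat_gram(1,2)[of v] vk by (intro CollectI exI[of _ ?w]) simp
    then show "T \<in> ?mat ` {transvection (D 0) w (F (b 0) w) |w. w \<in> carrier M \<and> F (D 0) w = \<zero> \<and> (\<forall>y\<in>carrier M. F w y \<in> J)}"
      unfolding T using C_mat_gram(3)[of v] vk by (simp only: imageI)
  qed
  have R: "?mat ` transvections (b 0) J = R_mat R gram' ` ?V"
    unfolding transvections_normalized[OF J b0 M.a_inv_closed[OF D0] bD]
  proof (intro equalityI subsetI)
    have eq: "F (\<ominus>\<^bsub>M\<^esub> D 0) w = F w (D 0)" if "w \<in> carrier M" for w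
      using that D0 F_skew[of "D 0" w] by simp
    {
      fix T assume "T \<in> ?mat ` {transvection (b 0) w (F (\<ominus>\<^bsub>M\<^esub> D 0) w) |w. w \<in> carrier M \<and> F (b 0) w = \<zero> \<and> (\<forall>y\<in>carrier M. F w y \<in> J)}"
      then obtain w where w: "w \<in> carrier M" "F (b 0) w = \<zero>" "\<forall>y\<in>carrier M. F w y \<in> J"
        and T: "T = ?mat (transvection (b 0) w (F w (D 0)))" using eq by auto
      define v where "v = vec m (\<lambda>k. F w (b (Suc k)))"
      have v: "v \<in> ?V" using w basis_vec by (auto simp: v_def)
      have "F w (b 0) = \<zero>" using F_skew[of "b 0" w] w b0 by simp
      have "w = (\<Oplus>\<^bsub>M\<^esub>i\<in>{..<Suc m}. F w (b i) \<odot>\<^bsub>M\<^esub> D i)" using expand_dual[OF db w(1)] by simp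
      also have "\<dots> = F w (b 0) \<odot>\<^bsub>M\<^esub> D 0 \<oplus>\<^bsub>M\<^esub> (\<Oplus>\<^bsub>M\<^esub>k\<in>{..<m}. F w (b (Suc k)) \<odot>\<^bsub>M\<^esub> D (Suc k))"
        using w basis_vec dual_vec by (intro M.finsum_lessThan_Suc2) auto
      also have "\<dots> = (\<Oplus>\<^bsub>M\<^esub>k\<in>{..<m}. F w (b (Suc k)) \<odot>\<^bsub>M\<^esub> D (Suc k))"
        using w basis_vec dual_vec \<open>F w (b 0) = \<zero>\<close> by (simp add: Pi_def)
      also have "\<dots> = (\<Oplus>\<^bsub>M\<^esub>k\<in>{..<m}. v $ k \<odot>\<^bsub>M\<^esub> D (Suc k))"
        by (intro finsum_eqI) (auto simp: v_def)
      finally have "T = R_mat R gram' v" using R_mat_gram(3)[of v] v JR T by auto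
      then show "T \<in> R_mat R gram' ` ?V" using v by blast
    next
      fix T assume "T \<in> R_mat R gram' ` ?V"
      then obtain v where v: "v \<in> ?V" and T: "T = R_mat R gram' v" by blast
      have vk: "k < m \<Longrightarrow> v $ k \<in> carrier R" for k using v JR by auto
      let ?w = "\<Oplus>\<^bsub>M\<^esub>k\<in>{..<m}. v $ k \<odot>\<^bsub>M\<^esub> D (Suc k)"
      have "F ?w y \<in> J" if "y \<in> carrier M" for y using FJ[OF v that] dual_vec by simp
      then have "transvection (b 0) ?w (F ?w (D 0)) \<in> {transvection (b 0) w (F (\<ominus>\<^bsub>M\<^esub> D 0) w) |w.
          w \<in> carrier M \<and> F (b 0) w = \<zero> \<and> (\<forall>y\<in>carrier M. F w y \<in> J)}"
        using R_mat_gram(1,2)[of v] vk by (intro CollectI exI[of _ ?w]) (simp add: eq)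
      then show "T \<in> ?mat ` {transvection (b 0) w (F (\<ominus>\<^bsub>M\<^esub> D 0) w) |w. w \<in> carrier M \<and> F (b 0) w = \<zero> \<and> (\<forall>y\<in>carrier M. F w y \<in> J)}"
        unfolding T using R_mat_gram(3)[of v] vk by (simp only: imageI)
    }
  qed
  have "ESp_gens R gram' J = C_mat R gram' ` ?V \<union> R_mat R gram' ` ?V"
    by (simp add: ESp_gens_def gram_matrix_def Let_def)
  then show ?thesis by (simp add: pair_gens_def image_Un C R)
qed

lemma ESp_rel_gram:
  assumes J: "ideal J R"
  shows "matrix_of (Suc m) b D ` elementary (D 0) (b 0) J = ESp_rel R gram' J"
proof -
  interpret h: group_hom Iso "Sp_mat R gram'" "matrix_of (Suc m) b D" by (rule matrix_of_hom[OF db])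
  have "D 0 \<in> carrier M" "b 0 \<in> carrier M" using dual_vec basis_vec by auto
  from h.relative_closure_img[OF pair_gens_subset[OF this] pair_gens_generate[OF J]]
  show ?thesis
    by (simp add: elementary_def ESp_rel_eq ESp_gens_gram[OF J] ESp_gens_gram[OF R.oneideal])
qed

text \<open>\<open>f\<close> is only known to be linear. That it is an isometry follows, because a
  linear map is determined by its matrix and so coincides with the elementary isometry having the
  same matrix.\<close>

lemma matrix_in_ESp_rel:
  assumes J: "ideal J R" and f: "f \<in> module_hom R M M" and T: "is_matrix_of R M (Suc m) b f T"
  shows "T \<in> ESp_rel R gram' J \<longleftrightarrow> f \<in> elementary (D 0) (b 0) J"
proof -
  have "D 0 \<in> carrier M" "b 0 \<in> carrier M" using dual_vec basis_vec by auto
  from I.relative_closure_subgroup[OF pair_gens_subset[OF this] pair_gens_generate[OF J]]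
  have sub: "elementary (D 0) (b 0) J \<subseteq> carrier Iso"
    by (auto simp: elementary_def dest: subgroup.subset)
  have "T = matrix_of (Suc m) b D f" using is_matrix_of_iff[OF db f] T by simp
  then show ?thesis
    unfolding ESp_rel_gram[OF J, symmetric]
    using matrix_of_inj[OF db f] sub by (fastforce simp: isometry_iff)
qed

lemma elementary_subgroup:
  assumes J: "ideal J R"
  shows "subgroup (elementary (D 0) (b 0) J) Iso"
proof -
  have "D 0 \<in> carrier M" "b 0 \<in> carrier M" using dual_vec basis_vec by auto
  from I.relative_closure_subgroup[OF pair_gens_subset[OF this] pair_gens_generate[OF J]]
  show ?thesis by (simp add: elementary_def)
qed

end

end

section \<open>Polynomial extension\<close>

text \<open>Both sides run over the triples \<open>(i, l, n - i - l)\<close> with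
  \<open>i + l \<le> k\<close>. Keeping \<open>n\<close> apart from \<open>k\<close> makes an
  induction on \<open>k\<close> possible; the case \<open>k = n\<close> yields the associativity of
  convolutions.\<close>

lemma (in abelian_monoid) finsum_triangle:
  fixes t :: "nat \<Rightarrow> nat \<Rightarrow> nat \<Rightarrow> 'a" and k n :: nat
  assumes t: "\<And>i j k. t i j k \<in> carrier G"
  shows "k \<le> n \<Longrightarrow> (\<Oplus>j\<in>{..k}. \<Oplus>i\<in>{..j}. t i (j - i) (n - j))
    = (\<Oplus>i\<in>{..k}. \<Oplus>l\<in>{..k - i}. t i l (n - i - l))"
proof (induction k)
  case 0
  show ?case using t by simp
next
  case (Suc k)
  have "(\<Oplus>i\<in>{..k}. \<Oplus>l\<in>{..Suc k - i}. t i l (n - i - l))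
    = (\<Oplus>i\<in>{..k}. t i (Suc k - i) (n - Suc k) \<oplus> (\<Oplus>l\<in>{..k - i}. t i l (n - i - l)))"
    using t Suc.prems by (intro finsum_eqI) (auto simp: Suc_diff_le)
  also have "\<dots> = (\<Oplus>i\<in>{..k}. t i (Suc k - i) (n - Suc k)) \<oplus> (\<Oplus>i\<in>{..k}. \<Oplus>l\<in>{..k - i}. t i l (n - i - l))"
    using t by (intro finsum_addf) auto
  finally show ?case
    using Suc t by (simp add: a_ac)
qed

lemma up_iff: "f \<in> up M \<longleftrightarrow> (\<forall>i. f i \<in> carrier M) \<and> (\<exists>n. \<forall>i\<ge>n. f i = \<zero>\<^bsub>M\<^esub>)"
proof -
  have "(\<exists>n. bound \<zero>\<^bsub>M\<^esub> n f) \<longleftrightarrow> (\<exists>n. \<forall>i\<ge>n. f i = \<zero>\<^bsub>M\<^esub>)"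
  proof
    assume "\<exists>n. bound \<zero>\<^bsub>M\<^esub> n f"
    then obtain n where "bound \<zero>\<^bsub>M\<^esub> n f" by blast
    then have "\<forall>i\<ge>Suc n. f i = \<zero>\<^bsub>M\<^esub>" by (auto simp: bound_def)
    then show "\<exists>n. \<forall>i\<ge>n. f i = \<zero>\<^bsub>M\<^esub>" by blast
  qed (meson bound.intro less_imp_le)
  then show ?thesis by (auto simp: up_def)
qed

lemma upI2:
  assumes "\<And>i. f i \<in> carrier M" "\<And>i. n \<le> i \<Longrightarrow> f i = \<zero>\<^bsub>M\<^esub>"
  shows "f \<in> up M"
  using assms by (auto simp: up_iff)

lemma upE2:
  assumes "f \<in> up M"
  obtains n where "\<And>i. n \<le> i \<Longrightarrow> f i = \<zero>\<^bsub>M\<^esub>"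
  using assms by (auto simp: up_iff)

text \<open>Serves the scalar multiplication of \<open>M[X]\<close> and the extended form alike.
  Beyond the sum of the two bounds, one of the two arguments of \<open>h\<close> is zero in every
  summand.\<close>

lemma up_convolution:
  assumes "abelian_monoid N" "f \<in> up A" "g \<in> up B"
    and closed: "\<And>x y. x \<in> carrier A \<Longrightarrow> y \<in> carrier B \<Longrightarrow> h x y \<in> carrier N"
    and zero: "\<And>y. y \<in> carrier B \<Longrightarrow> h \<zero>\<^bsub>A\<^esub> y = \<zero>\<^bsub>N\<^esub>" "\<And>x. x \<in> carrier A \<Longrightarrow> h x \<zero>\<^bsub>B\<^esub> = \<zero>\<^bsub>N\<^esub>"
  shows "(\<lambda>k. \<Oplus>\<^bsub>N\<^esub>i\<in>{..k}. h (f i) (g (k - i))) \<in> up N"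
proof -
  interpret N: abelian_monoid N by fact
  from assms obtain n m where n: "\<And>i. n \<le> i \<Longrightarrow> f i = \<zero>\<^bsub>A\<^esub>" and m: "\<And>i. m \<le> i \<Longrightarrow> g i = \<zero>\<^bsub>B\<^esub>"
    by (metis upE2)
  show ?thesis
  proof (rule upI2[where n = "n + m"])
    show "(\<Oplus>\<^bsub>N\<^esub>i\<in>{..k}. h (f i) (g (k - i))) \<in> carrier N" for k
      using assms by (intro N.finsum_closed) auto
    show "(\<Oplus>\<^bsub>N\<^esub>i\<in>{..k}. h (f i) (g (k - i))) = \<zero>\<^bsub>N\<^esub>" if "n + m \<le> k" for k
    proof -
      have "(\<Oplus>\<^bsub>N\<^esub>i\<in>{..k}. h (f i) (g (k - i))) = (\<Oplus>\<^bsub>N\<^esub>i\<in>{..k}. \<zero>\<^bsub>N\<^esub>)"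
      proof (rule finsum_eqI)
        fix i assume "i \<in> {..k}"
        have "n \<le> i \<or> m \<le> k - i" using that by arith
        then show "h (f i) (g (k - i)) = \<zero>\<^bsub>N\<^esub>"
          using n m zero mem_upD assms(2,3) by metis
      qed simp
      then show ?thesis by simp
    qed
  qed
qed

lemma poly_module_simps:
  "carrier (poly_module M) = up M"
  "\<zero>\<^bsub>poly_module M\<^esub> = (\<lambda>i. \<zero>\<^bsub>M\<^esub>)"
  "f \<oplus>\<^bsub>poly_module M\<^esub> g = (\<lambda>i. f i \<oplus>\<^bsub>M\<^esub> g i)"
  "p \<odot>\<^bsub>poly_module M\<^esub> f = (\<lambda>k. \<Oplus>\<^bsub>M\<^esub>i\<in>{..k}. p i \<odot>\<^bsub>M\<^esub> f (k - i))"
  by (simp_all add: poly_module_def)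

lemma UP_simps:
  "carrier (UP R) = up R"
  "\<zero>\<^bsub>UP R\<^esub> = (\<lambda>i. \<zero>\<^bsub>R\<^esub>)"
  "\<one>\<^bsub>UP R\<^esub> = const_poly R \<one>\<^bsub>R\<^esub>"
  "p \<in> up R \<Longrightarrow> q \<in> up R \<Longrightarrow> p \<oplus>\<^bsub>UP R\<^esub> q = (\<lambda>i. p i \<oplus>\<^bsub>R\<^esub> q i)"
  "p \<in> up R \<Longrightarrow> q \<in> up R \<Longrightarrow> p \<otimes>\<^bsub>UP R\<^esub> q = (\<lambda>k. \<Oplus>\<^bsub>R\<^esub>i\<in>{..k}. p i \<otimes>\<^bsub>R\<^esub> q (k - i))"
  by (simp_all add: UP_def const_poly_def)

lemma (in cring) UP_is_cring: "cring (UP R)"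
proof -
  interpret U: UP_cring R "UP R" by (simp add: UP_cring_def is_cring)
  show ?thesis by (rule U.UP_cring)
qed

lemma (in cring) UP_minus:
  assumes "p \<in> up R"
  shows "\<ominus>\<^bsub>UP R\<^esub> p = (\<lambda>i. \<ominus> p i)"
proof -
  interpret U: cring "UP R" by (rule UP_is_cring)
  have "(\<lambda>i. \<ominus> p i) \<in> up R" using assms by (rule up_a_inv_closed)
  then show ?thesis using assms
    by (intro U.minus_equality) (auto simp: UP_simps mem_upD l_neg)
qed

lemma (in abelian_monoid) const_poly_up:
  "x \<in> carrier G \<Longrightarrow> const_poly G x \<in> up G"
  by (rule upI2[where n = 1]) (auto simp: const_poly_def)

lemma (in Module.module) finsum_smult_rdistr:
  assumes "finite A" "f \<in> A \<rightarrow> carrier R" "x \<in> carrier M"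
  shows "(\<Oplus>i\<in>A. f i) \<odot>\<^bsub>M\<^esub> x = (\<Oplus>\<^bsub>M\<^esub>i\<in>A. f i \<odot>\<^bsub>M\<^esub> x)"
  using assms by (induction A rule: finite_induct) (auto simp: Pi_def smult_l_distr)

context Module.module
begin

abbreviation "PX \<equiv> poly_module M"

lemma poly_smult_closed:
  assumes "p \<in> up R" "f \<in> up M"
  shows "p \<odot>\<^bsub>PX\<^esub> f \<in> up M"
  unfolding poly_module_simps
  by (rule up_convolution[OF M.abelian_monoid_axioms assms]) auto

lemma finsum_delta_0:
  fixes f :: "nat \<Rightarrow> 'c"
  assumes "f 0 \<in> carrier M" "\<And>i. 0 < i \<Longrightarrow> f i = \<zero>\<^bsub>M\<^esub>"
  shows "(\<Oplus>\<^bsub>M\<^esub>i\<in>{..k}. f i) = f 0"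
proof -
  have "(\<Oplus>\<^bsub>M\<^esub>i\<in>{..k}. f i) = (\<Oplus>\<^bsub>M\<^esub>i\<in>{..k}. if i = 0 then f i else \<zero>\<^bsub>M\<^esub>)"
    using assms by (intro finsum_eqI) auto
  then show ?thesis using M.finsum_delta[of 0 "{..k}" f] assms by simp
qed

lemma finsum_delta_last:
  fixes f :: "nat \<Rightarrow> 'c"
  assumes "f k \<in> carrier M" "\<And>i. i < k \<Longrightarrow> f i = \<zero>\<^bsub>M\<^esub>"
  shows "(\<Oplus>\<^bsub>M\<^esub>i\<in>{..k}. f i) = f k"
proof -
  have "(\<Oplus>\<^bsub>M\<^esub>i\<in>{..k}. f i) = (\<Oplus>\<^bsub>M\<^esub>i\<in>{..k}. if i = k then f i else \<zero>\<^bsub>M\<^esub>)"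
    using assms by (intro finsum_eqI) auto
  then show ?thesis using M.finsum_delta[of k "{..k}" f] assms by simp
qed

lemma const_smult:
  assumes "a \<in> carrier R" "f \<in> up M"
  shows "const_poly R a \<odot>\<^bsub>PX\<^esub> f = (\<lambda>k. a \<odot>\<^bsub>M\<^esub> f k)"
proof
  fix k
  show "(const_poly R a \<odot>\<^bsub>PX\<^esub> f) k = a \<odot>\<^bsub>M\<^esub> f k"
    unfolding poly_module_simps
    using finsum_delta_0[of "\<lambda>i. const_poly R a i \<odot>\<^bsub>M\<^esub> f (k - i)" k] assms mem_upD[OF assms(2)]
    by (simp add: const_poly_def)
qed

lemma smult_const:
  assumes "p \<in> up R" "x \<in> carrier M"
  shows "p \<odot>\<^bsub>PX\<^esub> const_poly M x = (\<lambda>k. p k \<odot>\<^bsub>M\<^esub> x)"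
proof
  fix k
  show "(p \<odot>\<^bsub>PX\<^esub> const_poly M x) k = p k \<odot>\<^bsub>M\<^esub> x"
    unfolding poly_module_simps
    using finsum_delta_last[of "\<lambda>i. p i \<odot>\<^bsub>M\<^esub> const_poly M x (k - i)" k] assms mem_upD[OF assms(1)]
    by (simp add: const_poly_def)
qed

lemma poly_module: "Module.module (UP R) PX"
proof (rule moduleI)
  show "cring (UP R)" by (rule R.UP_is_cring)
  show "abelian_group PX"
  proof (rule abelian_groupI)
    show "f \<oplus>\<^bsub>PX\<^esub> g \<in> carrier PX" if "f \<in> carrier PX" "g \<in> carrier PX" for f g
    proof -
      have fg: "f \<in> up M" "g \<in> up M" using that by (simp_all add: poly_module_simps)
      then obtain n m where n: "\<And>i. n \<le> i \<Longrightarrow> f i = \<zero>\<^bsub>M\<^esub>" and m: "\<And>i. m \<le> i \<Longrightarrow> g i = \<zero>\<^bsub>M\<^esub>"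
        by (metis upE2)
      show ?thesis unfolding poly_module_simps
        using fg n m by (intro upI2[where n = "max n m"]) auto
    qed
    show "\<exists>g\<in>carrier PX. g \<oplus>\<^bsub>PX\<^esub> f = \<zero>\<^bsub>PX\<^esub>" if "f \<in> carrier PX" for f
    proof -
      have f: "f \<in> up M" using that by (simp add: poly_module_simps)
      then obtain n where n: "\<And>i. n \<le> i \<Longrightarrow> f i = \<zero>\<^bsub>M\<^esub>" by (metis upE2)
      have "(\<lambda>i. \<ominus>\<^bsub>M\<^esub> f i) \<in> up M" using f n by (intro upI2[where n = n]) auto
      then show ?thesis using f
        by (intro bexI[of _ "\<lambda>i. \<ominus>\<^bsub>M\<^esub> f i"]) (auto simp: poly_module_simps mem_upD M.l_neg)
    qed
  qed (auto simp: poly_module_simps mem_upD M.a_ac intro: upI2)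
next
  fix p f assume "p \<in> carrier (UP R)" "f \<in> carrier PX"
  then show "p \<odot>\<^bsub>PX\<^esub> f \<in> carrier PX"
    using poly_smult_closed by (simp add: poly_module_simps(1) UP_simps)
next
  fix p q f assume "p \<in> carrier (UP R)" "q \<in> carrier (UP R)" "f \<in> carrier PX"
  then have pq: "p \<in> up R" "q \<in> up R" "f \<in> up M" by (simp_all add: poly_module_simps UP_simps)
  note c = mem_upD[OF pq(1)] mem_upD[OF pq(2)] mem_upD[OF pq(3)]
  show "(p \<oplus>\<^bsub>UP R\<^esub> q) \<odot>\<^bsub>PX\<^esub> f = p \<odot>\<^bsub>PX\<^esub> f \<oplus>\<^bsub>PX\<^esub> q \<odot>\<^bsub>PX\<^esub> f"
    using pq c by (simp add: poly_module_simps UP_simps smult_l_distr M.finsum_addf Pi_def)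
  show "p \<otimes>\<^bsub>UP R\<^esub> q \<odot>\<^bsub>PX\<^esub> f = p \<odot>\<^bsub>PX\<^esub> (q \<odot>\<^bsub>PX\<^esub> f)"
  proof
    fix n
    have "(p \<otimes>\<^bsub>UP R\<^esub> q \<odot>\<^bsub>PX\<^esub> f) n
      = (\<Oplus>\<^bsub>M\<^esub>j\<in>{..n}. \<Oplus>\<^bsub>M\<^esub>i\<in>{..j}. p i \<otimes> q (j - i) \<odot>\<^bsub>M\<^esub> f (n - j))"
      using pq c by (auto simp: poly_module_simps UP_simps finsum_smult_rdistr Pi_def intro!: finsum_eqI)
    also have "\<dots> = (\<Oplus>\<^bsub>M\<^esub>i\<in>{..n}. \<Oplus>\<^bsub>M\<^esub>l\<in>{..n - i}. p i \<otimes> q l \<odot>\<^bsub>M\<^esub> f (n - i - l))"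
      using M.finsum_triangle[of "\<lambda>i l k. p i \<otimes> q l \<odot>\<^bsub>M\<^esub> f k" n n] c by simp
    also have "\<dots> = (p \<odot>\<^bsub>PX\<^esub> (q \<odot>\<^bsub>PX\<^esub> f)) n"
      using pq c by (auto simp: poly_module_simps smult_assoc1 finsum_smult_ldistr Pi_def intro!: finsum_eqI)
    finally show "(p \<otimes>\<^bsub>UP R\<^esub> q \<odot>\<^bsub>PX\<^esub> f) n = (p \<odot>\<^bsub>PX\<^esub> (q \<odot>\<^bsub>PX\<^esub> f)) n" .
  qed
next
  fix p f g assume "p \<in> carrier (UP R)" "f \<in> carrier PX" "g \<in> carrier PX"
  then have pq: "p \<in> up R" "f \<in> up M" "g \<in> up M" by (simp_all add: poly_module_simps UP_simps)
  note c = mem_upD[OF pq(1)] mem_upD[OF pq(2)] mem_upD[OF pq(3)]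
  show "p \<odot>\<^bsub>PX\<^esub> (f \<oplus>\<^bsub>PX\<^esub> g) = p \<odot>\<^bsub>PX\<^esub> f \<oplus>\<^bsub>PX\<^esub> p \<odot>\<^bsub>PX\<^esub> g"
    using pq c by (simp add: poly_module_simps smult_r_distr M.finsum_addf Pi_def)
next
  fix f assume "f \<in> carrier PX"
  then have f: "f \<in> up M" by (simp add: poly_module_simps)
  then have "f i \<in> carrier M" for i by auto
  then show "\<one>\<^bsub>UP R\<^esub> \<odot>\<^bsub>PX\<^esub> f = f" using f const_smult[of "\<one>" f] by (simp add: UP_simps)
qed

end

section \<open>The extended form on \<open>M[X]\<close>\<close>

context form_module
begin

abbreviation "FX \<equiv> poly_form R F"

lemma poly_form_closed:
  assumes "f \<in> up M" "g \<in> up M"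
  shows "FX f g \<in> up R"
  unfolding poly_form_def
  by (rule up_convolution[OF R.abelian_monoid_axioms assms]) auto

lemma poly_form_skew:
  assumes "f \<in> up M" "g \<in> up M"
  shows "FX g f = (\<lambda>k. \<ominus> FX f g k)"
proof
  fix k
  note c = mem_upD[OF assms(1)] mem_upD[OF assms(2)]
  have "(\<Oplus>i\<in>{..k}. F (g i) (f (k - i))) = (\<Oplus>i\<in>(\<lambda>i. k - i) ` {..k}. F (g i) (f (k - i)))"
  proof (rule finsum_eqI)
    show "{..k} = (\<lambda>i. k - i) ` {..k}"
    proof (intro equalityI subsetI)
      fix x assume "x \<in> {..k}"
      then show "x \<in> (\<lambda>i. k - i) ` {..k}" by (intro image_eqI[of _ _ "k - x"]) auto
    qed auto
  qed simp
  also have "\<dots> = (\<Oplus>i\<in>{..k}. F (g (k - i)) (f (k - (k - i))))"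
    using c by (intro R.finsum_reindex) (auto intro: inj_onI)
  also have "\<dots> = (\<Oplus>i\<in>{..k}. \<ominus> F (f i) (g (k - i)))"
    using c by (intro finsum_eqI) (auto intro!: F_skew)
  also have "\<dots> = \<ominus> (\<Oplus>i\<in>{..k}. F (f i) (g (k - i)))"
  proof -
    have "(\<Oplus>i\<in>{..k}. \<ominus> F (f i) (g (k - i))) \<oplus> (\<Oplus>i\<in>{..k}. F (f i) (g (k - i))) = \<zero>"
      using c by (simp add: R.finsum_addf[symmetric] R.l_neg Pi_def)
    then show ?thesis using c by (intro R.minus_equality[symmetric]) auto
  qed
  finally show "FX g f k = \<ominus> FX f g k" by (simp add: poly_form_def)
qed

text \<open>The summands at \<open>i\<close> and \<open>k - i\<close> cancel, and the middle one,
  present for even \<open>k\<close>, vanishes since \<open>F\<close> is alternating. Skew symmetry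
  alone would only make twice the middle summand zero.\<close>

lemma poly_form_alt:
  assumes f: "f \<in> up M"
  shows "FX f f = (\<lambda>k. \<zero>)"
proof
  fix k
  note c = mem_upD[OF f]
  let ?t = "\<lambda>i. F (f i) (f (k - i))"
  let ?A = "{i. 2 * i < k}" and ?B = "{i. i \<le> k \<and> k < 2 * i}" and ?C = "{i. 2 * i = k}"
  have fin: "finite ?A" "finite ?B" "finite ?C"
    by (auto intro: finite_subset[of _ "{..k}"])
  have t: "?t i \<in> carrier R" for i using c by auto
  have "?B = (\<lambda>i. k - i) ` ?A"
  proof (intro equalityI subsetI)
    fix x assume "x \<in> ?B"
    then show "x \<in> (\<lambda>i. k - i) ` ?A" by (intro image_eqI[of _ _ "k - x"]) auto
  qed auto
  then have "(\<Oplus>i\<in>?B. ?t i) = (\<Oplus>i\<in>?A. ?t (k - i))"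
    using t by (simp only:) (intro R.finsum_reindex, auto intro: inj_onI)
  also have "\<dots> = (\<Oplus>i\<in>?A. \<ominus> ?t i)"
    using c by (intro finsum_eqI) (auto intro!: F_skew)
  finally have B: "(\<Oplus>i\<in>?A. ?t i) \<oplus> (\<Oplus>i\<in>?B. ?t i) = \<zero>"
    using t fin by (simp add: R.finsum_addf[symmetric] R.r_neg Pi_def)
  have C: "(\<Oplus>i\<in>?C. ?t i) = (\<Oplus>i\<in>?C. \<zero>)"
    using c by (intro finsum_eqI) (auto simp: mult_2)
  have "{..k} = (?A \<union> ?B) \<union> ?C" by auto
  then have "(\<Oplus>i\<in>{..k}. ?t i) = (\<Oplus>i\<in>?A \<union> ?B. ?t i) \<oplus> (\<Oplus>i\<in>?C. ?t i)"
    using t fin by (simp only:) (intro R.finsum_Un_disjoint, auto)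
  also have "(\<Oplus>i\<in>?A \<union> ?B. ?t i) = (\<Oplus>i\<in>?A. ?t i) \<oplus> (\<Oplus>i\<in>?B. ?t i)"
    using t fin by (intro R.finsum_Un_disjoint) auto
  finally show "FX f f k = \<zero>" using B C by (simp add: poly_form_def)
qed

lemma poly_form_const:
  assumes "x \<in> carrier M" "f \<in> up M"
  shows "FX (const_poly M x) f = (\<lambda>k. F x (f k))"
proof
  fix k
  note c = mem_upD[OF assms(2)]
  have "(\<Oplus>i\<in>{..k}. F (const_poly M x i) (f (k - i))) = (\<Oplus>i\<in>{..k}. if i = 0 then F x (f k) else \<zero>)"
    using assms c by (intro finsum_eqI) (auto simp: const_poly_def)
  also have "\<dots> = F x (f k)" using R.finsum_delta[of 0 "{..k}" "\<lambda>_. F x (f k)"] assms c by simp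
  finally show "FX (const_poly M x) f k = F x (f k)" by (simp add: poly_form_def)
qed

lemma poly_form_smult_l:
  assumes "p \<in> up R" "f \<in> up M" "g \<in> up M"
  shows "FX (p \<odot>\<^bsub>PX\<^esub> f) g = p \<otimes>\<^bsub>UP R\<^esub> FX f g"
proof
  fix n
  note c = mem_upD[OF assms(1)] mem_upD[OF assms(2)] mem_upD[OF assms(3)]
  have "FX (p \<odot>\<^bsub>PX\<^esub> f) g n = (\<Oplus>j\<in>{..n}. F (\<Oplus>\<^bsub>M\<^esub>i\<in>{..j}. p i \<odot>\<^bsub>M\<^esub> f (j - i)) (g (n - j)))"
    by (simp add: poly_form_def poly_module_simps)
  also have "\<dots> = (\<Oplus>j\<in>{..n}. \<Oplus>i\<in>{..j}. p i \<otimes> F (f (j - i)) (g (n - j)))"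
    using c by (intro finsum_eqI) (simp_all add: F_finsum_l)
  also have "\<dots> = (\<Oplus>i\<in>{..n}. \<Oplus>l\<in>{..n - i}. p i \<otimes> F (f l) (g (n - i - l)))"
    using R.finsum_triangle[of "\<lambda>i l k. p i \<otimes> F (f l) (g k)" n n] c by simp
  also have "\<dots> = (\<Oplus>i\<in>{..n}. p i \<otimes> (\<Oplus>l\<in>{..n - i}. F (f l) (g (n - i - l))))"
    using c by (intro finsum_eqI) (simp_all add: R.finsum_rdistr Pi_def)
  also have "\<dots> = (p \<otimes>\<^bsub>UP R\<^esub> FX f g) n"
    using assms poly_form_closed by (simp add: UP_simps) (simp add: poly_form_def)
  finally show "FX (p \<odot>\<^bsub>PX\<^esub> f) g n = (p \<otimes>\<^bsub>UP R\<^esub> FX f g) n" .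
qed

lemma poly_form_module: "form_module (UP R) PX FX"
proof (intro form_module.intro form_module_axioms.intro poly_module)
  interpret U: cring "UP R" by (rule R.UP_is_cring)
  interpret PX: Module.module "UP R" PX by (rule poly_module)
  fix f g assume "f \<in> carrier PX" "g \<in> carrier PX"
  then have f: "f \<in> up M" and g: "g \<in> up M" by (simp_all add: poly_module_simps)
  note cf = mem_upD[OF f] and cg = mem_upD[OF g]
  show "FX f g \<in> carrier (UP R)" using poly_form_closed[OF f g] by (simp add: UP_simps)
  show "FX f f = \<zero>\<^bsub>UP R\<^esub>" using poly_form_alt[OF f] by (simp add: UP_simps)
  show sm: "FX (p \<odot>\<^bsub>PX\<^esub> f) g = p \<otimes>\<^bsub>UP R\<^esub> FX f g" if "p \<in> carrier (UP R)" for p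
    using poly_form_smult_l that f g by (simp add: UP_simps(1))
  show "FX f (p \<odot>\<^bsub>PX\<^esub> g) = p \<otimes>\<^bsub>UP R\<^esub> FX f g" if "p \<in> carrier (UP R)" for p
  proof -
    have p: "p \<in> up R" using that by (simp add: UP_simps)
    have "FX f (p \<odot>\<^bsub>PX\<^esub> g) = \<ominus>\<^bsub>UP R\<^esub> (p \<otimes>\<^bsub>UP R\<^esub> FX g f)"
      using poly_form_skew[OF poly_smult_closed[OF p g] f] poly_form_smult_l[OF p g f]
        R.UP_minus[OF poly_form_closed[OF poly_smult_closed[OF p g] f]] by simp
    also have "FX g f = \<ominus>\<^bsub>UP R\<^esub> FX f g"
      using poly_form_skew[OF f g] R.UP_minus[OF poly_form_closed[OF f g]] by simp
    finally show ?thesis using that \<open>FX f g \<in> carrier (UP R)\<close> by (simp add: U.r_minus)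
  qed
  fix h assume "h \<in> carrier PX"
  then have h: "h \<in> up M" by (simp add: poly_module_simps)
  note ch = mem_upD[OF h]
  show "FX (f \<oplus>\<^bsub>PX\<^esub> g) h = FX f h \<oplus>\<^bsub>UP R\<^esub> FX g h"
    using poly_form_closed[OF f h] poly_form_closed[OF g h] cf cg ch
    by (simp add: UP_simps) (simp add: poly_form_def poly_module_simps R.finsum_addf Pi_def)
  show "FX h (f \<oplus>\<^bsub>PX\<^esub> g) = FX h f \<oplus>\<^bsub>UP R\<^esub> FX h g"
    using poly_form_closed[OF h f] poly_form_closed[OF h g] cf cg ch
    by (simp add: UP_simps) (simp add: poly_form_def poly_module_simps R.finsum_addf Pi_def)
next
  fix f g assume "f \<in> carrier PX" "g \<in> carrier PX"
  then have f: "f \<in> up M" and g: "g \<in> up M" by (simp_all add: poly_module_simps)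
  assume eq: "\<And>z. z \<in> carrier PX \<Longrightarrow> FX z f = FX z g"
  show "f = g"
  proof
    fix k
    show "f k = g k"
    proof (rule F_nondegenerate)
      fix z assume z: "z \<in> carrier M"
      \<comment> \<open>Pairing with constants reads off the coefficients, so constants already
        separate points.\<close>
      have "FX (const_poly M z) f = FX (const_poly M z) g"
        using M.const_poly_up[OF z] by (intro eq) (simp add: poly_module_simps)
      then show "F z (f k) = F z (g k)"
        using poly_form_const[OF z] f g by (metis (no_types, lifting))
    qed (use f g in auto)
  qed
qed

end

section \<open>Substitution \<open>X = a\<close>\<close>

context Module.module
begin

definition poly_eval where
  "poly_eval a f = (\<Oplus>\<^bsub>M\<^esub>i\<in>{i::nat. f i \<noteq> \<zero>\<^bsub>M\<^esub>}. (a [^] i) \<odot>\<^bsub>M\<^esub> f i)"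

text \<open>\<open>eval_map\<close> sums over the support, which differs from one polynomial to the
  next. With an initial segment instead, several polynomials can share one index set.\<close>

lemma poly_eval_bound:
  assumes f: "f \<in> up M" and a: "a \<in> carrier R" and n: "\<And>i. n \<le> i \<Longrightarrow> f i = \<zero>\<^bsub>M\<^esub>"
  shows "poly_eval a f = (\<Oplus>\<^bsub>M\<^esub>i\<in>{..<n}. (a [^] i) \<odot>\<^bsub>M\<^esub> f i)"
proof -
  let ?S = "{i. f i \<noteq> \<zero>\<^bsub>M\<^esub>}" and ?t = "\<lambda>i. (a [^] i) \<odot>\<^bsub>M\<^esub> f i"
  have S: "?S \<subseteq> {..<n}" using n by (metis (mono_tags) lessThan_iff mem_Collect_eq not_le subsetI)
  have t: "?t i \<in> carrier M" for i using a mem_upD[OF f] by simp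
  have "{..<n} = ?S \<union> ({..<n} - ?S)" using S by auto
  then have "(\<Oplus>\<^bsub>M\<^esub>i\<in>{..<n}. ?t i) = (\<Oplus>\<^bsub>M\<^esub>i\<in>?S \<union> ({..<n} - ?S). ?t i)" by simp
  also have "\<dots> = (\<Oplus>\<^bsub>M\<^esub>i\<in>?S. ?t i) \<oplus>\<^bsub>M\<^esub> (\<Oplus>\<^bsub>M\<^esub>i\<in>{..<n} - ?S. ?t i)"
    using t finite_subset[OF S] by (intro M.finsum_Un_disjoint) auto
  also have "(\<Oplus>\<^bsub>M\<^esub>i\<in>{..<n} - ?S. ?t i) = (\<Oplus>\<^bsub>M\<^esub>i\<in>{..<n} - ?S. \<zero>\<^bsub>M\<^esub>)"
    using a by (intro finsum_eqI) auto
  finally show ?thesis using t by (simp add: poly_eval_def)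
qed

lemma poly_eval_closed [simp]:
  assumes "f \<in> up M" "a \<in> carrier R"
  shows "poly_eval a f \<in> carrier M"
  unfolding poly_eval_def using assms mem_upD[OF assms(1)] by (intro M.finsum_closed) auto

lemma poly_eval_const:
  assumes "x \<in> carrier M" "a \<in> carrier R"
  shows "poly_eval a (const_poly M x) = x"
  using poly_eval_bound[OF M.const_poly_up[OF assms(1)] assms(2), of 1] assms
  by (simp add: const_poly_def lessThan_Suc)

lemma poly_eval_add:
  assumes "f \<in> up M" "g \<in> up M" "a \<in> carrier R"
  shows "poly_eval a (\<lambda>i. f i \<oplus>\<^bsub>M\<^esub> g i) = poly_eval a f \<oplus>\<^bsub>M\<^esub> poly_eval a g"
proof -
  obtain n m where n: "\<And>i. n \<le> i \<Longrightarrow> f i = \<zero>\<^bsub>M\<^esub>" and m: "\<And>i. m \<le> i \<Longrightarrow> g i = \<zero>\<^bsub>M\<^esub>"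
    using assms by (metis upE2)
  interpret PX: Module.module "UP R" PX by (rule poly_module)
  have fg: "(\<lambda>i. f i \<oplus>\<^bsub>M\<^esub> g i) \<in> up M"
    using PX.M.add.m_closed[of f g] assms by (simp add: poly_module_simps)
  note c = mem_upD[OF assms(1)] mem_upD[OF assms(2)]
  let ?n = "max n m"
  show ?thesis
    using poly_eval_bound[of f a ?n] poly_eval_bound[of g a ?n] poly_eval_bound[of _ a ?n, OF fg]
      assms n m c by (simp add: smult_r_distr M.finsum_addf Pi_def)
qed

lemma poly_eval_smult:
  assumes "f \<in> up M" "a \<in> carrier R" "c \<in> carrier R"
  shows "poly_eval a (\<lambda>i. c \<odot>\<^bsub>M\<^esub> f i) = c \<odot>\<^bsub>M\<^esub> poly_eval a f"
proof -
  obtain n where n: "\<And>i. n \<le> i \<Longrightarrow> f i = \<zero>\<^bsub>M\<^esub>" using assms by (metis upE2)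
  note cl = mem_upD[OF assms(1)]
  have cf: "(\<lambda>i. c \<odot>\<^bsub>M\<^esub> f i) \<in> up M" using n cl assms by (intro upI2[where n = n]) auto
  have "a [^] i \<odot>\<^bsub>M\<^esub> (c \<odot>\<^bsub>M\<^esub> f i) = c \<odot>\<^bsub>M\<^esub> (a [^] i \<odot>\<^bsub>M\<^esub> f i)" for i
    using assms cl by (simp add: smult_assoc1[symmetric] R.m_comm)
  then show ?thesis
    using poly_eval_bound[OF assms(1,2) n] poly_eval_bound[OF cf assms(2), of n] n assms cl
    by (simp add: finsum_smult_ldistr Pi_def)
qed

text \<open>Multiplication by \<open>X\<close>, on coefficients.\<close>

definition shift_up where "shift_up f = (\<lambda>i. case i of 0 \<Rightarrow> \<zero>\<^bsub>M\<^esub> | Suc j \<Rightarrow> f j)"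

lemma shift_up_closed: "f \<in> up M \<Longrightarrow> shift_up f \<in> up M"
proof -
  assume f: "f \<in> up M"
  then obtain n where n: "\<And>i. n \<le> i \<Longrightarrow> f i = \<zero>\<^bsub>M\<^esub>" by (metis upE2)
  show ?thesis using f n
    by (intro upI2[where n = "Suc n"]) (auto simp: shift_up_def split: nat.splits)
qed

lemma poly_eval_shift:
  assumes "f \<in> up M" "a \<in> carrier R"
  shows "poly_eval a (shift_up f) = a \<odot>\<^bsub>M\<^esub> poly_eval a f"
proof -
  obtain n where n: "\<And>i. n \<le> i \<Longrightarrow> f i = \<zero>\<^bsub>M\<^esub>" using assms by (metis upE2)
  note cl = mem_upD[OF assms(1)]
  have z: "shift_up f i = \<zero>\<^bsub>M\<^esub>" if "Suc n \<le> i" for i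
    using that n by (auto simp: shift_up_def split: nat.splits)
  have sc: "shift_up f i \<in> carrier M" for i using mem_upD[OF shift_up_closed[OF assms(1)]] .
  have "poly_eval a (shift_up f) = (\<Oplus>\<^bsub>M\<^esub>i\<in>{..<Suc n}. a [^] i \<odot>\<^bsub>M\<^esub> shift_up f i)"
    by (rule poly_eval_bound[OF shift_up_closed[OF assms(1)] assms(2) z])
  also have "\<dots> = a [^] (0::nat) \<odot>\<^bsub>M\<^esub> shift_up f 0 \<oplus>\<^bsub>M\<^esub> (\<Oplus>\<^bsub>M\<^esub>i\<in>{..<n}. a [^] Suc i \<odot>\<^bsub>M\<^esub> shift_up f (Suc i))"
    using sc assms by (intro M.finsum_lessThan_Suc2) auto
  also have "\<dots> = (\<Oplus>\<^bsub>M\<^esub>i\<in>{..<n}. a \<odot>\<^bsub>M\<^esub> (a [^] i \<odot>\<^bsub>M\<^esub> f i))"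
  proof -
    have "a [^] Suc i \<odot>\<^bsub>M\<^esub> f i = a \<odot>\<^bsub>M\<^esub> (a [^] i \<odot>\<^bsub>M\<^esub> f i)" for i
      using assms cl by (simp add: smult_assoc1[symmetric] R.m_comm)
    then show ?thesis using assms cl by (simp add: shift_up_def Pi_def)
  qed
  also have "\<dots> = a \<odot>\<^bsub>M\<^esub> poly_eval a f"
    using poly_eval_bound[OF assms n] assms cl by (simp add: finsum_smult_ldistr Pi_def)
  finally show ?thesis .
qed

text \<open>Horner's scheme: every polynomial is a constant plus \<open>X\<close> times a polynomial
  with a smaller bound.\<close>

lemma up_induct [consumes 1, case_names zero shift]:
  assumes f: "f \<in> up M" and zero: "P (\<lambda>i. \<zero>\<^bsub>M\<^esub>)"
    and shift: "\<And>x g. x \<in> carrier M \<Longrightarrow> g \<in> up M \<Longrightarrow> P g \<Longrightarrow>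
      P (\<lambda>i. const_poly M x i \<oplus>\<^bsub>M\<^esub> shift_up g i)"
  shows "P f"
proof -
  obtain n where "\<And>i. n \<le> i \<Longrightarrow> f i = \<zero>\<^bsub>M\<^esub>" using f by (metis upE2)
  then show ?thesis using f
  proof (induction n arbitrary: f)
    case 0
    then have "f = (\<lambda>i. \<zero>\<^bsub>M\<^esub>)" by auto
    then show ?case using zero by simp
  next
    case (Suc n)
    let ?g = "\<lambda>i. f (Suc i)"
    have g: "?g \<in> up M" using Suc.prems mem_upD[OF Suc.prems(2)] by (intro upI2[where n = n]) auto
    have "f i = const_poly M (f 0) i \<oplus>\<^bsub>M\<^esub> shift_up ?g i" for i
      using mem_upD[OF Suc.prems(2)] by (auto simp: const_poly_def shift_up_def split: nat.splits)
    then have f: "f = (\<lambda>i. const_poly M (f 0) i \<oplus>\<^bsub>M\<^esub> shift_up ?g i)" by blast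
    have "P ?g" using Suc.prems by (intro Suc.IH g) auto
    from shift[OF _ g this, of "f 0"] show ?case
      using f mem_upD[OF Suc.prems(2), of 0] by simp
  qed
qed

definition poly_X where "poly_X = (\<lambda>i. if i = (1::nat) then \<one> else \<zero>)"

lemma poly_X_closed: "poly_X \<in> up R"
  by (rule upI2[where n = 2]) (auto simp: poly_X_def)

lemma poly_X_smult:
  assumes "f \<in> up M"
  shows "poly_X \<odot>\<^bsub>PX\<^esub> f = shift_up f"
proof
  fix k
  note cl = mem_upD[OF assms]
  show "(poly_X \<odot>\<^bsub>PX\<^esub> f) k = shift_up f k"
  proof (cases k)
    case 0
    then show ?thesis using cl by (simp add: poly_module_simps shift_up_def poly_X_def)
  next
    case (Suc j)
    have "(poly_X \<odot>\<^bsub>PX\<^esub> f) k = (\<Oplus>\<^bsub>M\<^esub>i\<in>{..k}. if i = 1 then f (k - i) else \<zero>\<^bsub>M\<^esub>)"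
      unfolding poly_module_simps using cl by (intro finsum_eqI) (auto simp: poly_X_def)
    also have "\<dots> = f (k - 1)" using M.finsum_delta[of 1 "{..k}" "\<lambda>i. f (k - i)"] cl Suc by simp
    finally show ?thesis using Suc by (simp add: shift_up_def)
  qed
qed

lemma eval_map_apply:
  "x \<in> carrier M \<Longrightarrow> eval_map R M \<alpha> a x = poly_eval a (\<alpha> (const_poly M x))"
  by (simp add: eval_map_def poly_eval_def Let_def)

text \<open>The value of \<open>\<alpha> f\<close> at \<open>a\<close> depends on the value of
  \<open>f\<close> at \<open>a\<close> only: both sides agree on constants, and both turn
  multiplication by \<open>X\<close> into multiplication by \<open>a\<close>. This is what makes
  evaluation of endomorphisms multiplicative.\<close>

lemma poly_eval_hom:
  assumes \<alpha>: "\<alpha> \<in> module_hom (UP R) PX PX" and a: "a \<in> carrier R" and f: "f \<in> up M"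
  shows "eval_map R M \<alpha> a \<in> module_hom R M M"
    "poly_eval a (\<alpha> f) = eval_map R M \<alpha> a (poly_eval a f)"
proof -
  note h = module_homD[OF \<alpha>, unfolded poly_module_simps(1) UP_simps(1)]
  interpret PX: Module.module "UP R" PX by (rule poly_module)
  have const_add: "const_poly M (x \<oplus>\<^bsub>M\<^esub> y) = const_poly M x \<oplus>\<^bsub>PX\<^esub> const_poly M y"
    if "x \<in> carrier M" "y \<in> carrier M" for x y
    using that by (auto simp: const_poly_def poly_module_simps)
  have const_sm: "const_poly M (c \<odot>\<^bsub>M\<^esub> x) = const_poly R c \<odot>\<^bsub>PX\<^esub> const_poly M x"
    if "c \<in> carrier R" "x \<in> carrier M" for c x
    using that const_smult[OF _ M.const_poly_up] by (auto simp: const_poly_def)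
  show lin: "eval_map R M \<alpha> a \<in> module_hom R M M"
  proof (rule module_homI)
    fix x assume x: "x \<in> carrier M"
    note cx = M.const_poly_up[OF x]
    show "eval_map R M \<alpha> a x \<in> carrier M"
      using x cx h(1) a by (simp add: eval_map_apply)
    show "eval_map R M \<alpha> a (c \<odot>\<^bsub>M\<^esub> x) = c \<odot>\<^bsub>M\<^esub> eval_map R M \<alpha> a x" if c: "c \<in> carrier R" for c
    proof -
      have "\<alpha> (const_poly M (c \<odot>\<^bsub>M\<^esub> x)) = const_poly R c \<odot>\<^bsub>PX\<^esub> \<alpha> (const_poly M x)"
        unfolding const_sm[OF c x] by (rule h(3)[OF R.const_poly_up[OF c] cx])
      then show ?thesis
        using x cx c h(1) a by (simp add: eval_map_apply const_smult poly_eval_smult)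
    qed
    fix y assume y: "y \<in> carrier M"
    note cy = M.const_poly_up[OF y]
    show "eval_map R M \<alpha> a (x \<oplus>\<^bsub>M\<^esub> y) = eval_map R M \<alpha> a x \<oplus>\<^bsub>M\<^esub> eval_map R M \<alpha> a y"
      using x y cx cy h(1,2) a
      by (simp add: eval_map_apply const_add poly_module_simps(3) poly_eval_add)
  qed (simp add: eval_map_def)
  note l = module_homD[OF lin]
  show "poly_eval a (\<alpha> f) = eval_map R M \<alpha> a (poly_eval a f)"
    using f
  proof (induction rule: up_induct)
    case zero
    have z: "(\<lambda>i. \<zero>\<^bsub>M\<^esub>) = const_poly M \<zero>\<^bsub>M\<^esub>" by (auto simp: const_poly_def)
    show ?case unfolding z using a by (simp add: poly_eval_const eval_map_apply)
  next
    case (shift x g)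
    have eq: "(\<lambda>i. const_poly M x i \<oplus>\<^bsub>M\<^esub> shift_up g i) = const_poly M x \<oplus>\<^bsub>PX\<^esub> poly_X \<odot>\<^bsub>PX\<^esub> g"
      using shift by (simp add: poly_X_smult poly_module_simps(3))
    note cx = M.const_poly_up[OF shift(1)]
    have "\<alpha> (const_poly M x \<oplus>\<^bsub>PX\<^esub> poly_X \<odot>\<^bsub>PX\<^esub> g) = \<alpha> (const_poly M x) \<oplus>\<^bsub>PX\<^esub> shift_up (\<alpha> g)"
      using h(2)[OF cx poly_smult_closed[OF poly_X_closed shift(2)]] h(3)[OF poly_X_closed shift(2)]
        poly_X_smult[OF h(1)[OF shift(2)]] by simp
    then have "poly_eval a (\<alpha> (\<lambda>i. const_poly M x i \<oplus>\<^bsub>M\<^esub> shift_up g i))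
       = eval_map R M \<alpha> a x \<oplus>\<^bsub>M\<^esub> a \<odot>\<^bsub>M\<^esub> poly_eval a (\<alpha> g)"
      unfolding eq using shift cx h(1) a
      by (simp add: poly_module_simps(3) poly_eval_add shift_up_closed poly_eval_shift eval_map_apply)
    moreover have "poly_eval a (\<lambda>i. const_poly M x i \<oplus>\<^bsub>M\<^esub> shift_up g i) = x \<oplus>\<^bsub>M\<^esub> a \<odot>\<^bsub>M\<^esub> poly_eval a g"
      using shift cx a by (simp add: poly_eval_add shift_up_closed poly_eval_shift poly_eval_const)
    ultimately show ?case using shift a l by simp
  qed
qed

end

lemma (in cring) ring_module_is_module: "Module.module R (ring_module R)"
proof (rule moduleI)
  show "abelian_group (ring_module R)"
    by (rule abelian_groupI) (auto simp: ring_module_def a_ac intro: bexI[of _ "\<ominus> _"] simp: l_neg)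
qed (auto simp: ring_module_def l_distr r_distr m_assoc is_cring)

lemma finsum_ring_module: "finsum (ring_module R) f A = finsum R f A"
  by (simp add: finsum_def ring_module_def finprod_def)

lemma up_ring_module: "up (ring_module R) = up R"
  by (simp add: up_def ring_module_def)

section \<open>Evaluation and constant extension of isometries\<close>

context form_module
begin

text \<open>Horner induction in the first argument; in the second one only the linearity in
  \<open>lin\<close> is used. \<open>R\<close> is regarded as a module over itself, so that
  evaluation and shift of scalar polynomials are instances of those for modules.\<close>

lemma poly_eval_form:
  assumes a: "a \<in> carrier R" and f: "f \<in> up M" and g: "g \<in> up M"
  shows "module.poly_eval R (ring_module R) a (FX f g) = F (poly_eval a f) (poly_eval a g)"
proof -
  interpret RR: Module.module R "ring_module R" by (rule R.ring_module_is_module)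
  have rr: "x \<oplus>\<^bsub>ring_module R\<^esub> y = x \<oplus> y" "x \<odot>\<^bsub>ring_module R\<^esub> y = x \<otimes> y" "\<zero>\<^bsub>ring_module R\<^esub> = \<zero>"
     "carrier (ring_module R) = carrier R" for x y by (simp_all add: ring_module_def)
  note cg = mem_upD[OF g]
  have lin: "RR.poly_eval a (\<lambda>k. F x (g k)) = F x (poly_eval a g)" if x: "x \<in> carrier M" for x
  proof -
    obtain n where n: "\<And>i. n \<le> i \<Longrightarrow> g i = \<zero>\<^bsub>M\<^esub>" using g by (metis upE2)
    have "(\<lambda>k. F x (g k)) \<in> up (ring_module R)"
      using cg n x by (intro upI2[where n = n]) (auto simp: rr)
    then have "RR.poly_eval a (\<lambda>k. F x (g k)) = (\<Oplus>i\<in>{..<n}. a [^] i \<otimes> F x (g i))"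
      using RR.poly_eval_bound[of "\<lambda>k. F x (g k)" a n] a n x by (simp add: rr finsum_ring_module)
    also have "\<dots> = (\<Oplus>i\<in>{..<n}. F x (a [^] i \<odot>\<^bsub>M\<^esub> g i))"
      using a x cg by simp
    also have "\<dots> = F x (\<Oplus>\<^bsub>M\<^esub>i\<in>{..<n}. a [^] i \<odot>\<^bsub>M\<^esub> g i)"
      using a x cg by (intro F_finsum_r[symmetric]) auto
    finally show ?thesis using poly_eval_bound[OF g a n] by simp
  qed
  show ?thesis using f
  proof (induction rule: up_induct)
    case zero
    have "FX (\<lambda>i. \<zero>\<^bsub>M\<^esub>) g = (\<lambda>k. F \<zero>\<^bsub>M\<^esub> (g k))" using cg by (simp add: poly_form_def)
    moreover have "poly_eval a (\<lambda>i. \<zero>\<^bsub>M\<^esub>) = \<zero>\<^bsub>M\<^esub>" using a by (simp add: poly_eval_def)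
    ultimately show ?case using lin[of "\<zero>\<^bsub>M\<^esub>"] by simp
  next
    case (shift x h)
    note cx = M.const_poly_up[OF shift(1)] and ch = mem_upD[OF shift(2)]
    have hg: "FX h g \<in> up (ring_module R)" using poly_form_closed[OF shift(2) g] by (simp add: up_ring_module)
    have eq: "FX (\<lambda>i. const_poly M x i \<oplus>\<^bsub>M\<^esub> shift_up h i) g
      = (\<lambda>k. F x (g k) \<oplus>\<^bsub>ring_module R\<^esub> RR.shift_up (FX h g) k)"
    proof
      fix k
      have "(\<Oplus>i\<in>{..k}. F (shift_up h i) (g (k - i))) = RR.shift_up (FX h g) k"
      proof (cases k)
        case 0 then show ?thesis using cg by (simp add: shift_up_def RR.shift_up_def rr)
      next
        case (Suc j)
        have "(\<Oplus>i\<in>{..Suc j}. F (shift_up h i) (g (Suc j - i)))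
           = (\<Oplus>i\<in>{..j}. F (shift_up h (Suc i)) (g (Suc j - Suc i))) \<oplus> F (shift_up h 0) (g (Suc j - 0))"
          using cg ch mem_upD[OF shift_up_closed[OF shift(2)]]
          by (intro R.finsum_Suc2) auto
        then show ?thesis using cg ch Suc
          by (simp add: shift_up_def RR.shift_up_def poly_form_def)
      qed
      moreover have "(\<Oplus>i\<in>{..k}. F (const_poly M x i \<oplus>\<^bsub>M\<^esub> shift_up h i) (g (k - i)))
        = (\<Oplus>i\<in>{..k}. F (const_poly M x i) (g (k - i))) \<oplus> (\<Oplus>i\<in>{..k}. F (shift_up h i) (g (k - i)))"
        using cg ch mem_upD[OF shift_up_closed[OF shift(2)]] mem_upD[OF cx]
        by (simp add: R.finsum_addf Pi_def)
      ultimately show "FX (\<lambda>i. const_poly M x i \<oplus>\<^bsub>M\<^esub> shift_up h i) g k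
        = F x (g k) \<oplus>\<^bsub>ring_module R\<^esub> RR.shift_up (FX h g) k"
        using poly_form_const[OF shift(1) g] by (simp add: poly_form_def rr fun_eq_iff)
    qed
    have Fx: "(\<lambda>k. F x (g k)) \<in> up (ring_module R)"
      using poly_form_closed[OF cx g] poly_form_const[OF shift(1) g] by (simp add: up_ring_module)
    have "RR.poly_eval a (FX (\<lambda>i. const_poly M x i \<oplus>\<^bsub>M\<^esub> shift_up h i) g)
      = F x (poly_eval a g) \<oplus> a \<otimes> F (poly_eval a h) (poly_eval a g)"
      unfolding eq using RR.poly_eval_add[OF Fx RR.shift_up_closed[OF hg] a] RR.poly_eval_shift[OF hg a]
        lin[OF shift(1)] shift(3) by (simp add: rr)
    moreover have "poly_eval a (\<lambda>i. const_poly M x i \<oplus>\<^bsub>M\<^esub> shift_up h i) = x \<oplus>\<^bsub>M\<^esub> a \<odot>\<^bsub>M\<^esub> poly_eval a h"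
      using shift cx a by (simp add: poly_eval_add shift_up_closed poly_eval_shift poly_eval_const)
    ultimately show ?case using shift a g by simp
  qed
qed

abbreviation IsoX where "IsoX \<equiv> isometry_group (UP R) PX FX"

lemma isoX_hom: "\<alpha> \<in> carrier IsoX \<Longrightarrow> \<alpha> \<in> module_hom (UP R) PX PX"
  by (simp add: isometry_iff)

lemma eval_map_isometry:
  assumes \<alpha>: "\<alpha> \<in> carrier IsoX" and a: "a \<in> carrier R"
  shows "eval_map R M \<alpha> a \<in> carrier Iso"
proof -
  interpret X: form_module "UP R" PX FX by (rule poly_form_module)
  interpret RR: Module.module R "ring_module R" by (rule R.ring_module_is_module)
  note D = X.isometryD[OF \<alpha>, unfolded poly_module_simps(1)]
  let ?\<beta> = "inv\<^bsub>IsoX\<^esub> \<alpha>"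
  have \<beta>: "?\<beta> \<in> carrier IsoX" using \<alpha> by simp
  note E = X.isometryD[OF \<beta>, unfolded poly_module_simps(1)]
  note inv = X.isometry_inv[OF \<alpha>, unfolded poly_module_simps(1)]
  have z: "(\<lambda>i. \<zero>\<^bsub>M\<^esub>) \<in> up M" by (rule upI2) auto
  note lin = poly_eval_hom(1)[OF isoX_hom[OF \<alpha>] a z] and lin' = poly_eval_hom(1)[OF isoX_hom[OF \<beta>] a z]
  have c: "const_poly M x \<in> up M" if "x \<in> carrier M" for x using M.const_poly_up that by blast
  \<comment> \<open>The inverse of the value at \<open>a\<close> is the value at \<open>a\<close> of
    the inverse: \<open>poly_eval_hom\<close> is applied to the polynomial
    \<open>?\<beta> (const_poly M x)\<close>, which \<open>\<alpha>\<close> sends back to the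
    constant \<open>x\<close>.\<close>
  have "eval_map R M \<alpha> a (eval_map R M ?\<beta> a x) = x" if "x \<in> carrier M" for x
    using poly_eval_hom(2)[OF isoX_hom[OF \<alpha>] a, of "?\<beta> (const_poly M x)"] that c[OF that] E inv a
    by (simp add: eval_map_apply poly_eval_const)
  moreover have "eval_map R M ?\<beta> a (eval_map R M \<alpha> a x) = x" if "x \<in> carrier M" for x
    using poly_eval_hom(2)[OF isoX_hom[OF \<beta>] a, of "\<alpha> (const_poly M x)"] that c[OF that] D inv a
    by (simp add: eval_map_apply poly_eval_const)
  ultimately have "bij_betw (eval_map R M \<alpha> a) (carrier M) (carrier M)"
    using module_homD(1)[OF lin] module_homD(1)[OF lin']
    by (intro bij_betw_byWitness[where f' = "eval_map R M ?\<beta> a"]) auto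
  moreover have "F (eval_map R M \<alpha> a x) (eval_map R M \<alpha> a y) = F x y"
    if "x \<in> carrier M" "y \<in> carrier M" for x y
  proof -
    have "F (eval_map R M \<alpha> a x) (eval_map R M \<alpha> a y)
      = RR.poly_eval a (FX (\<alpha> (const_poly M x)) (\<alpha> (const_poly M y)))"
      using that c D(1) a by (simp add: eval_map_apply poly_eval_form)
    also have "\<dots> = RR.poly_eval a (FX (const_poly M x) (const_poly M y))" using that c D by simp
    also have "\<dots> = F x y" using that c a by (simp add: poly_eval_form poly_eval_const)
    finally show ?thesis .
  qed
  ultimately show "eval_map R M \<alpha> a \<in> carrier Iso" using lin by (simp add: isometry_iff)
qed

lemma eval_map_hom:
  assumes a: "a \<in> carrier R"
  shows "group_hom IsoX Iso (\<lambda>\<alpha>. eval_map R M \<alpha> a)"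
proof (intro group_hom.intro group_hom_axioms.intro isometry_group homI)
  interpret X: form_module "UP R" PX FX by (rule poly_form_module)
  show "group IsoX" by (rule X.isometry_group)
  fix \<alpha> \<beta> assume \<alpha>: "\<alpha> \<in> carrier IsoX" and \<beta>: "\<beta> \<in> carrier IsoX"
  note E = X.isometryD[OF \<beta>, unfolded poly_module_simps(1)]
  show "eval_map R M (\<alpha> \<otimes>\<^bsub>IsoX\<^esub> \<beta>) a = eval_map R M \<alpha> a \<otimes>\<^bsub>Iso\<^esub> eval_map R M \<beta> a"
  proof
    fix x
    show "eval_map R M (\<alpha> \<otimes>\<^bsub>IsoX\<^esub> \<beta>) a x = (eval_map R M \<alpha> a \<otimes>\<^bsub>Iso\<^esub> eval_map R M \<beta> a) x"
    proof (cases "x \<in> carrier M")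
      case True
      then have c: "const_poly M x \<in> up M" by (rule M.const_poly_up)
      then show ?thesis
        using poly_eval_hom(2)[OF isoX_hom[OF \<alpha>] a, of "\<beta> (const_poly M x)"] True E
          isometry_mult_apply[OF eval_map_isometry[OF \<alpha> a] eval_map_isometry[OF \<beta> a] True]
          X.isometry_mult_apply[OF \<alpha> \<beta>, of "const_poly M x"]
        by (simp add: eval_map_apply poly_module_simps(1))
    next
      case False
      have prod: "eval_map R M \<alpha> a \<otimes>\<^bsub>Iso\<^esub> eval_map R M \<beta> a \<in> carrier Iso"
        using eval_map_isometry[OF \<alpha> a] eval_map_isometry[OF \<beta> a] by simp
      have "eval_map R M (\<alpha> \<otimes>\<^bsub>IsoX\<^esub> \<beta>) a x = undefined" using False by (simp add: eval_map_def)
      then show ?thesis using extensional_arb[OF isometryD(5)[OF prod] False] by simp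
    qed
  qed
qed (use eval_map_isometry assms in auto)

text \<open>The extension of scalars \<open>g \<otimes> R[X]\<close>, acting on coefficients. It
  sends constants to constants and evaluates to \<open>g\<close> at every point.\<close>

definition poly_lift where "poly_lift g = (\<lambda>f\<in>up M. \<lambda>i. g (f i))"

lemma poly_lift_apply: "f \<in> up M \<Longrightarrow> poly_lift g f = (\<lambda>i. g (f i))"
  by (simp add: poly_lift_def)

lemma poly_lift_isometry:
  assumes g: "g \<in> carrier Iso"
  shows "poly_lift g \<in> carrier IsoX"
proof -
  have gh: "g \<in> module_hom R M M" using g by (simp add: isometry_iff)
  have ginv: "inv\<^bsub>Iso\<^esub> g \<in> carrier Iso" using g by simp
  have g0: "h \<zero>\<^bsub>M\<^esub> = \<zero>\<^bsub>M\<^esub>" if "h \<in> carrier Iso" for h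
    using that module_hom_zero[OF is_module is_module] by (simp add: isometry_iff)
  have up: "(\<lambda>i. h (f i)) \<in> up M" if h: "h \<in> carrier Iso" and f: "f \<in> up M" for h f
  proof -
    obtain n where n: "\<And>i. n \<le> i \<Longrightarrow> f i = \<zero>\<^bsub>M\<^esub>" using f by (metis upE2)
    then show ?thesis using f isometryD(1)[OF h] g0[OF h] by (intro upI2[where n = n]) auto
  qed
  note D = isometryD[OF g] and inv = isometry_inv[OF g]
  show ?thesis unfolding isometry_iff
  proof (intro conjI ballI)
    show "poly_lift g \<in> module_hom (UP R) PX PX"
    proof (rule module_homI)
      fix f assume "f \<in> carrier PX"
      then have f: "f \<in> up M" by (simp add: poly_module_simps)
      note cf = mem_upD[OF f]
      show "poly_lift g f \<in> carrier PX" using f up[OF g f] by (simp add: poly_module_simps poly_lift_apply)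
      show "poly_lift g (p \<odot>\<^bsub>PX\<^esub> f) = p \<odot>\<^bsub>PX\<^esub> poly_lift g f" if "p \<in> carrier (UP R)" for p
      proof -
        have p: "p \<in> up R" using that by (simp add: UP_simps)
        note cp = mem_upD[OF p]
        have "g (\<Oplus>\<^bsub>M\<^esub>i\<in>{..k}. p i \<odot>\<^bsub>M\<^esub> f (k - i)) = (\<Oplus>\<^bsub>M\<^esub>i\<in>{..k}. p i \<odot>\<^bsub>M\<^esub> g (f (k - i)))" for k
          using module_hom_finsum[OF is_module is_module gh, of "{..k}" "\<lambda>i. p i \<odot>\<^bsub>M\<^esub> f (k - i)"] cf cp D(3)
          by simp
        then show ?thesis using poly_smult_closed[OF p f] f
          by (simp add: poly_lift_apply) (simp add: poly_module_simps)
      qed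
      fix h assume "h \<in> carrier PX"
      then have h: "h \<in> up M" by (simp add: poly_module_simps)
      interpret PX: Module.module "UP R" PX by (rule poly_module)
      have "f \<oplus>\<^bsub>PX\<^esub> h \<in> up M" using PX.M.add.m_closed[of f h] f h by (simp add: poly_module_simps)
      then show "poly_lift g (f \<oplus>\<^bsub>PX\<^esub> h) = poly_lift g f \<oplus>\<^bsub>PX\<^esub> poly_lift g h"
        using f h cf mem_upD[OF h] D(2) by (simp add: poly_lift_apply) (simp add: poly_module_simps)
    qed (simp add: poly_lift_def poly_module_simps)
    show "bij_betw (poly_lift g) (carrier PX) (carrier PX)"
      by (rule bij_betw_byWitness[where f' = "poly_lift (inv\<^bsub>Iso\<^esub> g)"])
        (use up[OF g] up[OF ginv] inv in \<open>auto simp: poly_module_simps poly_lift_apply mem_upD\<close>)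
    show "FX (poly_lift g f) (poly_lift g h) = FX f h" if "f \<in> carrier PX" "h \<in> carrier PX" for f h
      using that D(4) by (auto simp: poly_module_simps poly_lift_apply poly_form_def mem_upD intro!: ext finsum_eqI)
  qed
qed

lemma poly_lift_const:
  assumes g: "g \<in> carrier Iso" and x: "x \<in> carrier M"
  shows "poly_lift g (const_poly M x) = const_poly M (g x)"
proof -
  have "g \<zero>\<^bsub>M\<^esub> = \<zero>\<^bsub>M\<^esub>"
    using g module_hom_zero[OF is_module is_module] by (simp add: isometry_iff)
  then show ?thesis using M.const_poly_up[OF x] by (auto simp: poly_lift_apply const_poly_def)
qed

lemma eval_poly_lift:
  assumes g: "g \<in> carrier Iso" and a: "a \<in> carrier R"
  shows "eval_map R M (poly_lift g) a = g"
proof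
  fix x
  show "eval_map R M (poly_lift g) a x = g x"
    using isometryD(1,5)[OF g] a
    by (cases "x \<in> carrier M")
      (auto simp: eval_map_apply poly_lift_const[OF g] poly_eval_const, auto simp: eval_map_def extensional_def)
qed

end

section \<open>Localization\<close>

locale mult_subset = cring R for R (structure) +
  fixes S
  assumes S_subset: "S \<subseteq> carrier R"
    and S_one [simp]: "\<one> \<in> S"
    and S_mult [simp]: "s \<in> S \<Longrightarrow> t \<in> S \<Longrightarrow> s \<otimes> t \<in> S"
begin

lemma S_carrier [simp]: "s \<in> S \<Longrightarrow> s \<in> carrier R"
  using S_subset by auto

end

locale localized_module = mult_subset R S + Module.module R M
  for R :: "('a, 'm) ring_scheme" (structure) and S and M :: "('a, 'b, 'u) module_scheme" (structure)
begin

abbreviation "fr \<equiv> fraction M S"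
abbreviation "LM \<equiv> loc_module R S M"

lemma mem_fraction:
  "(y, t) \<in> fr x s \<longleftrightarrow> y \<in> carrier M \<and> t \<in> S \<and>
     (\<exists>u\<in>S. u \<odot>\<^bsub>M\<^esub> (t \<odot>\<^bsub>M\<^esub> x) = u \<odot>\<^bsub>M\<^esub> (s \<odot>\<^bsub>M\<^esub> y))"
  by (simp add: fraction_def)

lemma fraction_refl: "x \<in> carrier M \<Longrightarrow> s \<in> S \<Longrightarrow> (x, s) \<in> fr x s"
  by (auto simp: mem_fraction intro: bexI[of _ \<one>])

lemma fraction_scale:
  assumes "x \<in> carrier M" "s \<in> S" "v \<in> S"
  shows "fr (v \<odot>\<^bsub>M\<^esub> x) (v \<otimes> s) = fr x s"
proof -
  have "(\<exists>u\<in>S. u \<odot>\<^bsub>M\<^esub> (t \<odot>\<^bsub>M\<^esub> (v \<odot>\<^bsub>M\<^esub> x)) = u \<odot>\<^bsub>M\<^esub> (v \<otimes> s \<odot>\<^bsub>M\<^esub> y))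
     \<longleftrightarrow> (\<exists>u\<in>S. u \<odot>\<^bsub>M\<^esub> (t \<odot>\<^bsub>M\<^esub> x) = u \<odot>\<^bsub>M\<^esub> (s \<odot>\<^bsub>M\<^esub> y))" (is "?l \<longleftrightarrow> ?r")
    if y: "y \<in> carrier M" "t \<in> S" for y t
  proof
    assume ?l
    then obtain u where u: "u \<in> S" "u \<odot>\<^bsub>M\<^esub> (t \<odot>\<^bsub>M\<^esub> (v \<odot>\<^bsub>M\<^esub> x)) = u \<odot>\<^bsub>M\<^esub> (v \<otimes> s \<odot>\<^bsub>M\<^esub> y)" by blast
    have "(u \<otimes> v) \<odot>\<^bsub>M\<^esub> (t \<odot>\<^bsub>M\<^esub> x) = (u \<otimes> v) \<odot>\<^bsub>M\<^esub> (s \<odot>\<^bsub>M\<^esub> y)"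
      using u assms y by (simp add: smult_assoc1[symmetric] m_ac)
    then show ?r using u assms S_mult by blast
  next
    assume ?r
    then obtain u where u: "u \<in> S" "u \<odot>\<^bsub>M\<^esub> (t \<odot>\<^bsub>M\<^esub> x) = u \<odot>\<^bsub>M\<^esub> (s \<odot>\<^bsub>M\<^esub> y)" by blast
    have "v \<odot>\<^bsub>M\<^esub> (u \<odot>\<^bsub>M\<^esub> (t \<odot>\<^bsub>M\<^esub> x)) = v \<odot>\<^bsub>M\<^esub> (u \<odot>\<^bsub>M\<^esub> (s \<odot>\<^bsub>M\<^esub> y))" using u by simp
    then have "u \<odot>\<^bsub>M\<^esub> (t \<odot>\<^bsub>M\<^esub> (v \<odot>\<^bsub>M\<^esub> x)) = u \<odot>\<^bsub>M\<^esub> (v \<otimes> s \<odot>\<^bsub>M\<^esub> y)"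
      using u(1) assms y by (simp add: smult_assoc1[symmetric] m_ac)
    then show ?l using u by blast
  qed
  then show ?thesis by (auto simp: fraction_def)
qed

lemma fraction_eqI:
  assumes "x \<in> carrier M" "y \<in> carrier M" "s \<in> S" "t \<in> S" "u \<in> S"
    and eq: "u \<odot>\<^bsub>M\<^esub> (t \<odot>\<^bsub>M\<^esub> x) = u \<odot>\<^bsub>M\<^esub> (s \<odot>\<^bsub>M\<^esub> y)"
  shows "fr x s = fr y t"
proof -
  have "fr x s = fr (u \<otimes> t \<odot>\<^bsub>M\<^esub> x) (u \<otimes> t \<otimes> s)" using assms fraction_scale[of x s "u \<otimes> t"] by simp
  also have "\<dots> = fr (u \<otimes> s \<odot>\<^bsub>M\<^esub> y) (u \<otimes> s \<otimes> t)"
  proof -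
    have "u \<otimes> t \<odot>\<^bsub>M\<^esub> x = u \<otimes> s \<odot>\<^bsub>M\<^esub> y" "u \<otimes> t \<otimes> s = u \<otimes> s \<otimes> t"
      using assms by (simp_all add: smult_assoc1, simp add: m_ac)
    then show ?thesis by simp
  qed
  also have "\<dots> = fr y t" using assms fraction_scale[of y t "u \<otimes> s"] by simp
  finally show ?thesis .
qed

lemma fraction_eqI_one:
  assumes "x \<in> carrier M" "y \<in> carrier M" "s \<in> S" "t \<in> S" "t \<odot>\<^bsub>M\<^esub> x = s \<odot>\<^bsub>M\<^esub> y"
  shows "fr x s = fr y t"
  using fraction_eqI[of x y s t \<one>] assms by simp

lemma fraction_eq_iff:
  assumes "x \<in> carrier M" "y \<in> carrier M" "s \<in> S" "t \<in> S"
  shows "fr x s = fr y t \<longleftrightarrow> (\<exists>u\<in>S. u \<odot>\<^bsub>M\<^esub> (t \<odot>\<^bsub>M\<^esub> x) = u \<odot>\<^bsub>M\<^esub> (s \<odot>\<^bsub>M\<^esub> y))"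
  using fraction_eqI[of x y s t] fraction_refl[of y t] mem_fraction[of y t x s] assms by blast

text \<open>Equal fractions acquire the same numerator and denominator after scaling, so that it
  suffices to check invariance under scaling.\<close>

lemma fraction_UN:
  assumes "x \<in> carrier M" "s \<in> S"
    and scale: "\<And>x s v. x \<in> carrier M \<Longrightarrow> s \<in> S \<Longrightarrow> v \<in> S \<Longrightarrow> G (v \<odot>\<^bsub>M\<^esub> x) (v \<otimes> s) = G x s"
  shows "(\<Union>(x, s)\<in>fr x s. G x s) = G x s"
proof -
  have "G y t = G x s" if yt: "(y, t) \<in> fr x s" for y t
  proof -
    obtain u where u: "y \<in> carrier M" "t \<in> S" "u \<in> S" "u \<odot>\<^bsub>M\<^esub> (t \<odot>\<^bsub>M\<^esub> x) = u \<odot>\<^bsub>M\<^esub> (s \<odot>\<^bsub>M\<^esub> y)"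
      using yt by (auto simp: mem_fraction)
    have "G y t = G (u \<otimes> s \<odot>\<^bsub>M\<^esub> y) (u \<otimes> s \<otimes> t)" using scale[of y t "u \<otimes> s"] u assms by simp
    also have "\<dots> = G (u \<otimes> t \<odot>\<^bsub>M\<^esub> x) (u \<otimes> t \<otimes> s)"
    proof -
      have "u \<otimes> t \<odot>\<^bsub>M\<^esub> x = u \<otimes> s \<odot>\<^bsub>M\<^esub> y" "u \<otimes> t \<otimes> s = u \<otimes> s \<otimes> t"
        using assms(1,2) u by (simp_all add: smult_assoc1, simp add: m_ac)
      then show ?thesis by simp
    qed
    also have "\<dots> = G x s" using scale[of x s "u \<otimes> t"] u assms by simp
    finally show ?thesis .
  qed
  then show ?thesis using fraction_refl[OF assms(1,2)] by blast
qed

lemma loc_carrier: "carrier LM = {fr x s |x s. x \<in> carrier M \<and> s \<in> S}"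
  and loc_zero: "\<zero>\<^bsub>LM\<^esub> = fr \<zero>\<^bsub>M\<^esub> \<one>"
  by (simp_all add: loc_module_def)

lemma fraction_closed [simp]: "x \<in> carrier M \<Longrightarrow> s \<in> S \<Longrightarrow> fr x s \<in> carrier LM"
  by (auto simp: loc_carrier)

lemma loc_E:
  assumes "z \<in> carrier LM"
  obtains x s where "x \<in> carrier M" "s \<in> S" "z = fr x s"
  using assms by (auto simp: loc_carrier)

text \<open>The two unions are collapsed one at a time. The inner one has to be treated for every
  representative of the first fraction, before the outer one can be.\<close>

lemma loc_add:
  assumes "x \<in> carrier M" "s \<in> S" "y \<in> carrier M" "t \<in> S"
  shows "fr x s \<oplus>\<^bsub>LM\<^esub> fr y t = fr (t \<odot>\<^bsub>M\<^esub> x \<oplus>\<^bsub>M\<^esub> s \<odot>\<^bsub>M\<^esub> y) (s \<otimes> t)"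
proof -
  have inner: "(\<Union>(y, t)\<in>fr y t. fr (t \<odot>\<^bsub>M\<^esub> x \<oplus>\<^bsub>M\<^esub> s \<odot>\<^bsub>M\<^esub> y) (s \<otimes> t))
    = fr (t \<odot>\<^bsub>M\<^esub> x \<oplus>\<^bsub>M\<^esub> s \<odot>\<^bsub>M\<^esub> y) (s \<otimes> t)" if x: "x \<in> carrier M" "s \<in> S" for x s
  proof (rule fraction_UN[OF assms(3,4)])
    fix y t v assume y: "y \<in> carrier M" "t \<in> S" "v \<in> S"
    have "fr (v \<odot>\<^bsub>M\<^esub> (t \<odot>\<^bsub>M\<^esub> x \<oplus>\<^bsub>M\<^esub> s \<odot>\<^bsub>M\<^esub> y)) (v \<otimes> (s \<otimes> t)) = fr (t \<odot>\<^bsub>M\<^esub> x \<oplus>\<^bsub>M\<^esub> s \<odot>\<^bsub>M\<^esub> y) (s \<otimes> t)"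
      using x y by (intro fraction_scale) auto
    then show "fr (v \<otimes> t \<odot>\<^bsub>M\<^esub> x \<oplus>\<^bsub>M\<^esub> s \<odot>\<^bsub>M\<^esub> (v \<odot>\<^bsub>M\<^esub> y)) (s \<otimes> (v \<otimes> t)) = fr (t \<odot>\<^bsub>M\<^esub> x \<oplus>\<^bsub>M\<^esub> s \<odot>\<^bsub>M\<^esub> y) (s \<otimes> t)"
      using x y by (simp add: smult_r_distr smult_assoc1[symmetric] m_ac)
  qed
  have outer: "(\<Union>(x, s)\<in>fr x s. fr (t \<odot>\<^bsub>M\<^esub> x \<oplus>\<^bsub>M\<^esub> s \<odot>\<^bsub>M\<^esub> y) (s \<otimes> t))
    = fr (t \<odot>\<^bsub>M\<^esub> x \<oplus>\<^bsub>M\<^esub> s \<odot>\<^bsub>M\<^esub> y) (s \<otimes> t)"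
  proof (rule fraction_UN[OF assms(1,2)])
    fix x s v assume x: "x \<in> carrier M" "s \<in> S" "v \<in> S"
    have "fr (v \<odot>\<^bsub>M\<^esub> (t \<odot>\<^bsub>M\<^esub> x \<oplus>\<^bsub>M\<^esub> s \<odot>\<^bsub>M\<^esub> y)) (v \<otimes> (s \<otimes> t)) = fr (t \<odot>\<^bsub>M\<^esub> x \<oplus>\<^bsub>M\<^esub> s \<odot>\<^bsub>M\<^esub> y) (s \<otimes> t)"
      using x assms by (intro fraction_scale) auto
    then show "fr (t \<odot>\<^bsub>M\<^esub> (v \<odot>\<^bsub>M\<^esub> x) \<oplus>\<^bsub>M\<^esub> v \<otimes> s \<odot>\<^bsub>M\<^esub> y) (v \<otimes> s \<otimes> t) = fr (t \<odot>\<^bsub>M\<^esub> x \<oplus>\<^bsub>M\<^esub> s \<odot>\<^bsub>M\<^esub> y) (s \<otimes> t)"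
      using x assms by (simp add: smult_r_distr smult_assoc1[symmetric] m_ac)
  qed
  have "fr x s \<oplus>\<^bsub>LM\<^esub> fr y t
    = (\<Union>(x, s)\<in>fr x s. \<Union>(y, t)\<in>fr y t. fr (t \<odot>\<^bsub>M\<^esub> x \<oplus>\<^bsub>M\<^esub> s \<odot>\<^bsub>M\<^esub> y) (s \<otimes> t))"
    by (simp add: loc_module_def)
  also have "\<dots> = (\<Union>(x, s)\<in>fr x s. fr (t \<odot>\<^bsub>M\<^esub> x \<oplus>\<^bsub>M\<^esub> s \<odot>\<^bsub>M\<^esub> y) (s \<otimes> t))"
  proof (rule SUP_cong[OF refl])
    fix p assume "p \<in> fr x s"
    then obtain x' s' where p: "p = (x', s')" and x': "x' \<in> carrier M" "s' \<in> S"
      by (cases p) (auto simp: mem_fraction)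
    show "(case p of (x, s) \<Rightarrow> \<Union>(y, t)\<in>fr y t. fr (t \<odot>\<^bsub>M\<^esub> x \<oplus>\<^bsub>M\<^esub> s \<odot>\<^bsub>M\<^esub> y) (s \<otimes> t))
      = (case p of (x, s) \<Rightarrow> fr (t \<odot>\<^bsub>M\<^esub> x \<oplus>\<^bsub>M\<^esub> s \<odot>\<^bsub>M\<^esub> y) (s \<otimes> t))"
      unfolding p prod.case by (rule inner[OF x'])
  qed
  also have "\<dots> = fr (t \<odot>\<^bsub>M\<^esub> x \<oplus>\<^bsub>M\<^esub> s \<odot>\<^bsub>M\<^esub> y) (s \<otimes> t)" by (rule outer)
  finally show ?thesis .
qed

lemma loc_add_same:
  assumes "x \<in> carrier M" "y \<in> carrier M" "s \<in> S"
  shows "fr x s \<oplus>\<^bsub>LM\<^esub> fr y s = fr (x \<oplus>\<^bsub>M\<^esub> y) s"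
  using assms fraction_scale[of "x \<oplus>\<^bsub>M\<^esub> y" s s] by (simp add: loc_add smult_r_distr)

lemma loc_abelian_group: "abelian_group LM"
proof (rule abelian_groupI)
  fix z w v assume z: "z \<in> carrier LM" and w: "w \<in> carrier LM"
  then obtain x s y t where x: "x \<in> carrier M" "s \<in> S" "z = fr x s"
    and y: "y \<in> carrier M" "t \<in> S" "w = fr y t" by (metis loc_E)
  show "z \<oplus>\<^bsub>LM\<^esub> w \<in> carrier LM" using x y by (simp add: loc_add)
  show "z \<oplus>\<^bsub>LM\<^esub> w = w \<oplus>\<^bsub>LM\<^esub> z" using x y by (simp add: loc_add M.a_comm m_comm)
  assume "v \<in> carrier LM"
  then obtain k u where k: "k \<in> carrier M" "u \<in> S" "v = fr k u" by (metis loc_E)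
  show "z \<oplus>\<^bsub>LM\<^esub> w \<oplus>\<^bsub>LM\<^esub> v = z \<oplus>\<^bsub>LM\<^esub> (w \<oplus>\<^bsub>LM\<^esub> v)"
    using x y k by (simp add: loc_add smult_r_distr smult_assoc1[symmetric] M.a_ac m_ac)
next
  fix z assume "z \<in> carrier LM"
  then obtain x s where x: "x \<in> carrier M" "s \<in> S" "z = fr x s" by (metis loc_E)
  show "\<zero>\<^bsub>LM\<^esub> \<oplus>\<^bsub>LM\<^esub> z = z" using x by (simp add: loc_zero loc_add)
  have "fr (\<ominus>\<^bsub>M\<^esub> x) s \<oplus>\<^bsub>LM\<^esub> z = fr \<zero>\<^bsub>M\<^esub> s" using x by (simp add: loc_add_same M.l_neg)
  also have "\<dots> = \<zero>\<^bsub>LM\<^esub>" unfolding loc_zero using x by (intro fraction_eqI_one) auto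
  finally show "\<exists>y\<in>carrier LM. y \<oplus>\<^bsub>LM\<^esub> z = \<zero>\<^bsub>LM\<^esub>" using x by (intro bexI[of _ "fr (\<ominus>\<^bsub>M\<^esub> x) s"]) auto
qed (simp add: loc_zero)

lemma loc_finsum:
  assumes "finite A" "f \<in> A \<rightarrow> carrier M" "s \<in> S"
  shows "(\<Oplus>\<^bsub>LM\<^esub>i\<in>A. fr (f i) s) = fr (\<Oplus>\<^bsub>M\<^esub>i\<in>A. f i) s"
proof -
  interpret L: abelian_group LM by (rule loc_abelian_group)
  show ?thesis using assms
  proof (induction A rule: finite_induct)
    case empty
    show ?case unfolding L.finsum_empty M.finsum_empty loc_zero
      using empty by (intro fraction_eqI_one) auto
  qed (auto simp: Pi_def loc_add_same)
qed

end

context mult_subset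
begin

abbreviation "fq \<equiv> fraction (ring_module R) S"
abbreviation "LR \<equiv> loc_ring R S"

lemma ring_module_sel:
  "carrier (ring_module R) = carrier R" "x \<oplus>\<^bsub>ring_module R\<^esub> y = x \<oplus> y"
  "x \<odot>\<^bsub>ring_module R\<^esub> y = x \<otimes> y" "\<zero>\<^bsub>ring_module R\<^esub> = \<zero>"
  by (simp_all add: ring_module_def)

lemma localized_ring_module: "localized_module R S (ring_module R)"
  by (intro localized_module.intro ring_module_is_module mult_subset_axioms)

text \<open>The localized ring has the carrier, addition and scalar action of the localization of
  \<open>R\<close> as a module over itself, so that facts on fractions are inherited from the module
  case.\<close>

sublocale Q: localized_module R S "ring_module R"
  by (rule localized_ring_module)

lemma loc_ring_sel:
  "carrier LR = carrier Q.LM" "\<zero>\<^bsub>LR\<^esub> = \<zero>\<^bsub>Q.LM\<^esub>" "a \<oplus>\<^bsub>LR\<^esub> b = a \<oplus>\<^bsub>Q.LM\<^esub> b"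
  "a \<otimes>\<^bsub>LR\<^esub> b = a \<odot>\<^bsub>Q.LM\<^esub> b" "\<one>\<^bsub>LR\<^esub> = fq \<one> \<one>"
  by (simp_all add: loc_ring_def Let_def)

end

context localized_module
begin

lemma loc_smult:
  assumes "a \<in> carrier R" "s \<in> S" "x \<in> carrier M" "t \<in> S"
  shows "fq a s \<odot>\<^bsub>LM\<^esub> fr x t = fr (a \<odot>\<^bsub>M\<^esub> x) (s \<otimes> t)"
proof -
  have inner: "(\<Union>(x, t)\<in>fr x t. fr (a \<odot>\<^bsub>M\<^esub> x) (s \<otimes> t)) = fr (a \<odot>\<^bsub>M\<^esub> x) (s \<otimes> t)"
    if a: "a \<in> carrier R" "s \<in> S" for a s
  proof (rule fraction_UN[OF assms(3,4)])
    fix x t v assume x: "x \<in> carrier M" "t \<in> S" "v \<in> S"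
    have "fr (v \<odot>\<^bsub>M\<^esub> (a \<odot>\<^bsub>M\<^esub> x)) (v \<otimes> (s \<otimes> t)) = fr (a \<odot>\<^bsub>M\<^esub> x) (s \<otimes> t)"
      using x a by (intro fraction_scale) auto
    then show "fr (a \<odot>\<^bsub>M\<^esub> (v \<odot>\<^bsub>M\<^esub> x)) (s \<otimes> (v \<otimes> t)) = fr (a \<odot>\<^bsub>M\<^esub> x) (s \<otimes> t)"
      using x a by (simp add: smult_assoc1[symmetric] m_ac)
  qed
  have outer: "(\<Union>(a, s)\<in>fq a s. fr (a \<odot>\<^bsub>M\<^esub> x) (s \<otimes> t)) = fr (a \<odot>\<^bsub>M\<^esub> x) (s \<otimes> t)"
  proof (rule Q.fraction_UN)
    fix a s v assume a: "a \<in> carrier (ring_module R)" "s \<in> S" "v \<in> S"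
    have "fr (v \<odot>\<^bsub>M\<^esub> (a \<odot>\<^bsub>M\<^esub> x)) (v \<otimes> (s \<otimes> t)) = fr (a \<odot>\<^bsub>M\<^esub> x) (s \<otimes> t)"
      using a assms by (intro fraction_scale) (auto simp: ring_module_sel)
    then show "fr ((v \<odot>\<^bsub>ring_module R\<^esub> a) \<odot>\<^bsub>M\<^esub> x) (v \<otimes> s \<otimes> t) = fr (a \<odot>\<^bsub>M\<^esub> x) (s \<otimes> t)"
      using a assms by (simp add: ring_module_sel smult_assoc1[symmetric] m_ac)
  qed (use assms in \<open>auto simp: ring_module_sel\<close>)
  have "fq a s \<odot>\<^bsub>LM\<^esub> fr x t = (\<Union>(a, s)\<in>fq a s. \<Union>(x, t)\<in>fr x t. fr (a \<odot>\<^bsub>M\<^esub> x) (s \<otimes> t))"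
    by (simp add: loc_module_def)
  also have "\<dots> = (\<Union>(a, s)\<in>fq a s. fr (a \<odot>\<^bsub>M\<^esub> x) (s \<otimes> t))"
  proof (rule SUP_cong[OF refl])
    fix p assume "p \<in> fq a s"
    then obtain a' s' where p: "p = (a', s')" and a': "a' \<in> carrier R" "s' \<in> S"
      by (cases p) (auto simp: Q.mem_fraction ring_module_sel)
    show "(case p of (a, s) \<Rightarrow> \<Union>(x, t)\<in>fr x t. fr (a \<odot>\<^bsub>M\<^esub> x) (s \<otimes> t))
      = (case p of (a, s) \<Rightarrow> fr (a \<odot>\<^bsub>M\<^esub> x) (s \<otimes> t))"
      unfolding p prod.case by (rule inner[OF a'])
  qed
  also have "\<dots> = fr (a \<odot>\<^bsub>M\<^esub> x) (s \<otimes> t)" by (rule outer)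
  finally show ?thesis .
qed

end

context mult_subset
begin

lemma LR_E:
  assumes "z \<in> carrier LR"
  obtains a s where "a \<in> carrier R" "s \<in> S" "z = fq a s"
  using assms by (metis Q.loc_E loc_ring_sel(1) ring_module_sel(1))

lemma fq_closed [simp]: "a \<in> carrier R \<Longrightarrow> s \<in> S \<Longrightarrow> fq a s \<in> carrier LR"
  by (simp add: loc_ring_sel ring_module_sel)

lemma fq_mult:
  assumes "a \<in> carrier R" "s \<in> S" "b \<in> carrier R" "t \<in> S"
  shows "fq a s \<otimes>\<^bsub>LR\<^esub> fq b t = fq (a \<otimes> b) (s \<otimes> t)"
  using Q.loc_smult[of a s b t] assms by (simp add: loc_ring_sel ring_module_sel)

lemma fq_add:
  assumes "a \<in> carrier R" "s \<in> S" "b \<in> carrier R" "t \<in> S"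
  shows "fq a s \<oplus>\<^bsub>LR\<^esub> fq b t = fq (t \<otimes> a \<oplus> s \<otimes> b) (s \<otimes> t)"
  using Q.loc_add[of a s b t] assms by (simp add: loc_ring_sel ring_module_sel)

lemma fq_zero: "s \<in> S \<Longrightarrow> fq \<zero> s = \<zero>\<^bsub>LR\<^esub>"
  unfolding loc_ring_sel Q.loc_zero by (intro Q.fraction_eqI_one) (auto simp: ring_module_sel)

lemma LR_cring: "cring LR"
proof (rule cringI)
  interpret L: abelian_group Q.LM by (rule Q.loc_abelian_group)
  show "abelian_group LR"
  proof (rule abelian_groupI)
    show "\<exists>y\<in>carrier LR. y \<oplus>\<^bsub>LR\<^esub> x = \<zero>\<^bsub>LR\<^esub>" if "x \<in> carrier LR" for x
      using that by (intro bexI[of _ "\<ominus>\<^bsub>Q.LM\<^esub> x"]) (auto simp: loc_ring_sel L.l_neg)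
  qed (simp_all add: loc_ring_sel L.a_ac)
  show "comm_monoid LR"
  proof (rule comm_monoidI)
    fix z w v assume "z \<in> carrier LR" "w \<in> carrier LR"
    then obtain x s y t where x: "x \<in> carrier R" "s \<in> S" "z = fq x s"
      and y: "y \<in> carrier R" "t \<in> S" "w = fq y t" by (metis LR_E)
    show "z \<otimes>\<^bsub>LR\<^esub> w \<in> carrier LR" using x y by (simp add: fq_mult)
    show "z \<otimes>\<^bsub>LR\<^esub> w = w \<otimes>\<^bsub>LR\<^esub> z" using x y by (simp add: fq_mult m_comm)
    show "\<one>\<^bsub>LR\<^esub> \<otimes>\<^bsub>LR\<^esub> z = z" using x by (simp add: loc_ring_sel(5) fq_mult)
    assume "v \<in> carrier LR"
    then obtain k u where k: "k \<in> carrier R" "u \<in> S" "v = fq k u" by (metis LR_E)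
    show "z \<otimes>\<^bsub>LR\<^esub> w \<otimes>\<^bsub>LR\<^esub> v = z \<otimes>\<^bsub>LR\<^esub> (w \<otimes>\<^bsub>LR\<^esub> v)"
      using x y k by (simp add: fq_mult m_assoc)
  qed (simp add: loc_ring_sel(5))
  fix z w v assume "z \<in> carrier LR" "w \<in> carrier LR" "v \<in> carrier LR"
  then obtain x s y t k u where x: "x \<in> carrier R" "s \<in> S" "z = fq x s"
    and y: "y \<in> carrier R" "t \<in> S" "w = fq y t"
    and k: "k \<in> carrier R" "u \<in> S" "v = fq k u" by (metis LR_E)
  \<comment> \<open>The right side of the distributive law has the denominator
    \<open>(s \<otimes> u) \<otimes> (t \<otimes> u)\<close>, with one factor \<open>u\<close> more
    than the left side.\<close>
  have "fq (u \<otimes> (t \<otimes> x \<otimes> k \<oplus> s \<otimes> y \<otimes> k)) (u \<otimes> (s \<otimes> t \<otimes> u)) = fq (t \<otimes> x \<otimes> k \<oplus> s \<otimes> y \<otimes> k) (s \<otimes> t \<otimes> u)"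
    using Q.fraction_scale[of "t \<otimes> x \<otimes> k \<oplus> s \<otimes> y \<otimes> k" "s \<otimes> t \<otimes> u" u] x y k
    by (simp add: ring_module_sel)
  then show "(z \<oplus>\<^bsub>LR\<^esub> w) \<otimes>\<^bsub>LR\<^esub> v = z \<otimes>\<^bsub>LR\<^esub> v \<oplus>\<^bsub>LR\<^esub> w \<otimes>\<^bsub>LR\<^esub> v"
    using x y k by (simp add: fq_add fq_mult l_distr r_distr m_ac)
qed

end

context localized_module
begin

lemma loc_module: "Module.module LR LM"
proof (rule moduleI[OF LR_cring loc_abelian_group])
  fix a b z w assume "a \<in> carrier LR" "z \<in> carrier LM"
  then obtain p s x t where p: "p \<in> carrier R" "s \<in> S" "a = fq p s"
    and x: "x \<in> carrier M" "t \<in> S" "z = fr x t" by (metis LR_E loc_E)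
  show "a \<odot>\<^bsub>LM\<^esub> z \<in> carrier LM" using p x by (simp add: loc_smult)
  {
    assume "b \<in> carrier LR"
    then obtain q u where q: "q \<in> carrier R" "u \<in> S" "b = fq q u" by (metis LR_E)
    show "(a \<otimes>\<^bsub>LR\<^esub> b) \<odot>\<^bsub>LM\<^esub> z = a \<odot>\<^bsub>LM\<^esub> (b \<odot>\<^bsub>LM\<^esub> z)"
      using p x q by (simp add: loc_smult fq_mult smult_assoc1 m_assoc)
    have "fr (t \<odot>\<^bsub>M\<^esub> ((u \<otimes> p \<oplus> s \<otimes> q) \<odot>\<^bsub>M\<^esub> x)) (t \<otimes> (s \<otimes> u \<otimes> t)) = fr ((u \<otimes> p \<oplus> s \<otimes> q) \<odot>\<^bsub>M\<^esub> x) (s \<otimes> u \<otimes> t)"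
      using p x q by (intro fraction_scale) auto
    then show "(a \<oplus>\<^bsub>LR\<^esub> b) \<odot>\<^bsub>LM\<^esub> z = a \<odot>\<^bsub>LM\<^esub> z \<oplus>\<^bsub>LM\<^esub> b \<odot>\<^bsub>LM\<^esub> z"
      using p x q by (simp add: loc_smult fq_add loc_add smult_l_distr smult_r_distr smult_assoc1[symmetric] m_ac)
  next
    assume "w \<in> carrier LM"
    then obtain y u where y: "y \<in> carrier M" "u \<in> S" "w = fr y u" by (metis loc_E)
    have "fr (s \<odot>\<^bsub>M\<^esub> (p \<odot>\<^bsub>M\<^esub> (u \<odot>\<^bsub>M\<^esub> x \<oplus>\<^bsub>M\<^esub> t \<odot>\<^bsub>M\<^esub> y))) (s \<otimes> (s \<otimes> (t \<otimes> u))) = fr (p \<odot>\<^bsub>M\<^esub> (u \<odot>\<^bsub>M\<^esub> x \<oplus>\<^bsub>M\<^esub> t \<odot>\<^bsub>M\<^esub> y)) (s \<otimes> (t \<otimes> u))"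
      using p x y by (intro fraction_scale) auto
    then show "a \<odot>\<^bsub>LM\<^esub> (z \<oplus>\<^bsub>LM\<^esub> w) = a \<odot>\<^bsub>LM\<^esub> z \<oplus>\<^bsub>LM\<^esub> a \<odot>\<^bsub>LM\<^esub> w"
      using p x y by (simp add: loc_smult loc_add smult_r_distr smult_assoc1[symmetric] m_ac)
  }
next
  fix z assume "z \<in> carrier LM"
  then obtain x t where x: "x \<in> carrier M" "t \<in> S" "z = fr x t" by (metis loc_E)
  show "\<one>\<^bsub>LR\<^esub> \<odot>\<^bsub>LM\<^esub> z = z" using x by (simp add: loc_ring_sel(5) loc_smult)
qed

end

section \<open>Dual systems and bases\<close>

context form_module
begin

text \<open>For a finitely generated projective module with a perfect form, such a system is a
  pair of dual generating families; unlike perfectness it is visibly preserved by localization.\<close>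

definition dual_system where
  "dual_system k p q \<longleftrightarrow> p \<in> {..<k::nat} \<rightarrow> carrier M \<and> q \<in> {..<k} \<rightarrow> carrier M \<and>
     (\<forall>x\<in>carrier M. (\<Oplus>\<^bsub>M\<^esub>i\<in>{..<k}. F (p i) x \<odot>\<^bsub>M\<^esub> q i) = x)"

text \<open>The coordinate of \<open>x\<close> at \<open>j\<close> is
  \<open>\<Sum>\<^sub>i F (p i) x\<close> times the coordinate of \<open>q i\<close> at
  \<open>j\<close>, so it is the pairing of \<open>x\<close> with an explicit combination
  \<open>D j\<close> of the vectors \<open>p i\<close>.\<close>

lemma module_basis_dual:
  assumes mb: "module_basis R M N b" and ds: "dual_system k p q"
  shows "\<exists>D. dual_basis N b D"
proof -
  have b: "i < N \<Longrightarrow> b i \<in> carrier M" for i using mb by (auto simp: module_basis_def)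
  have p: "i < k \<Longrightarrow> p i \<in> carrier M" and q: "i < k \<Longrightarrow> q i \<in> carrier M" for i
    using ds by (auto simp: dual_system_def)
  have ex1: "\<exists>!a. a \<in> {..<N} \<rightarrow>\<^sub>E carrier R \<and> x = (\<Oplus>\<^bsub>M\<^esub>i\<in>{..<N}. a i \<odot>\<^bsub>M\<^esub> b i)" if "x \<in> carrier M" for x
    using mb that unfolding module_basis_def by blast
  define co where "co x = (THE a. a \<in> {..<N} \<rightarrow>\<^sub>E carrier R \<and> x = (\<Oplus>\<^bsub>M\<^esub>i\<in>{..<N}. a i \<odot>\<^bsub>M\<^esub> b i))" for x
  have co: "co x \<in> {..<N} \<rightarrow>\<^sub>E carrier R" "(\<Oplus>\<^bsub>M\<^esub>i\<in>{..<N}. co x i \<odot>\<^bsub>M\<^esub> b i) = x" if "x \<in> carrier M" for x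
    using theI'[OF ex1[OF that]] unfolding co_def by auto
  have cc: "co x j \<in> carrier R" if "x \<in> carrier M" "j < N" for x j
    using co(1)[OF that(1)] that(2) by auto
  have uniq: "co x i = a i" if "x \<in> carrier M" "\<And>i. i < N \<Longrightarrow> a i \<in> carrier R"
    "x = (\<Oplus>\<^bsub>M\<^esub>i\<in>{..<N}. a i \<odot>\<^bsub>M\<^esub> b i)" "i < N" for x a i
  proof -
    have "x = (\<Oplus>\<^bsub>M\<^esub>i\<in>{..<N}. (\<lambda>i\<in>{..<N}. a i) i \<odot>\<^bsub>M\<^esub> b i)"
      unfolding that(3) by (intro finsum_eqI) auto
    then have "co x = (\<lambda>i\<in>{..<N}. a i)"
      unfolding co_def using that(2) by (intro the1_equality[OF ex1[OF that(1)]] conjI) auto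
    then show ?thesis using that(4) by simp
  qed
  define D where "D j = (\<Oplus>\<^bsub>M\<^esub>i\<in>{..<k}. co (q i) j \<odot>\<^bsub>M\<^esub> p i)" for j
  have D: "D j \<in> carrier M" if "j < N" for j
    unfolding D_def using p q cc that by (intro M.finsum_closed) auto
  have FD: "F (D j) x = co x j" if x: "x \<in> carrier M" and j: "j < N" for x j
  proof -
    have "F (D j) x = (\<Oplus>i\<in>{..<k}. F (co (q i) j \<odot>\<^bsub>M\<^esub> p i) x)"
      unfolding D_def using p q cc x j by (intro F_finsum_l) auto
    also have "\<dots> = (\<Oplus>i\<in>{..<k}. F (p i) x \<otimes> co (q i) j)"
      using p q cc x j by (intro finsum_eqI) (auto simp: R.m_comm)
    also have "\<dots> = co x j"
    \<comment> \<open>Coordinates are unique, so it suffices that these scalars also expand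
      \<open>x\<close>: first \<open>x\<close> is written in the \<open>q i\<close>, then each
      \<open>q i\<close> in the basis, and the sums are exchanged.\<close>
    proof (rule uniq[OF x _ _ j, symmetric])
      show "(\<Oplus>i\<in>{..<k}. F (p i) x \<otimes> co (q i) j) \<in> carrier R" if "j < N" for j
        using p q cc x that by (intro R.finsum_closed) auto
      have "(\<Oplus>\<^bsub>M\<^esub>j\<in>{..<N}. (\<Oplus>i\<in>{..<k}. F (p i) x \<otimes> co (q i) j) \<odot>\<^bsub>M\<^esub> b j)
        = (\<Oplus>\<^bsub>M\<^esub>j\<in>{..<N}. \<Oplus>\<^bsub>M\<^esub>i\<in>{..<k}. F (p i) x \<otimes> co (q i) j \<odot>\<^bsub>M\<^esub> b j)"
        using p q cc x b by (intro finsum_eqI) (auto intro!: finsum_smult_rdistr)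
      also have "\<dots> = (\<Oplus>\<^bsub>M\<^esub>i\<in>{..<k}. \<Oplus>\<^bsub>M\<^esub>j\<in>{..<N}. F (p i) x \<otimes> co (q i) j \<odot>\<^bsub>M\<^esub> b j)"
        using p q cc x b by (intro M.finsum_swap) auto
      also have "\<dots> = (\<Oplus>\<^bsub>M\<^esub>i\<in>{..<k}. F (p i) x \<odot>\<^bsub>M\<^esub> q i)"
      proof (rule finsum_eqI)
        fix i assume i: "i \<in> {..<k}"
        have "(\<Oplus>\<^bsub>M\<^esub>j\<in>{..<N}. F (p i) x \<otimes> co (q i) j \<odot>\<^bsub>M\<^esub> b j) = (\<Oplus>\<^bsub>M\<^esub>j\<in>{..<N}. F (p i) x \<odot>\<^bsub>M\<^esub> (co (q i) j \<odot>\<^bsub>M\<^esub> b j))"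
          using p q cc x b i by (intro finsum_eqI) (auto simp: smult_assoc1)
        also have "\<dots> = F (p i) x \<odot>\<^bsub>M\<^esub> (\<Oplus>\<^bsub>M\<^esub>j\<in>{..<N}. co (q i) j \<odot>\<^bsub>M\<^esub> b j)"
          using p q cc x b i by (intro finsum_smult_ldistr[symmetric]) auto
        finally show "(\<Oplus>\<^bsub>M\<^esub>j\<in>{..<N}. F (p i) x \<otimes> co (q i) j \<odot>\<^bsub>M\<^esub> b j) = F (p i) x \<odot>\<^bsub>M\<^esub> q i"
          using co(2) q i by simp
      qed simp
      also have "\<dots> = x" using ds x by (simp add: dual_system_def)
      finally show "x = (\<Oplus>\<^bsub>M\<^esub>j\<in>{..<N}. (\<Oplus>i\<in>{..<k}. F (p i) x \<otimes> co (q i) j) \<odot>\<^bsub>M\<^esub> b j)" by simp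
    qed
    finally show ?thesis .
  qed
  have exp: "(\<Oplus>\<^bsub>M\<^esub>i\<in>{..<N}. F (D i) x \<odot>\<^bsub>M\<^esub> b i) = x" if "x \<in> carrier M" for x
    using co(2)[OF that] FD[OF that] by (simp cong: finsum_eq_cong)
  have du: "F (D i) (b j) = (if i = j then \<one> else \<zero>)" if "i < N" "j < N" for i j
  proof -
    have "(\<Oplus>\<^bsub>M\<^esub>i\<in>{..<N}. (if i = j then \<one> else \<zero>) \<odot>\<^bsub>M\<^esub> b i) = (\<Oplus>\<^bsub>M\<^esub>i\<in>{..<N}. if i = j then b i else \<zero>\<^bsub>M\<^esub>)"
      using b by (intro finsum_eqI) auto
    also have "\<dots> = b j" using that b by (intro M.finsum_delta) auto
    finally have "co (b j) i = (if i = j then \<one> else \<zero>)"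
      using that b by (intro uniq) auto
    then show ?thesis using FD that b by simp
  qed
  have "dual_basis N b D"
    unfolding dual_basis_def by (intro conjI ballI allI impI Pi_I) (simp_all add: b D exp du)
  then show ?thesis by blast
qed

lemma dual_basis_module_basis:
  assumes db: "dual_basis N b D"
  shows "module_basis R M N b"
proof -
  note d = dual_basisD[OF db]
  have "\<exists>!a. a \<in> {..<N} \<rightarrow>\<^sub>E carrier R \<and> x = (\<Oplus>\<^bsub>M\<^esub>i\<in>{..<N}. a i \<odot>\<^bsub>M\<^esub> b i)" if x: "x \<in> carrier M" for x
  proof (rule ex1I[of _ "\<lambda>i\<in>{..<N}. F (D i) x"])
    have "(\<Oplus>\<^bsub>M\<^esub>i\<in>{..<N}. (\<lambda>i\<in>{..<N}. F (D i) x) i \<odot>\<^bsub>M\<^esub> b i) = (\<Oplus>\<^bsub>M\<^esub>i\<in>{..<N}. F (D i) x \<odot>\<^bsub>M\<^esub> b i)"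
      by (intro finsum_eqI) auto
    then show "(\<lambda>i\<in>{..<N}. F (D i) x) \<in> {..<N} \<rightarrow>\<^sub>E carrier R \<and>
       x = (\<Oplus>\<^bsub>M\<^esub>i\<in>{..<N}. (\<lambda>i\<in>{..<N}. F (D i) x) i \<odot>\<^bsub>M\<^esub> b i)"
      using d x by auto
  next
    fix a assume a: "a \<in> {..<N} \<rightarrow>\<^sub>E carrier R \<and> x = (\<Oplus>\<^bsub>M\<^esub>i\<in>{..<N}. a i \<odot>\<^bsub>M\<^esub> b i)"
    have "F (D j) x = a j" if j: "j < N" for j
    proof -
      have "F (D j) x = F (D j) (\<Oplus>\<^bsub>M\<^esub>i\<in>{..<N}. a i \<odot>\<^bsub>M\<^esub> b i)" using a by simp
      also have "\<dots> = (\<Oplus>i\<in>{..<N}. F (D j) (a i \<odot>\<^bsub>M\<^esub> b i))"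
        using a d j by (intro F_finsum_r) auto
      also have "\<dots> = (\<Oplus>i\<in>{..<N}. if i = j then a i else \<zero>)"
        using a d j by (intro finsum_eqI) (auto simp: PiE_def Pi_def)
      also have "\<dots> = a j" using a j by (intro R.finsum_delta) auto
      finally show ?thesis .
    qed
    then show "a = (\<lambda>i\<in>{..<N}. F (D i) x)"
      using a by (auto simp: PiE_def extensional_def)
  qed
  then show ?thesis using d by (auto simp: module_basis_def)
qed

end

section \<open>The localized form and localized isometries\<close>

locale localized_form = localized_module R S M + form_module R M F
  for R :: "('a, 'm) ring_scheme" (structure) and S
    and M :: "('a, 'b, 'u) module_scheme" (structure) and F
begin

abbreviation "LF \<equiv> loc_form R S F"

lemma loc_form_apply:
  assumes "x \<in> carrier M" "s \<in> S" "y \<in> carrier M" "t \<in> S"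
  shows "LF (fr x s) (fr y t) = fq (F x y) (s \<otimes> t)"
proof -
  have scale: "fq (v \<otimes> a) (v \<otimes> s) = fq a s" if "v \<in> S" "a \<in> carrier R" "s \<in> S" for v a s
    using Q.fraction_scale[of a s v] that by (simp add: ring_module_sel)
  have inner: "(\<Union>(y, t)\<in>fr y t. fq (F x y) (s \<otimes> t)) = fq (F x y) (s \<otimes> t)"
    if x: "x \<in> carrier M" "s \<in> S" for x s
  proof (rule fraction_UN[OF assms(3,4)])
    fix y t v assume y: "y \<in> carrier M" "t \<in> S" "v \<in> S"
    then show "fq (F x (v \<odot>\<^bsub>M\<^esub> y)) (s \<otimes> (v \<otimes> t)) = fq (F x y) (s \<otimes> t)"
      using scale[of v "F x y" "s \<otimes> t"] x by (simp add: m_lcomm)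
  qed
  have "LF (fr x s) (fr y t) = (\<Union>(x, s)\<in>fr x s. \<Union>(y, t)\<in>fr y t. fq (F x y) (s \<otimes> t))"
    by (simp add: loc_form_def)
  also have "\<dots> = (\<Union>(x, s)\<in>fr x s. fq (F x y) (s \<otimes> t))"
  proof (rule SUP_cong[OF refl])
    fix p assume "p \<in> fr x s"
    then obtain x' s' where p: "p = (x', s')" and x': "x' \<in> carrier M" "s' \<in> S"
      by (cases p) (auto simp: mem_fraction)
    show "(case p of (x, s) \<Rightarrow> \<Union>(y, t)\<in>fr y t. fq (F x y) (s \<otimes> t)) = (case p of (x, s) \<Rightarrow> fq (F x y) (s \<otimes> t))"
      unfolding p prod.case by (rule inner[OF x'])
  qed
  also have "\<dots> = fq (F x y) (s \<otimes> t)"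
  proof (rule fraction_UN[OF assms(1,2)])
    fix x s v assume x: "x \<in> carrier M" "s \<in> S" "v \<in> S"
    then show "fq (F (v \<odot>\<^bsub>M\<^esub> x) y) (v \<otimes> s \<otimes> t) = fq (F x y) (s \<otimes> t)"
      using scale[of v "F x y" "s \<otimes> t"] assms by (simp add: m_assoc)
  qed
  finally show ?thesis .
qed

lemma loc_dual_expand:
  assumes ds: "dual_system k p q" and z: "z \<in> carrier LM"
  shows "(\<Oplus>\<^bsub>LM\<^esub>i\<in>{..<k}. LF (fr (p i) \<one>) z \<odot>\<^bsub>LM\<^esub> fr (q i) \<one>) = z"
proof -
  have p: "i < k \<Longrightarrow> p i \<in> carrier M" and q: "i < k \<Longrightarrow> q i \<in> carrier M" for i
    using ds by (auto simp: dual_system_def)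
  obtain x s where x: "x \<in> carrier M" "s \<in> S" "z = fr x s" using z by (metis loc_E)
  have "(\<Oplus>\<^bsub>LM\<^esub>i\<in>{..<k}. LF (fr (p i) \<one>) z \<odot>\<^bsub>LM\<^esub> fr (q i) \<one>)
    = (\<Oplus>\<^bsub>LM\<^esub>i\<in>{..<k}. fr (F (p i) x \<odot>\<^bsub>M\<^esub> q i) s)"
    using p q x by (intro finsum_eqI) (auto simp: loc_form_apply loc_smult)
  also have "\<dots> = fr (\<Oplus>\<^bsub>M\<^esub>i\<in>{..<k}. F (p i) x \<odot>\<^bsub>M\<^esub> q i) s"
    using p q x by (intro loc_finsum) auto
  also have "\<dots> = z" using ds x by (simp add: dual_system_def)
  finally show ?thesis .
qed

lemma loc_form_module:
  assumes ds: "dual_system k p q"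
  shows "form_module LR LM LF"
proof (intro form_module.intro form_module_axioms.intro loc_module)
  interpret L: Module.module LR LM by (rule loc_module)
  have scale: "fq (v \<otimes> a) (v \<otimes> s) = fq a s" if "v \<in> S" "a \<in> carrier R" "s \<in> S" for v a s
    using Q.fraction_scale[of a s v] that by (simp add: ring_module_sel)
  have p: "i < k \<Longrightarrow> p i \<in> carrier M" and q: "i < k \<Longrightarrow> q i \<in> carrier M" for i
    using ds by (auto simp: dual_system_def)
  fix z w assume zw: "z \<in> carrier LM" "w \<in> carrier LM"
  then obtain x s y t where x: "x \<in> carrier M" "s \<in> S" "z = fr x s"
    and y: "y \<in> carrier M" "t \<in> S" "w = fr y t" by (metis loc_E)
  show "LF z w \<in> carrier LR" using x y by (simp add: loc_form_apply)
  show "LF z z = \<zero>\<^bsub>LR\<^esub>" using x by (simp add: loc_form_apply fq_zero)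
  {
    fix a assume "a \<in> carrier LR"
    then obtain c u where c: "c \<in> carrier R" "u \<in> S" "a = fq c u" by (metis LR_E)
    show "LF (a \<odot>\<^bsub>LM\<^esub> z) w = a \<otimes>\<^bsub>LR\<^esub> LF z w"
      using x y c by (simp add: loc_form_apply loc_smult fq_mult m_assoc)
    show "LF z (a \<odot>\<^bsub>LM\<^esub> w) = a \<otimes>\<^bsub>LR\<^esub> LF z w"
      using x y c by (simp add: loc_form_apply loc_smult fq_mult m_lcomm)
  next
    fix v assume "v \<in> carrier LM"
    then obtain k u where k: "k \<in> carrier M" "u \<in> S" "v = fr k u" by (metis loc_E)
    show "LF (z \<oplus>\<^bsub>LM\<^esub> w) v = LF z v \<oplus>\<^bsub>LR\<^esub> LF w v"
      using x y k scale[of u "t \<otimes> F x k \<oplus> s \<otimes> F y k" "s \<otimes> t \<otimes> u"]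
      by (simp add: loc_form_apply loc_add fq_add r_distr m_ac)
    show "LF v (z \<oplus>\<^bsub>LM\<^esub> w) = LF v z \<oplus>\<^bsub>LR\<^esub> LF v w"
      using x y k scale[of u "t \<otimes> F k x \<oplus> s \<otimes> F k y" "s \<otimes> t \<otimes> u"]
      by (simp add: loc_form_apply loc_add fq_add r_distr m_ac)
  next
    \<comment> \<open>\<open>z\<close> is recovered from its pairings with the images of the
      finitely many \<open>p i\<close>.\<close>
    assume eq: "\<And>v. v \<in> carrier LM \<Longrightarrow> LF v z = LF v w"
    have "(\<Oplus>\<^bsub>LM\<^esub>i\<in>{..<k}. LF (fr (p i) \<one>) z \<odot>\<^bsub>LM\<^esub> fr (q i) \<one>)
      = (\<Oplus>\<^bsub>LM\<^esub>i\<in>{..<k}. LF (fr (p i) \<one>) w \<odot>\<^bsub>LM\<^esub> fr (q i) \<one>)"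
      using eq p by (intro finsum_eqI) auto
    then show "z = w" using loc_dual_expand[OF ds] zw by simp
  }
qed

lemma loc_dual_system:
  assumes ds: "dual_system k p q"
  shows "form_module.dual_system LM LF k (\<lambda>i. fr (p i) \<one>) (\<lambda>i. fr (q i) \<one>)"
proof -
  interpret L: form_module LR LM LF by (rule loc_form_module[OF ds])
  show ?thesis using loc_dual_expand[OF ds] ds by (auto simp: L.dual_system_def dual_system_def Pi_def)
qed

definition loc_map where "loc_map g = (\<lambda>z\<in>carrier LM. \<Union>(x, s)\<in>z. fr (g x) s)"

lemma loc_map_apply:
  assumes g: "g \<in> module_hom R M M" and x: "x \<in> carrier M" "s \<in> S"
  shows "loc_map g (fr x s) = fr (g x) s"
proof -
  note h = module_homD[OF g]
  have "(\<Union>(x, s)\<in>fr x s. fr (g x) s) = fr (g x) s"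
    by (rule fraction_UN[OF x]) (use h in \<open>auto simp: fraction_scale\<close>)
  then show ?thesis using x by (simp add: loc_map_def)
qed

lemma loc_map_isometry:
  assumes ds: "dual_system k p q" and g: "g \<in> carrier Iso"
  shows "loc_map g \<in> carrier (isometry_group LR LM LF)"
proof -
  interpret L: form_module LR LM LF by (rule loc_form_module[OF ds])
  have gh: "g \<in> module_hom R M M" using g by (simp add: isometry_iff)
  have k: "inv\<^bsub>Iso\<^esub> g \<in> carrier Iso" using g by simp
  then have kh: "inv\<^bsub>Iso\<^esub> g \<in> module_hom R M M" by (simp add: isometry_iff)
  note D = isometryD[OF g] and E = isometryD[OF k] and inv = isometry_inv[OF g]
  show ?thesis unfolding isometry_iff
  proof (intro conjI ballI)
    show "loc_map g \<in> module_hom LR LM LM"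
    proof (rule module_homI)
      fix z assume "z \<in> carrier LM"
      then obtain x s where x: "x \<in> carrier M" "s \<in> S" "z = fr x s" by (metis loc_E)
      show "loc_map g z \<in> carrier LM" using x D by (simp add: loc_map_apply[OF gh])
      {
        fix w assume "w \<in> carrier LM"
        then obtain y t where y: "y \<in> carrier M" "t \<in> S" "w = fr y t" by (metis loc_E)
        show "loc_map g (z \<oplus>\<^bsub>LM\<^esub> w) = loc_map g z \<oplus>\<^bsub>LM\<^esub> loc_map g w"
          using x y D by (simp add: loc_map_apply[OF gh] loc_add)
      next
        fix a assume "a \<in> carrier LR"
        then obtain c u where c: "c \<in> carrier R" "u \<in> S" "a = fq c u" by (metis LR_E)
        show "loc_map g (a \<odot>\<^bsub>LM\<^esub> z) = a \<odot>\<^bsub>LM\<^esub> loc_map g z"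
          using x c D by (simp add: loc_map_apply[OF gh] loc_smult)
      }
    qed (simp add: loc_map_def)
    have "loc_map g (loc_map (inv\<^bsub>Iso\<^esub> g) z) = z" "loc_map (inv\<^bsub>Iso\<^esub> g) (loc_map g z) = z"
      "loc_map g z \<in> carrier LM" "loc_map (inv\<^bsub>Iso\<^esub> g) z \<in> carrier LM" if z: "z \<in> carrier LM" for z
    proof -
      obtain x s where x: "x \<in> carrier M" "s \<in> S" "z = fr x s" using z by (metis loc_E)
      show "loc_map g (loc_map (inv\<^bsub>Iso\<^esub> g) z) = z" "loc_map (inv\<^bsub>Iso\<^esub> g) (loc_map g z) = z"
        "loc_map g z \<in> carrier LM" "loc_map (inv\<^bsub>Iso\<^esub> g) z \<in> carrier LM"
        using x D E inv by (simp_all add: loc_map_apply[OF gh] loc_map_apply[OF kh])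
    qed
    then show "bij_betw (loc_map g) (carrier LM) (carrier LM)"
      by (intro bij_betw_byWitness[where f' = "loc_map (inv\<^bsub>Iso\<^esub> g)"]) auto
    fix z w assume "z \<in> carrier LM" "w \<in> carrier LM"
    then obtain x s y t where x: "x \<in> carrier M" "s \<in> S" "z = fr x s"
      and y: "y \<in> carrier M" "t \<in> S" "w = fr y t" by (metis loc_E)
    show "LF (loc_map g z) (loc_map g w) = LF z w"
      using x y D by (simp add: loc_map_apply[OF gh] loc_form_apply)
  qed
qed

end

section \<open>Localization at a prime\<close>

lemma prime_mult_subset:
  assumes "cring R" "primeideal \<pp> R"
  shows "mult_subset R (prime_compl R \<pp>)"
proof -
  interpret R: cring R by fact
  interpret p: primeideal \<pp> R by fact
  show ?thesis
  proof (intro mult_subset.intro mult_subset_axioms.intro assms(1))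
    show "\<one>\<^bsub>R\<^esub> \<in> prime_compl R \<pp>" using p.one_imp_carrier p.I_notcarr by auto
  qed (use p.I_prime in auto)
qed

text \<open>A fraction is a unit iff its numerator lies outside \<open>\<pp>\<close>. A sum of two
  fractions with numerators in \<open>\<pp>\<close> has a numerator in \<open>\<pp>\<close>
  again.\<close>

lemma (in cring) loc_ring_local:
  assumes p: "primeideal \<pp> R"
  defines "S \<equiv> prime_compl R \<pp>"
  assumes ab: "a \<in> carrier (loc_ring R S)" "b \<in> carrier (loc_ring R S)"
    and sum: "a \<oplus>\<^bsub>loc_ring R S\<^esub> b \<in> Units (loc_ring R S)"
  shows "a \<in> Units (loc_ring R S) \<or> b \<in> Units (loc_ring R S)"
proof -
  interpret mult_subset R S unfolding S_def by (rule prime_mult_subset[OF is_cring p])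
  interpret L: cring LR by (rule LR_cring)
  interpret p: primeideal \<pp> R by fact
  have unit: "fq x s \<in> Units LR \<longleftrightarrow> x \<notin> \<pp>" if x: "x \<in> carrier R" "s \<in> S" for x s
  proof
    assume "fq x s \<in> Units LR"
    then obtain w where "w \<in> carrier LR" "fq x s \<otimes>\<^bsub>LR\<^esub> w = \<one>\<^bsub>LR\<^esub>" by (auto simp: Units_def L.m_comm)
    then obtain y t where y: "y \<in> carrier R" "t \<in> S" "fq (x \<otimes> y) (s \<otimes> t) = fq \<one> \<one>"
      using x by (metis LR_E fq_mult loc_ring_sel(5))
    then obtain u where u: "u \<in> S" "u \<otimes> (x \<otimes> y) = u \<otimes> (s \<otimes> t)"
      using Q.fraction_eq_iff[of "x \<otimes> y" \<one> "s \<otimes> t" \<one>] x by (auto simp: ring_module_sel)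
    show "x \<notin> \<pp>"
    proof
      assume "x \<in> \<pp>"
      then have "u \<otimes> (x \<otimes> y) \<in> \<pp>" using u(1) y(1) by (simp add: p.I_l_closed p.I_r_closed)
      moreover have "u \<otimes> (s \<otimes> t) \<in> S" using u x y by simp
      ultimately show False using u(2) by (simp add: S_def)
    qed
  next
    assume "x \<notin> \<pp>"
    then have xS: "x \<in> S" using x by (simp add: S_def)
    have "fq x s \<otimes>\<^bsub>LR\<^esub> fq s x = \<one>\<^bsub>LR\<^esub>"
      unfolding loc_ring_sel(5) using x xS
      by (simp add: fq_mult, intro Q.fraction_eqI_one) (auto simp: ring_module_sel m_comm)
    then show "fq x s \<in> Units LR"
      using x xS by (auto simp: Units_def L.m_comm intro!: bexI[of _ "fq s x"])
  qed
  obtain x s y t where x: "x \<in> carrier R" "s \<in> S" "a = fq x s" and y: "y \<in> carrier R" "t \<in> S" "b = fq y t"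
    using ab by (metis LR_E)
  have "t \<otimes> x \<oplus> s \<otimes> y \<notin> \<pp>" using sum x y by (simp add: fq_add unit)
  then have "x \<notin> \<pp> \<or> y \<notin> \<pp>" using x y by (auto simp: p.I_l_closed)
  then show ?thesis using unit x y by auto
qed

section \<open>Symplectic bases\<close>

context form_module
begin

text \<open>The Gram matrix of an orthogonal sum of hyperbolic planes, the members of each pair
  having the adjacent indices \<open>2i\<close> and \<open>2i + 1\<close>.\<close>

definition standard_entry where
  "standard_entry i j = (if even (i::nat) \<and> j = Suc i then \<one> else if odd i \<and> i = Suc j then \<ominus> \<one> else \<zero>)"

lemma dual_basis_permute:
  assumes db: "dual_basis N b D" and \<sigma>: "\<sigma> permutes {..<N}"
  shows "dual_basis N (b \<circ> \<sigma>) (D \<circ> \<sigma>)"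
proof -
  note d = dual_basisD[OF db]
  have s: "\<sigma> i < N" if "i < N" for i using permutes_in_image[OF \<sigma>, of i] that by simp
  have inj: "inj_on \<sigma> {..<N}" using permutes_inj_on[OF \<sigma>] .
  have img: "\<sigma> ` {..<N} = {..<N}" by (rule permutes_image[OF \<sigma>])
  have "(\<Oplus>\<^bsub>M\<^esub>i\<in>{..<N}. F (D (\<sigma> i)) x \<odot>\<^bsub>M\<^esub> b (\<sigma> i)) = x" if x: "x \<in> carrier M" for x
  proof -
    have "(\<Oplus>\<^bsub>M\<^esub>i\<in>\<sigma> ` {..<N}. F (D i) x \<odot>\<^bsub>M\<^esub> b i) = (\<Oplus>\<^bsub>M\<^esub>i\<in>{..<N}. F (D (\<sigma> i)) x \<odot>\<^bsub>M\<^esub> b (\<sigma> i))"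
      using d s x inj by (intro M.finsum_reindex) (auto simp: img)
    then show ?thesis using d(3)[OF x] by (simp add: img)
  qed
  moreover have "F (D (\<sigma> i)) (b (\<sigma> j)) = (if i = j then \<one> else \<zero>)" if "i < N" "j < N" for i j
    using d(4) s that inj by (auto simp: inj_on_def)
  ultimately show ?thesis
    unfolding dual_basis_def by (intro conjI ballI allI impI Pi_I) (simp_all add: d(1,2) s)
qed

text \<open>The local condition for two summands, iterated; the empty sum is excluded because zero
  is not a unit.\<close>

lemma finsum_unit_summand:
  assumes loc: "\<And>a b. a \<in> carrier R \<Longrightarrow> b \<in> carrier R \<Longrightarrow> a \<oplus> b \<in> Units R \<Longrightarrow> a \<in> Units R \<or> b \<in> Units R"
    and zero: "\<zero> \<notin> Units R" and "finite A" "f \<in> A \<rightarrow> carrier R" "(\<Oplus>i\<in>A. f i) \<in> Units R"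
  shows "\<exists>i\<in>A. f i \<in> Units R"
  using assms(3-5)
proof (induction A rule: finite_induct)
  case (insert a A)
  then have "f a \<oplus> (\<Oplus>i\<in>A. f i) \<in> Units R" by (simp add: Pi_def)
  then have "f a \<in> Units R \<or> (\<Oplus>i\<in>A. f i) \<in> Units R" using insert by (intro loc) auto
  then show ?case using insert by auto
qed (use zero in simp)

lemma minus_Units: "a \<in> Units R \<Longrightarrow> \<ominus> a \<in> Units R"
  by (metis R.Units_closed R.Units_m_closed R.Units_minus_one_closed R.l_minus R.l_one R.one_closed)

lemma Units_factor:
  assumes "a \<in> carrier R" "b \<in> carrier R" "a \<otimes> b \<in> Units R"
  shows "b \<in> Units R"
proof -
  have i: "inv (a \<otimes> b) \<in> carrier R" using assms(3) by simp
  have "inv (a \<otimes> b) \<otimes> a \<otimes> b = \<one>" using assms i by (simp add: R.m_assoc)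
  then show ?thesis unfolding Units_def
    using assms i by (auto simp: R.m_comm intro!: bexI[of _ "inv (a \<otimes> b) \<otimes> a"])
qed

text \<open>For \<open>F e f = 1\<close> this is the projection onto the orthogonal complement of
  the hyperbolic plane of \<open>e\<close> and \<open>f\<close>: the component of \<open>x\<close>
  in the plane is \<open>F (- f) x\<close> times \<open>e\<close> plus \<open>F e x\<close> times
  \<open>f\<close>.\<close>

definition proj_compl where
  "proj_compl e f = (\<lambda>x\<in>carrier M. x \<oplus>\<^bsub>M\<^esub> (F f x \<odot>\<^bsub>M\<^esub> e \<oplus>\<^bsub>M\<^esub> F x e \<odot>\<^bsub>M\<^esub> f))"

lemma proj_compl:
  assumes e: "e \<in> carrier M" and f: "f \<in> carrier M" and ef: "F e f = \<one>"
  shows "proj_compl e f \<in> module_hom R M M"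
    and "proj_compl e f e = \<zero>\<^bsub>M\<^esub>" and "proj_compl e f f = \<zero>\<^bsub>M\<^esub>"
    and "x \<in> carrier M \<Longrightarrow> F e (proj_compl e f x) = \<zero>"
    and "x \<in> carrier M \<Longrightarrow> F f (proj_compl e f x) = \<zero>"
    and "x \<in> carrier M \<Longrightarrow> y \<in> carrier M \<Longrightarrow> F y e = \<zero> \<Longrightarrow> F y f = \<zero> \<Longrightarrow> F y (proj_compl e f x) = F y x"
    and "x \<in> carrier M \<Longrightarrow>
      (proj_compl e f x \<oplus>\<^bsub>M\<^esub> F (\<ominus>\<^bsub>M\<^esub> f) x \<odot>\<^bsub>M\<^esub> e) \<oplus>\<^bsub>M\<^esub> F e x \<odot>\<^bsub>M\<^esub> f = x"
proof -
  have fe: "F f e = \<ominus> \<one>" using F_skew[OF e f] ef by simp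
  show "proj_compl e f \<in> module_hom R M M"
  proof (rule module_homI)
    fix x y assume xy: "x \<in> carrier M" "y \<in> carrier M"
    show "proj_compl e f (x \<oplus>\<^bsub>M\<^esub> y) = proj_compl e f x \<oplus>\<^bsub>M\<^esub> proj_compl e f y"
      by (rule F_nondegenerate)
        (use xy e f in \<open>simp_all add: proj_compl_def R.l_distr R.r_distr R.a_ac\<close>)
  next
    fix a x assume ax: "a \<in> carrier R" "x \<in> carrier M"
    show "proj_compl e f (a \<odot>\<^bsub>M\<^esub> x) = a \<odot>\<^bsub>M\<^esub> proj_compl e f x"
      by (rule F_nondegenerate)
        (use ax e f in \<open>simp_all add: proj_compl_def R.l_distr R.r_distr R.a_ac R.m_ac\<close>)
  qed (use e f in \<open>auto simp: proj_compl_def\<close>)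
  show "proj_compl e f e = \<zero>\<^bsub>M\<^esub>" "proj_compl e f f = \<zero>\<^bsub>M\<^esub>"
    using e f ef fe by (simp_all add: proj_compl_def smult_l_minus M.r_neg)
  {
    assume x: "x \<in> carrier M"
    show "F e (proj_compl e f x) = \<zero>"
      using x e f ef F_skew[OF e x] by (simp add: proj_compl_def R.r_neg)
    show "F f (proj_compl e f x) = \<zero>"
      using x e f fe by (simp add: proj_compl_def R.r_minus R.r_neg)
    show "y \<in> carrier M \<Longrightarrow> F y e = \<zero> \<Longrightarrow> F y f = \<zero> \<Longrightarrow> F y (proj_compl e f x) = F y x"
      using x e f by (simp add: proj_compl_def)
    show "(proj_compl e f x \<oplus>\<^bsub>M\<^esub> F (\<ominus>\<^bsub>M\<^esub> f) x \<odot>\<^bsub>M\<^esub> e) \<oplus>\<^bsub>M\<^esub> F e x \<odot>\<^bsub>M\<^esub> f = x"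
    proof (rule F_nondegenerate)
      fix z assume z: "z \<in> carrier M"
      have "k \<oplus> (a \<otimes> c \<oplus> (\<ominus> b) \<otimes> d) \<oplus> (\<ominus> a) \<otimes> c \<oplus> b \<otimes> d = k"
        if "k \<in> carrier R" "a \<in> carrier R" "b \<in> carrier R" "c \<in> carrier R" "d \<in> carrier R" for k a b c d
        using that by algebra
      from this[of "F z x" "F f x" "F e x" "F z e" "F z f"]
      show "F z (proj_compl e f x \<oplus>\<^bsub>M\<^esub> F (\<ominus>\<^bsub>M\<^esub> f) x \<odot>\<^bsub>M\<^esub> e \<oplus>\<^bsub>M\<^esub> F e x \<odot>\<^bsub>M\<^esub> f) = F z x"
        using x z e f F_skew[OF e x] by (simp add: proj_compl_def)
    qed (use x e f in \<open>auto simp: proj_compl_def\<close>)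
  }
qed

text \<open>Symplectic Gram-Schmidt. The vector \<open>e\<close> at position \<open>2m\<close> has a
  partner among the later basis vectors; it is moved to position \<open>2m + 1\<close>, scaled to
  \<open>f\<close> with \<open>F e f = 1\<close>, and the remaining vectors are projected away from
  the plane. The finished vectors are orthogonal to \<open>e\<close> and \<open>f\<close>, so the
  projection fixes them. The dual basis is carried along.\<close>

lemma symplectic_step:
  assumes loc: "\<And>a b. a \<in> carrier R \<Longrightarrow> b \<in> carrier R \<Longrightarrow> a \<oplus> b \<in> Units R \<Longrightarrow> a \<in> Units R \<or> b \<in> Units R"
    and zero: "\<zero> \<notin> Units R" and db: "dual_basis N b D" and m: "2 * m + 2 \<le> N"
    and std: "\<And>i j. i < 2 * m \<Longrightarrow> j < N \<Longrightarrow> F (b i) (b j) = standard_entry i j"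
  shows "\<exists>b' D'. dual_basis N b' D' \<and>
    (\<forall>i<2 * Suc m. \<forall>j<N. F (b' i) (b' j) = standard_entry i j)"
proof -
  let ?m = "2 * m"
  define e where "e = b ?m"
  note d = dual_basisD[OF db]
  have e: "e \<in> carrier M" unfolding e_def using d m by simp
  \<comment> \<open>This is \<open>F (D ?m) (b ?m) = \<one>\<close> with \<open>D ?m\<close>
    expanded in the basis. Over a local ring some summand is a unit, and then so is its factor
    \<open>F (b k) e\<close>.\<close>
  have "(\<Oplus>k\<in>{..<N}. F (D k) (D ?m) \<otimes> F (b k) e) = \<one>"
    using F_expand_l[OF db, of "D ?m" e] d m e by (simp add: e_def)
  then obtain k where k: "k < N" "F (D k) (D ?m) \<otimes> F (b k) e \<in> Units R"
    using finsum_unit_summand[OF loc zero, of "{..<N}" "\<lambda>k. F (D k) (D ?m) \<otimes> F (b k) e"] d m e by auto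
  have bk: "F (b k) e \<in> Units R"
    using k d m e by (intro Units_factor[of "F (D k) (D ?m)" "F (b k) e"]) auto
  \<comment> \<open>The earlier basis vectors are orthogonal to \<open>e\<close> by the standard
    form, and \<open>e\<close> is orthogonal to itself. So the exchange below does not touch the
    finished planes.\<close>
  have kge: "Suc ?m \<le> k"
  proof (rule ccontr)
    assume "\<not> Suc ?m \<le> k"
    then consider "k < ?m" | "k = ?m" by linarith
    then have "F (b k) e = \<zero>"
    proof cases
      case 1
      then have "F (b k) e = standard_entry k ?m" using std m by (simp add: e_def)
      also have "\<dots> = \<zero>" using 1 by (auto simp: standard_entry_def) presburger
      finally show ?thesis .
    qed (use e in \<open>simp add: e_def\<close>)
    then show False using bk zero by simp
  qed
  define \<sigma> where "\<sigma> = transpose (Suc ?m) k"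
  have \<sigma>: "\<sigma> permutes {..<N}" unfolding \<sigma>_def using k m by (intro permutes_swap_id) auto
  define b1 where "b1 = b \<circ> \<sigma>"
  define D1 where "D1 = D \<circ> \<sigma>"
  have db1: "dual_basis N b1 D1" unfolding b1_def D1_def by (rule dual_basis_permute[OF db \<sigma>])
  note d1 = dual_basisD[OF db1]
  have s: "\<sigma> i = i" if "i \<le> ?m" for i using that kge by (simp add: \<sigma>_def transpose_def)
  have s': "\<sigma> i < N" if "i < N" for i using permutes_in_image[OF \<sigma>, of i] that by simp
  have sge: "?m \<le> \<sigma> i" if "?m \<le> i" for i using that kge by (auto simp: \<sigma>_def transpose_def)
  have big: "standard_entry i j = \<zero>" if "i < ?m" "?m \<le> j" for i j
    using that by (auto simp: standard_entry_def)
  have std1: "F (b1 i) (b1 j) = standard_entry i j" if "i < ?m" "j < N" for i j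
  proof -
    have "F (b1 i) (b1 j) = standard_entry i (\<sigma> j)" using that std s s' by (simp add: b1_def)
    also have "\<dots> = standard_entry i j"
      using that s[of j] sge[of j] big[of i j] big[of i "\<sigma> j"] by (cases "j < ?m") auto
    finally show ?thesis .
  qed
  have e1: "e = b1 ?m" by (simp add: e_def b1_def s)
  define f0 where "f0 = b1 (Suc ?m)"
  have f0: "f0 \<in> carrier M" unfolding f0_def using d1 m by simp
  have "f0 = b k" by (simp add: f0_def b1_def \<sigma>_def)
  then have ef0: "F e f0 \<in> Units R" using bk minus_Units F_skew[of f0 e] e f0 by simp
  define f where "f = inv (F e f0) \<odot>\<^bsub>M\<^esub> f0"
  have f: "f \<in> carrier M" and ef: "F e f = \<one>" using f0 ef0 e by (auto simp: f_def)
  have fe: "F f e = \<ominus> \<one>" using F_skew[OF e f] ef by simp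
  let ?\<pi> = "proj_compl e f"
  note pr = proj_compl[OF e f ef]
  note prh = module_homD[OF pr(1)]
  have low: "F (b1 i) e = \<zero>" "F (b1 i) f = \<zero>" if "i < ?m" for i
    using std1[OF that, of ?m] std1[OF that, of "Suc ?m"] big[OF that] d1 m that f0 e ef0
    by (auto simp: e1 f_def f0_def)
  have pf0: "?\<pi> f0 = \<zero>\<^bsub>M\<^esub>"
  proof -
    have "f0 = F e f0 \<odot>\<^bsub>M\<^esub> f" using f0 ef0 e by (simp add: f_def smult_assoc1[symmetric])
    then have "?\<pi> f0 = F e f0 \<odot>\<^bsub>M\<^esub> ?\<pi> f" using prh(3)[of "F e f0" f] f e f0 by simp
    then show ?thesis using pr(3) e f0 by simp
  qed
  define b' where "b' i = (if i = ?m then e else if i = Suc ?m then f else ?\<pi> (b1 i))" for i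
  \<comment> \<open>On the plane the dual vectors are forced by \<open>F (- f) e = \<one>\<close>
    and \<open>F e f = \<one>\<close>. The others remain: they annihilate \<open>e\<close> and
    \<open>f\<close>, so they do not notice that multiples of \<open>e\<close> and \<open>f\<close>
    are added to the basis vectors.\<close>
  define D' where "D' i = (if i = ?m then \<ominus>\<^bsub>M\<^esub> f else if i = Suc ?m then e else D1 i)" for i
  have b': "b' i \<in> carrier M" and D': "D' i \<in> carrier M" if "i < N" for i
    using that d1 e f prh(1) by (auto simp: b'_def D'_def)
  have De: "F (D1 i) e = \<zero>" "F (D1 i) f = \<zero>" if "i < N" "i \<noteq> ?m" "i \<noteq> Suc ?m" for i
    using that d1(4)[of i ?m] d1(4)[of i "Suc ?m"] d1(2) m f0 ef0 e by (auto simp: e1 f_def f0_def)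
  have dual': "F (D' i) (b' j) = (if i = j then \<one> else \<zero>)" if "i < N" "j < N" for i j
    using that e f ef fe d1(1,2,4) prh(1) pr(4-6) De by (auto simp: D'_def b'_def)
  have exp: "(\<Oplus>\<^bsub>M\<^esub>i\<in>{..<N}. F (D' i) x \<odot>\<^bsub>M\<^esub> b' i) = x" if x: "x \<in> carrier M" for x
  proof -
    let ?g = "\<lambda>i. F (D1 i) x \<odot>\<^bsub>M\<^esub> ?\<pi> (b1 i)"
    let ?s = "\<lambda>i. if i = ?m then F (\<ominus>\<^bsub>M\<^esub> f) x \<odot>\<^bsub>M\<^esub> e else \<zero>\<^bsub>M\<^esub>"
    let ?t = "\<lambda>i. if i = Suc ?m then F e x \<odot>\<^bsub>M\<^esub> f else \<zero>\<^bsub>M\<^esub>"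
    have c: "F (\<ominus>\<^bsub>M\<^esub> f) x \<odot>\<^bsub>M\<^esub> e \<in> carrier M" "F e x \<odot>\<^bsub>M\<^esub> f \<in> carrier M" using x e f by auto
    have g: "?g i \<in> carrier M" if "i < N" for i using that d1 x prh(1) by simp
    \<comment> \<open>The projection kills \<open>e\<close> and \<open>f0\<close>, so its expansion
      \<open>?g\<close> in the old basis has no terms at the positions \<open>2m\<close> and
      \<open>2m + 1\<close>. The two components in the plane are put there.\<close>
    have "(\<Oplus>\<^bsub>M\<^esub>i\<in>{..<N}. F (D' i) x \<odot>\<^bsub>M\<^esub> b' i) = (\<Oplus>\<^bsub>M\<^esub>i\<in>{..<N}. ?g i \<oplus>\<^bsub>M\<^esub> ?s i \<oplus>\<^bsub>M\<^esub> ?t i)"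
    proof (rule finsum_eqI)
      fix i assume "i \<in> {..<N}"
      then have i: "i < N" by simp
      consider "i = ?m" | "i = Suc ?m" | "i \<noteq> ?m" "i \<noteq> Suc ?m" by blast
      then show "F (D' i) x \<odot>\<^bsub>M\<^esub> b' i = ?g i \<oplus>\<^bsub>M\<^esub> ?s i \<oplus>\<^bsub>M\<^esub> ?t i"
      proof cases
        case 1
        then have "?g i = \<zero>\<^bsub>M\<^esub>" using pr(2) d1(2)[OF i] x e1 by simp
        then show ?thesis using 1 c by (simp add: b'_def D'_def)
      next
        case 2
        then have "?g i = \<zero>\<^bsub>M\<^esub>" using pf0 d1(2)[OF i] x f0_def by simp
        then show ?thesis using 2 c by (simp add: b'_def D'_def)
      next
        case 3
        then show ?thesis using g[OF i] by (simp add: b'_def D'_def)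
      qed
    qed simp
    also have "\<dots> = (\<Oplus>\<^bsub>M\<^esub>i\<in>{..<N}. ?g i) \<oplus>\<^bsub>M\<^esub> (\<Oplus>\<^bsub>M\<^esub>i\<in>{..<N}. ?s i) \<oplus>\<^bsub>M\<^esub> (\<Oplus>\<^bsub>M\<^esub>i\<in>{..<N}. ?t i)"
      using g c by (subst M.finsum_addf; (subst M.finsum_addf)?) (auto intro!: M.add.m_closed)
    also have "(\<Oplus>\<^bsub>M\<^esub>i\<in>{..<N}. ?g i) = ?\<pi> x"
      by (rule hom_expand[OF db1 pr(1) x, symmetric])
    also have "(\<Oplus>\<^bsub>M\<^esub>i\<in>{..<N}. ?s i) = F (\<ominus>\<^bsub>M\<^esub> f) x \<odot>\<^bsub>M\<^esub> e"
      using M.finsum_delta[of ?m "{..<N}" "\<lambda>_. F (\<ominus>\<^bsub>M\<^esub> f) x \<odot>\<^bsub>M\<^esub> e"] c m by simp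
    also have "(\<Oplus>\<^bsub>M\<^esub>i\<in>{..<N}. ?t i) = F e x \<odot>\<^bsub>M\<^esub> f"
      using M.finsum_delta[of "Suc ?m" "{..<N}" "\<lambda>_. F e x \<odot>\<^bsub>M\<^esub> f"] c m by simp
    finally show ?thesis using pr(7)[OF x] by simp
  qed
  have "dual_basis N b' D'"
    unfolding dual_basis_def by (intro conjI ballI allI impI Pi_I) (simp_all add: b' D' exp dual')
  moreover have "F (b' i) (b' j) = standard_entry i j" if i: "i < 2 * Suc m" and j: "j < N" for i j
  proof -
    from i consider "i < ?m" | "i = ?m" | "i = Suc ?m" by fastforce
    then show ?thesis
    proof cases
      case 1
      have bi: "b' i = b1 i"
      proof -
        have "F (b1 i) e = \<zero>" "F f (b1 i) = \<zero>" using low[OF 1] F_skew[of "b1 i" f] d1(1)[of i] 1 m f by auto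
        then show ?thesis using 1 d1(1)[of i] m e f by (simp add: b'_def proj_compl_def)
      qed
      have b1i: "b1 i \<in> carrier M" using 1 m d1(1) by simp
      show ?thesis
        using low[OF 1] big[OF 1, of j] std1[OF 1 j] pr(6)[OF d1(1)[OF j] b1i low[OF 1]]
        by (auto simp: bi) (auto simp: b'_def)
    next
      case 2
      then show ?thesis using e f ef pr(4)[OF d1(1)[OF j]]
        by (auto simp: b'_def standard_entry_def)
    next
      case 3
      then show ?thesis using e f fe pr(5)[OF d1(1)[OF j]]
        by (auto simp: b'_def standard_entry_def)
    qed
  qed
  ultimately show ?thesis by blast
qed

lemma symplectic_basis:
  assumes loc: "\<And>a b. a \<in> carrier R \<Longrightarrow> b \<in> carrier R \<Longrightarrow> a \<oplus> b \<in> Units R \<Longrightarrow> a \<in> Units R \<or> b \<in> Units R"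
    and zero: "\<zero> \<notin> Units R" and db: "dual_basis (2 * n) b D"
  shows "\<exists>b D. dual_basis (2 * n) b D \<and> (\<forall>i<2 * n. \<forall>j<2 * n. F (b i) (b j) = standard_entry i j)"
proof -
  have "\<exists>b D. dual_basis (2 * n) b D \<and> (\<forall>i<2 * m. \<forall>j<2 * n. F (b i) (b j) = standard_entry i j)"
    if "m \<le> n" for m
    using that
  proof (induction m)
    case (Suc m)
    then obtain b D where "dual_basis (2 * n) b D" "\<forall>i<2 * m. \<forall>j<2 * n. F (b i) (b j) = standard_entry i j"
      by auto
    then show ?case using Suc.prems by (intro symplectic_step[OF loc zero]) auto
  qed (use db in auto)
  then show ?thesis by blast
qed

end

section \<open>The Pfaffian of the standard matrix\<close>

lemma strictly_increasing_on_initial: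
  fixes a :: "nat \<Rightarrow> nat"
  assumes bound: "\<And>i. i < n \<Longrightarrow> a i < n" and mono: "\<And>i j. i < j \<Longrightarrow> j < n \<Longrightarrow> a i < a j" and i: "i < n"
  shows "a i = i"
proof -
  have step: "i + d < n \<Longrightarrow> a i + d \<le> a (i + d)" for i d
  proof (induction d)
    case (Suc d)
    then show ?case using mono[of "i + d" "i + Suc d"] by simp
  qed simp
  have "i \<le> a i" using step[of 0 i] i by simp
  moreover have "a i + (n - 1 - i) \<le> a (n - 1)" using step[of i "n - 1 - i"] i by simp
  ultimately show ?thesis using bound[of "n - 1"] i by linarith
qed

context form_module
begin

text \<open>Only the identity contributes. A nonzero product forces each pair to be
  \<open>(2a, 2a + 1)\<close>, the entry \<open>-1\<close> being excluded by the order within pairs;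
  the order of the pairs then fixes the permutation.\<close>

lemma pfaffian_standard:
  assumes \<phi>: "\<And>i j. i < 2 * n \<Longrightarrow> j < 2 * n \<Longrightarrow> \<phi> $$ (i, j) = standard_entry i j"
  shows "pfaffian R n \<phi> = \<one>"
proof -
  let ?\<Pi> = "{\<pi>. \<pi> permutes {..<2 * n} \<and> (\<forall>i<n. \<pi> (2 * i) < \<pi> (2 * i + 1)) \<and>
                 (\<forall>j<n. \<forall>i<j. \<pi> (2 * i) < \<pi> (2 * j))}"
  let ?p = "\<lambda>\<pi>. \<Otimes>i\<in>{..<n}. \<phi> $$ (\<pi> (2 * i), \<pi> (2 * i + 1))"
  have fin: "finite ?\<Pi>" by (rule finite_subset[OF _ finite_permutations[of "{..<2 * n}"]]) auto
  have id: "id \<in> ?\<Pi>" by (auto simp: permutes_id)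
  have \<phi>c: "\<phi> $$ (i, j) \<in> carrier R" if "i < 2 * n" "j < 2 * n" for i j
    using \<phi>[OF that] by (simp add: standard_entry_def)
  have one: "?p id = \<one>"
    using \<phi> by (intro R.finprod_one_eqI) (auto simp: standard_entry_def)
  have zero: "?p \<pi> = \<zero>" if \<pi>: "\<pi> \<in> ?\<Pi>" "\<pi> \<noteq> id" for \<pi>
  proof -
    have perm: "\<pi> permutes {..<2 * n}" using \<pi> by blast
    have lt: "\<pi> i < 2 * n" if "i < 2 * n" for i using permutes_in_image[OF perm, of i] that by simp
    have "\<exists>i<n. \<phi> $$ (\<pi> (2 * i), \<pi> (2 * i + 1)) = \<zero>"
    proof (rule ccontr)
      assume "\<not> ?thesis"
      then have nz: "standard_entry (\<pi> (2 * i)) (\<pi> (2 * i + 1)) \<noteq> \<zero>" if "i < n" for i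
        using \<phi>[of "\<pi> (2 * i)" "\<pi> (2 * i + 1)"] lt[of "2 * i"] lt[of "2 * i + 1"] that by auto
      have ev: "even (\<pi> (2 * i))" "\<pi> (2 * i + 1) = Suc (\<pi> (2 * i))" if "i < n" for i
      proof -
        have "\<pi> (2 * i) < \<pi> (2 * i + 1)" using \<pi> that by blast
        then show "even (\<pi> (2 * i))" "\<pi> (2 * i + 1) = Suc (\<pi> (2 * i))"
          using nz[OF that] by (auto simp: standard_entry_def split: if_splits)
      qed
      \<comment> \<open>The first members of the pairs are even, less than \<open>2n\<close> and
        increasing, so their halves form a strictly increasing map of \<open>{..<n}\<close> into
        itself.\<close>
      have half: "\<pi> (2 * i) div 2 = i" if "i < n" for i
      proof (rule strictly_increasing_on_initial[where a = "\<lambda>i. \<pi> (2 * i) div 2", OF _ _ that])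
        show "\<pi> (2 * i) div 2 < n" if "i < n" for i using lt[of "2 * i"] that by auto
        show "\<pi> (2 * i) div 2 < \<pi> (2 * j) div 2" if "i < j" "j < n" for i j
        proof -
          have "\<pi> (2 * i) < \<pi> (2 * j)" using \<pi> that by blast
          then show ?thesis using ev(1)[of i] ev(1)[of j] that by (auto elim!: evenE)
        qed
      qed
      have p2: "\<pi> (2 * i) = 2 * i" "\<pi> (2 * i + 1) = 2 * i + 1" if "i < n" for i
        using half[OF that] ev[OF that] by (auto elim!: evenE)
      have "\<pi> j = j" for j
      proof (cases "j < 2 * n")
        case True
        then show ?thesis using p2[of "j div 2"] by (cases "even j") (auto elim!: evenE oddE)
      next
        case False
        then show ?thesis using permutes_not_in[OF perm] by simp
      qed
      then show False using \<pi>(2) by auto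
    qed
    then obtain i where i: "i < n" "\<phi> $$ (\<pi> (2 * i), \<pi> (2 * i + 1)) = \<zero>" by blast
    have c: "\<phi> $$ (\<pi> (2 * j), \<pi> (2 * j + 1)) \<in> carrier R" if "j < n" for j
      using \<phi>c lt that by simp
    have "{..<n} = insert i ({..<n} - {i})" using i by auto
    then have "?p \<pi> = \<phi> $$ (\<pi> (2 * i), \<pi> (2 * i + 1)) \<otimes> (\<Otimes>i\<in>{..<n} - {i}. \<phi> $$ (\<pi> (2 * i), \<pi> (2 * i + 1)))"
      using c i(1) R.finprod_insert[of "{..<n} - {i}" i "\<lambda>i. \<phi> $$ (\<pi> (2 * i), \<pi> (2 * i + 1))"] by auto
    then show ?thesis unfolding i(2) using c by (simp add: R.finprod_closed Pi_def)
  qed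
  have "pfaffian R n \<phi> = (\<Oplus>\<pi>\<in>?\<Pi>. if \<pi> = id then \<one> else \<zero>)"
    unfolding pfaffian_def Let_def
  proof (rule finsum_eqI)
    fix \<pi> assume "\<pi> \<in> ?\<Pi>"
    then show "(if evenperm \<pi> then ?p \<pi> else \<ominus> ?p \<pi>) = (if \<pi> = id then \<one> else \<zero>)"
      using one zero[of \<pi>] by (cases "\<pi> = id") (auto simp: evenperm_id)
  qed simp
  also have "\<dots> = \<one>" using R.finsum_delta[OF id fin, of "\<lambda>_. \<one>"] by simp
  finally show ?thesis .
qed

section \<open>Constants in the polynomial extension: dual bases, units and ideals\<close>

lemma poly_finsum_apply:
  assumes "finite A" "g \<in> A \<rightarrow> up M"
  shows "(\<Oplus>\<^bsub>PX\<^esub>i\<in>A. g i) k = (\<Oplus>\<^bsub>M\<^esub>i\<in>A. g i k)"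
proof -
  interpret X: Module.module "UP R" PX by (rule poly_module)
  show ?thesis using assms
  proof (induction A rule: finite_induct)
    case empty
    then show ?case by (simp add: poly_module_simps)
  next
    case (insert a A)
    have "(\<Oplus>\<^bsub>PX\<^esub>i\<in>insert a A. g i) = g a \<oplus>\<^bsub>PX\<^esub> (\<Oplus>\<^bsub>PX\<^esub>i\<in>A. g i)"
      using insert by (intro X.M.finsum_insert) (auto simp: poly_module_simps)
    moreover have "(\<Oplus>\<^bsub>M\<^esub>i\<in>insert a A. g i k) = g a k \<oplus>\<^bsub>M\<^esub> (\<Oplus>\<^bsub>M\<^esub>i\<in>A. g i k)"
      using insert by (intro M.finsum_insert) auto
    ultimately show ?case using insert by (simp add: poly_module_simps)
  qed
qed

lemma poly_form_consts:
  "x \<in> carrier M \<Longrightarrow> y \<in> carrier M \<Longrightarrow> FX (const_poly M x) (const_poly M y) = const_poly R (F x y)"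
  using poly_form_const[OF _ M.const_poly_up] by (auto simp: const_poly_def)

lemma poly_dual_basis:
  assumes db: "dual_basis N b D"
  shows "form_module.dual_basis (UP R) PX FX N (const_poly M \<circ> b) (const_poly M \<circ> D)"
proof -
  interpret X: form_module "UP R" PX FX by (rule poly_form_module)
  note d = dual_basisD[OF db]
  have "(\<Oplus>\<^bsub>PX\<^esub>i\<in>{..<N}. FX (const_poly M (D i)) f \<odot>\<^bsub>PX\<^esub> const_poly M (b i)) = f" if f: "f \<in> up M" for f
  proof
    fix k
    have p: "FX (const_poly M (D i)) f \<in> up R" if "i < N" for i
      using poly_form_closed[OF M.const_poly_up f] d that by simp
    have "(\<Oplus>\<^bsub>PX\<^esub>i\<in>{..<N}. FX (const_poly M (D i)) f \<odot>\<^bsub>PX\<^esub> const_poly M (b i)) k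
      = (\<Oplus>\<^bsub>M\<^esub>i\<in>{..<N}. (FX (const_poly M (D i)) f \<odot>\<^bsub>PX\<^esub> const_poly M (b i)) k)"
      using d p M.const_poly_up by (intro poly_finsum_apply) (auto intro!: poly_smult_closed)
    also have "\<dots> = (\<Oplus>\<^bsub>M\<^esub>i\<in>{..<N}. F (D i) (f k) \<odot>\<^bsub>M\<^esub> b i)"
      using d p f by (intro finsum_eqI) (auto simp: smult_const poly_form_const)
    also have "\<dots> = f k" using d(3) mem_upD[OF f] by simp
    finally show "(\<Oplus>\<^bsub>PX\<^esub>i\<in>{..<N}. FX (const_poly M (D i)) f \<odot>\<^bsub>PX\<^esub> const_poly M (b i)) k = f k" .
  qed
  moreover have "FX (const_poly M (D i)) (const_poly M (b j)) = (if i = j then \<one>\<^bsub>UP R\<^esub> else \<zero>\<^bsub>UP R\<^esub>)"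
    if "i < N" "j < N" for i j
    using that d by (simp add: poly_form_consts UP_simps) (simp add: const_poly_def)
  ultimately show ?thesis
    unfolding X.dual_basis_def using d M.const_poly_up
    by (intro conjI ballI allI impI Pi_I) (simp_all add: poly_module_simps)
qed

lemma const_Units:
  assumes "a \<in> Units R"
  shows "const_poly R a \<in> Units (UP R)"
proof -
  interpret U: cring "UP R" by (rule R.UP_is_cring)
  have mult: "const_poly R x \<otimes>\<^bsub>UP R\<^esub> const_poly R y = const_poly R (x \<otimes> y)"
    if "x \<in> carrier R" "y \<in> carrier R" for x y
  proof
    fix k
    have "(\<Oplus>i\<in>{..k}. const_poly R x i \<otimes> const_poly R y (k - i))
      = (\<Oplus>i\<in>{..k}. if i = 0 then x \<otimes> const_poly R y k else \<zero>)"
      using that R.const_poly_up by (intro finsum_eqI) (auto simp: const_poly_def)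
    also have "\<dots> = x \<otimes> const_poly R y k"
      using R.finsum_delta[of 0 "{..k}" "\<lambda>_. x \<otimes> const_poly R y k"] that by (simp add: const_poly_def)
    finally show "(const_poly R x \<otimes>\<^bsub>UP R\<^esub> const_poly R y) k = const_poly R (x \<otimes> y) k"
      using that R.const_poly_up by (simp add: UP_simps) (simp add: const_poly_def)
  qed
  have "inv a \<in> carrier R" "a \<in> carrier R" using assms by auto
  then show ?thesis
    unfolding Units_def using assms mult R.const_poly_up
    by (auto simp: UP_simps intro!: bexI[of _ "const_poly R (inv a)"])
qed

lemma poly_ideal_ideal:
  assumes "ideal J R"
  shows "ideal (poly_ideal R J) (UP R)"
proof -
  interpret J: ideal J R by fact
  interpret U: cring "UP R" by (rule R.UP_is_cring)
  have l: "x \<otimes>\<^bsub>UP R\<^esub> f \<in> poly_ideal R J" if "f \<in> poly_ideal R J" "x \<in> carrier (UP R)" for f x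
  proof -
    have fx: "f \<in> up R" "x \<in> up R" "\<And>i. f i \<in> J" using that by (auto simp: poly_ideal_def UP_simps)
    have "x \<otimes>\<^bsub>UP R\<^esub> f \<in> up R" using U.m_closed[of x f] fx by (simp add: UP_simps(1))
    moreover have "(x \<otimes>\<^bsub>UP R\<^esub> f) k \<in> J" for k
      using fx mem_upD[OF fx(2)] by (auto simp: UP_simps intro!: J.finsum_in_ideal J.I_l_closed)
    ultimately show ?thesis by (simp add: poly_ideal_def)
  qed
  show ?thesis
  proof (rule idealI[OF U.ring_axioms])
    show "subgroup (poly_ideal R J) (add_monoid (UP R))"
    proof (rule U.add.subgroupI)
      show "poly_ideal R J \<subseteq> carrier (UP R)" by (auto simp: poly_ideal_def UP_simps)
      have "(\<lambda>i. \<zero>) \<in> poly_ideal R J" using U.zero_closed by (auto simp: poly_ideal_def UP_simps)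
      then show "poly_ideal R J \<noteq> {}" by blast
      show "\<ominus>\<^bsub>UP R\<^esub> p \<in> poly_ideal R J" if "p \<in> poly_ideal R J" for p
        using that R.UP_minus[of p] R.up_a_inv_closed[of p] by (auto simp: poly_ideal_def)
      show "p \<oplus>\<^bsub>UP R\<^esub> q \<in> poly_ideal R J" if "p \<in> poly_ideal R J" "q \<in> poly_ideal R J" for p q
        using that R.up_add_closed[of p q] by (auto simp: poly_ideal_def UP_simps)
    qed
    show "x \<otimes>\<^bsub>UP R\<^esub> f \<in> poly_ideal R J" if "f \<in> poly_ideal R J" "x \<in> carrier (UP R)" for f x
      using l that by blast
    show "f \<otimes>\<^bsub>UP R\<^esub> x \<in> poly_ideal R J" if "f \<in> poly_ideal R J" "x \<in> carrier (UP R)" for f x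
    proof -
      have "f \<in> carrier (UP R)" using that by (simp add: poly_ideal_def UP_simps)
      then show ?thesis using l[OF that] U.m_comm[of f x] that by simp
    qed
  qed
qed

end

section \<open>Symplectic modules\<close>

text \<open>A splitting \<open>r \<circ> s = id\<close> through a free module gives generators
  \<open>r (u i)\<close> and coordinate functions \<open>x \<mapsto> s x i\<close>. Perfectness of
  the form represents the latter by vectors \<open>p i\<close>. The resulting expansion of
  \<open>x\<close> also shows that the form separates points.\<close>

lemma symplectic_module_form:
  assumes sm: "symplectic_module R P B"
  shows "form_module R P B" and "\<exists>k p q. form_module.dual_system P B k p q"
proof -
  have "cring R" "Module.module R P" and proj: "fg_projective R P"
    and lin_r: "x \<in> carrier P \<Longrightarrow> (\<lambda>y\<in>carrier P. B x y) \<in> module_hom R P (ring_module R)"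
    and lin_l: "y \<in> carrier P \<Longrightarrow> (\<lambda>x\<in>carrier P. B x y) \<in> module_hom R P (ring_module R)"
    and alt: "x \<in> carrier P \<Longrightarrow> B x x = \<zero>\<^bsub>R\<^esub>"
    and bij: "bij_betw (\<lambda>x. \<lambda>y\<in>carrier P. B x y) (carrier P) (module_hom R P (ring_module R))" for x y
    using sm unfolding symplectic_module_def by auto
  then interpret P: Module.module R P by blast
  interpret RR: Module.module R "ring_module R" by (rule P.R.ring_module_is_module)
  have rr: "x \<oplus>\<^bsub>ring_module R\<^esub> y = x \<oplus>\<^bsub>R\<^esub> y" "x \<odot>\<^bsub>ring_module R\<^esub> y = x \<otimes>\<^bsub>R\<^esub> y"
    "carrier (ring_module R) = carrier R" for x y
    by (simp_all add: ring_module_def)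
  obtain k s r where s: "s \<in> module_hom R P (free_module R k)" and r: "r \<in> module_hom R (free_module R k) P"
    and rs: "\<And>x. x \<in> carrier P \<Longrightarrow> r (s x) = x"
    using proj unfolding fg_projective_def by blast
  note sD = module_homD[OF s] and rD = module_homD[OF r]
  have fm: "carrier (free_module R k) = {..<k} \<rightarrow>\<^sub>E carrier R"
    "x \<oplus>\<^bsub>free_module R k\<^esub> y = (\<lambda>i\<in>{..<k}. x i \<oplus>\<^bsub>R\<^esub> y i)"
    "a \<odot>\<^bsub>free_module R k\<^esub> x = (\<lambda>i\<in>{..<k}. a \<otimes>\<^bsub>R\<^esub> x i)" for x y a
    by (simp_all add: free_module_def)
  define u where "u j = (\<lambda>i\<in>{..<k}. if i = j then \<one>\<^bsub>R\<^esub> else \<zero>\<^bsub>R\<^esub>)" for j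
  have u: "u j \<in> carrier (free_module R k)" for j by (auto simp: fm u_def)
  \<comment> \<open>Truncating after \<open>j\<close> coordinates turns the decomposition into unit
    vectors into an induction that uses only additivity and homogeneity of \<open>r\<close>.\<close>
  have expand: "r (\<lambda>i\<in>{..<k}. if i < j then y i else \<zero>\<^bsub>R\<^esub>) = (\<Oplus>\<^bsub>P\<^esub>i\<in>{..<j}. y i \<odot>\<^bsub>P\<^esub> r (u i))"
    if y: "y \<in> {..<k} \<rightarrow>\<^sub>E carrier R" and "j \<le> k" for y j
    using that(2)
  proof (induction j)
    case 0
    have "(\<lambda>i\<in>{..<k}. \<zero>\<^bsub>R\<^esub>) = \<zero>\<^bsub>R\<^esub> \<odot>\<^bsub>free_module R k\<^esub> u 0" by (auto simp: fm u_def)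
    then show ?case using rD(3)[of "\<zero>\<^bsub>R\<^esub>" "u 0"] rD(1)[OF u] u by simp
  next
    case (Suc j)
    have yc: "y i \<in> carrier R" if "i < k" for i using y that by auto
    have "(\<lambda>i\<in>{..<k}. if i < Suc j then y i else \<zero>\<^bsub>R\<^esub>)
      = (\<lambda>i\<in>{..<k}. if i < j then y i else \<zero>\<^bsub>R\<^esub>) \<oplus>\<^bsub>free_module R k\<^esub> y j \<odot>\<^bsub>free_module R k\<^esub> u j"
      using Suc.prems yc by (auto simp: fm u_def less_Suc_eq)
    moreover have "(\<lambda>i\<in>{..<k}. if i < j then y i else \<zero>\<^bsub>R\<^esub>) \<in> carrier (free_module R k)"
      "y j \<odot>\<^bsub>free_module R k\<^esub> u j \<in> carrier (free_module R k)"
      using Suc.prems yc by (auto simp: fm u_def)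
    ultimately have "r (\<lambda>i\<in>{..<k}. if i < Suc j then y i else \<zero>\<^bsub>R\<^esub>)
      = r (\<lambda>i\<in>{..<k}. if i < j then y i else \<zero>\<^bsub>R\<^esub>) \<oplus>\<^bsub>P\<^esub> r (y j \<odot>\<^bsub>free_module R k\<^esub> u j)"
      using rD(2) by presburger
    also have "r (\<lambda>i\<in>{..<k}. if i < j then y i else \<zero>\<^bsub>R\<^esub>) = (\<Oplus>\<^bsub>P\<^esub>i\<in>{..<j}. y i \<odot>\<^bsub>P\<^esub> r (u i))"
      using Suc.prems by (intro Suc.IH) simp
    also have "r (y j \<odot>\<^bsub>free_module R k\<^esub> u j) = y j \<odot>\<^bsub>P\<^esub> r (u j)"
      using Suc.prems yc u by (intro rD(3)) auto
    finally have "r (\<lambda>i\<in>{..<k}. if i < Suc j then y i else \<zero>\<^bsub>R\<^esub>)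
      = (\<Oplus>\<^bsub>P\<^esub>i\<in>{..<j}. y i \<odot>\<^bsub>P\<^esub> r (u i)) \<oplus>\<^bsub>P\<^esub> y j \<odot>\<^bsub>P\<^esub> r (u j)" .
    moreover have "(\<Oplus>\<^bsub>P\<^esub>i\<in>{..<Suc j}. y i \<odot>\<^bsub>P\<^esub> r (u i))
      = (\<Oplus>\<^bsub>P\<^esub>i\<in>{..<j}. y i \<odot>\<^bsub>P\<^esub> r (u i)) \<oplus>\<^bsub>P\<^esub> y j \<odot>\<^bsub>P\<^esub> r (u j)"
      using Suc.prems yc rD(1)[OF u] by (simp add: lessThan_Suc P.M.a_comm)
    ultimately show ?case by (simp only:)
  qed
  \<comment> \<open>Here the surjectivity of the map from \<open>P\<close> to its dual is
    used.\<close>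
  have "\<exists>p\<in>carrier P. \<forall>x\<in>carrier P. B p x = s x i" if i: "i < k" for i
  proof -
    have "(\<lambda>x\<in>carrier P. s x i) \<in> module_hom R P (ring_module R)"
      using sD i by (intro module_homI) (auto simp: rr fm)
    then have "(\<lambda>x\<in>carrier P. s x i) \<in> (\<lambda>x. \<lambda>y\<in>carrier P. B x y) ` carrier P"
      using bij by (simp only: bij_betw_def)
    then obtain p where "p \<in> carrier P" "(\<lambda>y\<in>carrier P. B p y) = (\<lambda>x\<in>carrier P. s x i)"
      by (elim imageE) simp
    then show ?thesis by (metis restrict_apply')
  qed
  then obtain p where p: "\<And>i. i < k \<Longrightarrow> p i \<in> carrier P" "\<And>i x. i < k \<Longrightarrow> x \<in> carrier P \<Longrightarrow> B (p i) x = s x i"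
    by metis
  have ds: "(\<Oplus>\<^bsub>P\<^esub>i\<in>{..<k}. B (p i) x \<odot>\<^bsub>P\<^esub> r (u i)) = x" if x: "x \<in> carrier P" for x
  proof -
    have sx: "s x \<in> {..<k} \<rightarrow>\<^sub>E carrier R" using sD(1)[OF x] by (simp add: fm)
    have "(\<Oplus>\<^bsub>P\<^esub>i\<in>{..<k}. B (p i) x \<odot>\<^bsub>P\<^esub> r (u i)) = (\<Oplus>\<^bsub>P\<^esub>i\<in>{..<k}. s x i \<odot>\<^bsub>P\<^esub> r (u i))"
      using p x by (intro finsum_eqI) auto
    also have "\<dots> = r (\<lambda>i\<in>{..<k}. if i < k then s x i else \<zero>\<^bsub>R\<^esub>)" using expand[OF sx, of k] by simp
    also have "(\<lambda>i\<in>{..<k}. if i < k then s x i else \<zero>\<^bsub>R\<^esub>) = s x"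
      using sx by (auto simp: PiE_def extensional_def)
    finally show ?thesis using rs[OF x] by simp
  qed
  show form: "form_module R P B"
  proof (intro form_module.intro form_module_axioms.intro \<open>Module.module R P\<close>)
    fix x y z assume xy: "x \<in> carrier P" "y \<in> carrier P"
    show "B x y \<in> carrier R" using module_homD(1)[OF lin_r[OF xy(1)] xy(2)] xy by (simp add: rr)
    show "B x x = \<zero>\<^bsub>R\<^esub>" using alt xy by simp
    show "B (a \<odot>\<^bsub>P\<^esub> x) y = a \<otimes>\<^bsub>R\<^esub> B x y" if "a \<in> carrier R" for a
      using module_homD(3)[OF lin_l[OF xy(2)] that xy(1)] xy that by (simp add: rr)
    show "B x (a \<odot>\<^bsub>P\<^esub> y) = a \<otimes>\<^bsub>R\<^esub> B x y" if "a \<in> carrier R" for a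
      using module_homD(3)[OF lin_r[OF xy(1)] that xy(2)] xy that by (simp add: rr)
    show "B (x \<oplus>\<^bsub>P\<^esub> y) z = B x z \<oplus>\<^bsub>R\<^esub> B y z" if "z \<in> carrier P"
      using module_homD(2)[OF lin_l[OF that] xy] xy that by (simp add: rr)
    show "B z (x \<oplus>\<^bsub>P\<^esub> y) = B z x \<oplus>\<^bsub>R\<^esub> B z y" if "z \<in> carrier P"
      using module_homD(2)[OF lin_r[OF that] xy] xy that by (simp add: rr)
    assume eq: "\<And>z. z \<in> carrier P \<Longrightarrow> B z x = B z y"
    have "(\<Oplus>\<^bsub>P\<^esub>i\<in>{..<k}. B (p i) x \<odot>\<^bsub>P\<^esub> r (u i)) = (\<Oplus>\<^bsub>P\<^esub>i\<in>{..<k}. B (p i) y \<odot>\<^bsub>P\<^esub> r (u i))"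
      using eq p by (intro finsum_eqI) auto
    then show "x = y" using ds xy by simp
  qed
  interpret form_module R P B by (rule form)
  have "dual_system k p (\<lambda>i. r (u i))"
    unfolding dual_system_def by (intro conjI ballI Pi_I) (use p rD(1)[OF u] ds in auto)
  then show "\<exists>k p q. dual_system k p q" by blast
qed

section \<open>Transport along isometries\<close>

context form_module
begin

lemma dual_basis_isometry:
  assumes db: "dual_basis N b D" and g: "g \<in> carrier Iso"
  shows "dual_basis N (g \<circ> b) (g \<circ> D)"
proof -
  note d = dual_basisD[OF db] and h = isometryD[OF g]
  have gh: "g \<in> module_hom R M M" using g by (simp add: isometry_iff)
  have gi: "inv\<^bsub>Iso\<^esub> g \<in> carrier Iso" using g by simp
  have "(\<Oplus>\<^bsub>M\<^esub>i\<in>{..<N}. F (g (D i)) x \<odot>\<^bsub>M\<^esub> g (b i)) = x" if x: "x \<in> carrier M" for x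
  proof -
    let ?y = "(inv\<^bsub>Iso\<^esub> g) x"
    have y: "?y \<in> carrier M" "g ?y = x" using isometryD(1)[OF gi x] isometry_inv(1)[OF g x] by auto
    have "(\<Oplus>\<^bsub>M\<^esub>i\<in>{..<N}. F (g (D i)) x \<odot>\<^bsub>M\<^esub> g (b i)) = (\<Oplus>\<^bsub>M\<^esub>i\<in>{..<N}. F (D i) ?y \<odot>\<^bsub>M\<^esub> g (b i))"
      using d h(4) y by (intro finsum_eqI) (metis lessThan_iff, metis lessThan_iff)
    also have "\<dots> = g ?y" by (rule hom_expand[OF db gh y(1), symmetric])
    finally show ?thesis using y by simp
  qed
  then show ?thesis
    unfolding dual_basis_def by (intro conjI ballI allI impI Pi_I) (simp_all add: d h)
qed

text \<open>Here \<open>h\<close> is an arbitrary isometry, not an elementary one: the group is not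
  fixed but moves with the pair.\<close>

lemma elementary_conj:
  assumes J: "ideal J R" and h: "h \<in> carrier Iso" and M: "D \<in> carrier M" "e \<in> carrier M"
  shows "(\<lambda>x. h \<otimes>\<^bsub>Iso\<^esub> x \<otimes>\<^bsub>Iso\<^esub> inv\<^bsub>Iso\<^esub> h) ` elementary D e J = elementary (h D) (h e) J"
proof -
  interpret c: group_hom Iso Iso "\<lambda>x. h \<otimes>\<^bsub>Iso\<^esub> x \<otimes>\<^bsub>Iso\<^esub> inv\<^bsub>Iso\<^esub> h" by (rule I.conj_hom[OF h])
  have "(\<lambda>x. h \<otimes>\<^bsub>Iso\<^esub> x \<otimes>\<^bsub>Iso\<^esub> inv\<^bsub>Iso\<^esub> h) ` pair_gens D e K = pair_gens (h D) (h e) K" for K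
    by (simp only: pair_gens_def image_Un transvections_conj[OF h M(1)] transvections_conj[OF h M(2)])
  then show ?thesis
    unfolding elementary_def
    using c.relative_closure_img[OF pair_gens_subset[OF M] pair_gens_generate[OF J]] by simp
qed

end

section \<open>The local condition\<close>

text \<open>The situation at one prime: \<open>M\<close> with the form \<open>F\<close> is the
  global module, \<open>L\<close> refers to \<open>P\<^sub>\<pp>\<close> over
  \<open>R\<^sub>\<pp>\<close> and \<open>X\<close> to \<open>P\<^sub>\<pp>[X]\<close> over
  \<open>R\<^sub>\<pp>[X]\<close>. The dual system \<open>k\<close>, \<open>p\<close>,
  \<open>q\<close> is one of the global module and gives the dual bases of
  \<open>P\<^sub>\<pp>\<close>.\<close>

locale symplectic_localization = localized_form R S M F
  for R :: "('a, 'm) ring_scheme" (structure) and S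
    and M :: "('a, 'b, 'u) module_scheme" (structure) and F +
  fixes \<pp> I :: "'a set" and n :: nat and k p q
  assumes prime: "primeideal \<pp> R" and S_eq: "S = prime_compl R \<pp>"
    and I: "ideal I R" and ds: "dual_system k p q"
    and rank: "\<exists>b. module_basis LR LM (2 * n) b"
begin

lemma L_form: "form_module LR LM LF"
  by (rule loc_form_module[OF ds])

lemma X_form: "form_module (UP LR) (poly_module LM) (poly_form LR LF)"
  by (rule form_module.poly_form_module[OF L_form])

sublocale L: form_module LR LM LF by (rule L_form)
sublocale X: form_module "UP LR" "poly_module LM" "poly_form LR LF" by (rule X_form)

abbreviation "cM \<equiv> const_poly LM"

definition JX where "JX = poly_ideal LR (loc_ideal R S I)"

lemma JX_ideal: "ideal JX (UP LR)"
proof -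
  have "(\<lambda>a. fq a \<one>) ` I \<subseteq> carrier LR"
    using ideal.Icarr[OF I] by auto
  then have "ideal (loc_ideal R S I) LR" unfolding loc_ideal_def by (rule ring.genideal_ideal[OF cring.axioms(1)[OF LR_cring]])
  then show ?thesis unfolding JX_def by (rule L.poly_ideal_ideal)
qed

lemma loc_local:
  "a \<in> carrier LR \<Longrightarrow> b \<in> carrier LR \<Longrightarrow> a \<oplus>\<^bsub>LR\<^esub> b \<in> Units LR \<Longrightarrow> a \<in> Units LR \<or> b \<in> Units LR"
  using loc_ring_local[OF prime, of a b] unfolding S_eq .

lemma loc_zero_nonunit: "\<zero>\<^bsub>LR\<^esub> \<notin> Units LR"
proof
  interpret p: primeideal \<pp> R by (rule prime)
  assume "\<zero>\<^bsub>LR\<^esub> \<in> Units LR"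
  then obtain w where "w \<in> carrier LR" "w \<otimes>\<^bsub>LR\<^esub> \<zero>\<^bsub>LR\<^esub> = \<one>\<^bsub>LR\<^esub>" by (auto simp: Units_def)
  then have "fq \<zero> \<one> = fq \<one> \<one>" by (simp add: fq_zero loc_ring_sel(5))
  then obtain u where "u \<in> S" "u \<otimes> (\<one> \<otimes> \<zero>) = u \<otimes> (\<one> \<otimes> \<one>)"
    using Q.fraction_eq_iff[of \<zero> \<one> \<one> \<one>] by (auto simp: ring_module_sel)
  then have "\<zero> \<in> S" by simp
  then show False by (simp add: S_eq)
qed

text \<open>For \<open>n = 0\<close> the families \<open>b\<close> and \<open>D\<close> are empty and \<open>b 0\<close>, \<open>D 0\<close> are junk.\<close>

definition elem_group where
  "elem_group b D = (if n = 0 then {\<one>\<^bsub>X.Iso\<^esub>} else X.elementary (cM (D 0)) (cM (b 0)) JX)"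

lemma cM_closed: "x \<in> carrier LM \<Longrightarrow> cM x \<in> carrier (poly_module LM)"
  using L.M.const_poly_up by (simp add: poly_module_simps)

lemma elem_group_indep:
  assumes db: "L.dual_basis (2 * n) b D" "L.dual_basis (2 * n) b' D'"
  shows "elem_group b D = elem_group b' D'"
proof (cases "n = 0")
  case False
  then have n: "0 < 2 * n" by simp
  note d = L.dual_basisD[OF db(1)] and d' = L.dual_basisD[OF db(2)]
  have Db: "LF (D 0) (b 0) \<in> Units LR" "LF (D' 0) (b' 0) \<in> Units LR"
    using d(4)[OF n n] d'(4)[OF n n] by simp_all
  \<comment> \<open>Locality is used over \<open>R\<^sub>\<pp>\<close>. Afterwards \<open>x\<close>
    is taken as the constant \<open>cM x\<close>; all pairings are then constant polynomials of
    units, hence units.\<close>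
  obtain x where x: "x \<in> carrier LM" "LF (D 0) x \<in> Units LR" "LF (D' 0) x \<in> Units LR"
    using L.common_unit[OF loc_local d(2)[OF n] d(1)[OF n] d'(2)[OF n] d'(1)[OF n] Db] by blast
  have "X.elementary (cM (D 0)) (cM (b 0)) JX = X.elementary (cM (D' 0)) (cM (b' 0)) JX"
    by (rule X.elementary_change_pair[OF JX_ideal, where x = "cM x"])
      (use d(1,2)[OF n] d'(1,2)[OF n] x Db in
        \<open>simp_all add: cM_closed L.poly_form_consts L.const_Units\<close>)
  then show ?thesis using False by (simp add: elem_group_def)
qed (unfold elem_group_def, simp)

lemma elem_group_subgroup:
  assumes db: "L.dual_basis (2 * n) b D"
  shows "subgroup (elem_group b D) X.Iso"
proof (cases "n = 0")
  case True
  then show ?thesis unfolding elem_group_def using X.I.triv_subgroup by simp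
next
  case False
  then obtain m where m: "2 * n = Suc m" by (metis Suc_pred' bot_nat_0.not_eq_extremum mult_is_0 zero_neq_numeral)
  show ?thesis
    using X.elementary_subgroup[OF L.poly_dual_basis[OF db[unfolded m]] JX_ideal] False
    by (simp add: elem_group_def)
qed

lemma map_gram:
  assumes "L.dual_basis (2 * n) b D"
  shows "map_mat (const_poly LR) (gram_matrix (2 * n) LF b) = gram_matrix (2 * n) (poly_form LR LF) (cM \<circ> b)"
  using L.dual_basisD(1)[OF assms]
  by (intro eq_matI) (simp_all add: gram_matrix_def L.poly_form_consts)

text \<open>The constants of a basis of \<open>P\<^sub>\<pp>\<close> form a basis of
  \<open>P\<^sub>\<pp>[X]\<close>, whose Gram matrix is \<open>\<phi>\<close> with constant entries.
  For positive \<open>n\<close> this reduces the claim to \<open>matrix_in_ESp_rel\<close>.\<close>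

lemma ESp_rel_iff:
  assumes db: "L.dual_basis (2 * n) b D" and \<beta>: "\<beta> \<in> module_hom (UP LR) (poly_module LM) (poly_module LM)"
    and T: "is_matrix_of (UP LR) (poly_module LM) (2 * n) (cM \<circ> b) \<beta> T"
  shows "T \<in> ESp_rel (UP LR) (map_mat (const_poly LR) (gram_matrix (2 * n) LF b)) JX \<longleftrightarrow> \<beta> \<in> elem_group b D"
proof (cases "n = 0")
  case False
  then obtain m where m: "2 * n = Suc m" by (metis Suc_pred' bot_nat_0.not_eq_extremum mult_is_0 zero_neq_numeral)
  show ?thesis
    unfolding map_gram[OF db]
    using X.matrix_in_ESp_rel[OF L.poly_dual_basis[OF db[unfolded m]] JX_ideal \<beta> T[unfolded m]] False
    by (simp add: elem_group_def m)
next
  case True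
  \<comment> \<open>In rank 0 the localized module is zero, so the identity is its only endomorphism
    and the empty matrix the only matrix; both memberships hold.\<close>
  have "x = \<zero>\<^bsub>LM\<^esub>" if "x \<in> carrier LM" for x
    using L.dual_basisD(3)[OF db that] True by simp
  then have triv: "f = (\<lambda>i. \<zero>\<^bsub>LM\<^esub>)" if "f \<in> carrier (poly_module LM)" for f
    using that by (auto simp: poly_module_simps dest: mem_upD)
  have "\<beta> = \<one>\<^bsub>X.Iso\<^esub>"
  proof (rule extensionalityI[of _ "carrier (poly_module LM)"])
    show "\<beta> x = \<one>\<^bsub>X.Iso\<^esub> x" if "x \<in> carrier (poly_module LM)" for x
      using triv[OF module_homD(1)[OF \<beta> that]] triv[OF that] that by (simp add: isometry_one)
  qed (use module_homD(4)[OF \<beta>] in \<open>auto simp: isometry_one\<close>)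
  moreover have "T \<in> ESp_rel (UP LR) (map_mat (const_poly LR) (gram_matrix (2 * n) LF b)) JX"
  proof -
    let ?\<phi> = "map_mat (const_poly LR) (gram_matrix (2 * n) LF b)"
    have "T \<in> carrier_mat 0 0" using T True by (simp add: is_matrix_of_def mat_monoid_simps)
    then have "T = \<one>\<^bsub>ESp (UP LR) ?\<phi>\<^esub>"
      using True by (intro eq_matI) (auto simp: ESp_def Sp_mat_def mat_monoid_def gram_matrix_def Let_def)
    then show ?thesis by (simp add: ESp_rel_def normal_closure_def generate.one)
  qed
  ultimately show ?thesis unfolding elem_group_def using True by simp
qed

text \<open>Every module basis has a dual basis here, and every endomorphism has a matrix, so the
  matrix can be eliminated in favour of \<open>\<beta>\<close>.\<close>

lemma locally_elementary_iff:
  "locally_elementary R M F n I S \<alpha> \<longleftrightarrow> (\<exists>b D \<beta>. L.dual_basis (2 * n) b D \<and>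
     pfaffian LR n (gram_matrix (2 * n) LF b) = \<one>\<^bsub>LR\<^esub> \<and> is_localized_map R M S \<alpha> \<beta> \<and> \<beta> \<in> elem_group b D)"
proof
  assume "locally_elementary R M F n I S \<alpha>"
  then obtain b \<beta> T where b: "module_basis LR LM (2 * n) b"
    and pf: "pfaffian LR n (gram_matrix (2 * n) LF b) = \<one>\<^bsub>LR\<^esub>" and \<beta>: "is_localized_map R M S \<alpha> \<beta>"
    and T: "is_matrix_of (UP LR) (poly_module LM) (2 * n) (cM \<circ> b) \<beta> T"
    "T \<in> ESp_rel (UP LR) (map_mat (const_poly LR) (gram_matrix (2 * n) LF b)) JX"
    by (auto simp: locally_elementary_def Let_def JX_def)
  obtain D where D: "L.dual_basis (2 * n) b D"
    using L.module_basis_dual[OF b loc_dual_system[OF ds]] by blast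
  have "\<beta> \<in> module_hom (UP LR) (poly_module LM) (poly_module LM)"
    using \<beta> by (simp add: is_localized_map_def Let_def)
  then have "\<beta> \<in> elem_group b D" using ESp_rel_iff[OF D _ T(1)] T(2) by simp
  then show "\<exists>b D \<beta>. L.dual_basis (2 * n) b D \<and>
     pfaffian LR n (gram_matrix (2 * n) LF b) = \<one>\<^bsub>LR\<^esub> \<and> is_localized_map R M S \<alpha> \<beta> \<and> \<beta> \<in> elem_group b D"
    using D pf \<beta> by blast
next
  assume "\<exists>b D \<beta>. L.dual_basis (2 * n) b D \<and>
     pfaffian LR n (gram_matrix (2 * n) LF b) = \<one>\<^bsub>LR\<^esub> \<and> is_localized_map R M S \<alpha> \<beta> \<and> \<beta> \<in> elem_group b D"
  then obtain b D \<beta> where D: "L.dual_basis (2 * n) b D"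
    and pf: "pfaffian LR n (gram_matrix (2 * n) LF b) = \<one>\<^bsub>LR\<^esub>" and \<beta>: "is_localized_map R M S \<alpha> \<beta>" "\<beta> \<in> elem_group b D"
    by blast
  have \<beta>h: "\<beta> \<in> module_hom (UP LR) (poly_module LM) (poly_module LM)"
    using \<beta> by (simp add: is_localized_map_def Let_def)
  let ?T = "X.matrix_of (2 * n) (cM \<circ> b) (cM \<circ> D) \<beta>"
  have T: "is_matrix_of (UP LR) (poly_module LM) (2 * n) (cM \<circ> b) \<beta> ?T"
    using X.is_matrix_of_iff[OF L.poly_dual_basis[OF D] \<beta>h] by simp
  then have "?T \<in> ESp_rel (UP LR) (map_mat (const_poly LR) (gram_matrix (2 * n) LF b)) JX"
    using ESp_rel_iff[OF D \<beta>h T] \<beta> by simp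
  then show "locally_elementary R M F n I S \<alpha>"
    unfolding locally_elementary_def Let_def JX_def
    using L.dual_basis_module_basis[OF D] pf \<beta> T by blast
qed

text \<open>The local condition asks for some basis with this property; the lemma guarantees that
  there is one at every prime.\<close>

lemma exists_pfaffian_one:
  "\<exists>b D. L.dual_basis (2 * n) b D \<and> pfaffian LR n (gram_matrix (2 * n) LF b) = \<one>\<^bsub>LR\<^esub>"
proof -
  obtain b where "module_basis LR LM (2 * n) b" using rank by blast
  then obtain D where "L.dual_basis (2 * n) b D"
    using L.module_basis_dual[OF _ loc_dual_system[OF ds]] by blast
  then obtain b D where bD: "L.dual_basis (2 * n) b D"
    "\<And>i j. i < 2 * n \<Longrightarrow> j < 2 * n \<Longrightarrow> LF (b i) (b j) = L.standard_entry i j"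
    using L.symplectic_basis[OF loc_local loc_zero_nonunit] by blast
  moreover have "pfaffian LR n (gram_matrix (2 * n) LF b) = \<one>\<^bsub>LR\<^esub>"
    by (rule L.pfaffian_standard) (simp add: gram_matrix_def bD(2))
  ultimately show ?thesis by blast
qed

section \<open>Compatibility of isometries with localization\<close>

definition frac_poly where "frac_poly f = (\<lambda>i::nat. fr (f i) \<one>)"

lemma frac_poly_closed:
  assumes "f \<in> up M"
  shows "frac_poly f \<in> carrier (poly_module LM)"
proof -
  obtain m where "\<And>i. m \<le> i \<Longrightarrow> f i = \<zero>\<^bsub>M\<^esub>" using assms by (metis upE2)
  then show ?thesis unfolding poly_module_simps
    using mem_upD[OF assms] by (intro upI2[where n = m]) (simp_all add: frac_poly_def loc_zero)
qed

lemma is_localized_map_iff: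
  assumes "\<beta> \<in> carrier X.Iso"
  shows "is_localized_map R M S \<alpha> \<beta> \<longleftrightarrow> (\<forall>f\<in>up M. \<beta> (frac_poly f) = frac_poly (\<alpha> f))"
  using assms by (simp add: is_localized_map_def Let_def frac_poly_def poly_module_simps isometry_iff)

lemma is_localized_map_mult:
  assumes "\<alpha> \<in> carrier IsoX" "\<alpha>' \<in> carrier IsoX" "\<beta> \<in> carrier X.Iso" "\<beta>' \<in> carrier X.Iso"
    and "is_localized_map R M S \<alpha> \<beta>" "is_localized_map R M S \<alpha>' \<beta>'"
  shows "is_localized_map R M S (\<alpha> \<otimes>\<^bsub>IsoX\<^esub> \<alpha>') (\<beta> \<otimes>\<^bsub>X.Iso\<^esub> \<beta>')"
proof -
  interpret MX: form_module "UP R" PX FX by (rule poly_form_module)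
  show ?thesis
    using assms MX.isometryD(1)[OF assms(2)] frac_poly_closed
    by (simp add: is_localized_map_iff X.isometry_mult_apply MX.isometry_mult_apply poly_module_simps(1))
qed

lemma is_localized_map_inv:
  assumes "\<alpha> \<in> carrier IsoX" "\<beta> \<in> carrier X.Iso" "is_localized_map R M S \<alpha> \<beta>"
  shows "is_localized_map R M S (inv\<^bsub>IsoX\<^esub> \<alpha>) (inv\<^bsub>X.Iso\<^esub> \<beta>)"
proof -
  interpret MX: form_module "UP R" PX FX by (rule poly_form_module)
  have inv: "inv\<^bsub>IsoX\<^esub> \<alpha> \<in> carrier IsoX" "inv\<^bsub>X.Iso\<^esub> \<beta> \<in> carrier X.Iso" using assms by simp_all
  have "(inv\<^bsub>X.Iso\<^esub> \<beta>) (frac_poly f) = frac_poly ((inv\<^bsub>IsoX\<^esub> \<alpha>) f)" if f: "f \<in> up M" for f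
  proof -
    let ?g = "(inv\<^bsub>IsoX\<^esub> \<alpha>) f"
    have g: "?g \<in> up M" "\<alpha> ?g = f"
      using MX.isometryD(1)[OF inv(1)] MX.isometry_inv(1)[OF assms(1)] f by (simp_all add: poly_module_simps)
    then have "\<beta> (frac_poly ?g) = frac_poly f" using assms by (simp add: is_localized_map_iff)
    then show ?thesis using X.isometry_inv(2)[OF assms(2) frac_poly_closed[OF g(1)]] by simp
  qed
  then show ?thesis using inv by (simp add: is_localized_map_iff)
qed

lemma is_localized_map_one: "is_localized_map R M S \<one>\<^bsub>IsoX\<^esub> \<one>\<^bsub>X.Iso\<^esub>"
proof -
  have "\<one>\<^bsub>X.Iso\<^esub> \<in> carrier X.Iso" by simp
  then show ?thesis
    using frac_poly_closed by (simp add: is_localized_map_iff isometry_one poly_module_simps(1))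
qed

lemma is_localized_map_lift:
  assumes g: "g \<in> carrier Iso"
  shows "is_localized_map R M S (poly_lift g) (L.poly_lift (loc_map g))"
proof -
  have gh: "g \<in> module_hom R M M" using g by (simp add: isometry_iff)
  have "L.poly_lift (loc_map g) \<in> carrier X.Iso"
    by (rule L.poly_lift_isometry[OF loc_map_isometry[OF ds g]])
  moreover have "L.poly_lift (loc_map g) (frac_poly f) = frac_poly (poly_lift g f)" if "f \<in> up M" for f
    using frac_poly_closed[OF that] that mem_upD[OF that]
    by (simp add: L.poly_lift_apply poly_lift_apply poly_module_simps(1) frac_poly_def loc_map_apply[OF gh])
  ultimately show ?thesis by (simp add: is_localized_map_iff)
qed

text \<open>The group of one fixed basis serves as \<open>E\<close>. By independence the group of
  any other basis is \<open>E\<close> too, which eliminates the quantifier over bases. Conjugation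
  by a lifted isometry yields the group of the transported basis, and this is again
  \<open>E\<close>.\<close>

lemma local_group:
  obtains E where "subgroup E X.Iso"
    and "\<And>g \<beta>. g \<in> carrier Iso \<Longrightarrow> \<beta> \<in> E \<Longrightarrow>
      L.poly_lift (loc_map g) \<otimes>\<^bsub>X.Iso\<^esub> \<beta> \<otimes>\<^bsub>X.Iso\<^esub> inv\<^bsub>X.Iso\<^esub> (L.poly_lift (loc_map g)) \<in> E"
    and "\<And>\<alpha>. locally_elementary R M F n I S \<alpha> \<longleftrightarrow> (\<exists>\<beta>\<in>E. is_localized_map R M S \<alpha> \<beta>)"
proof -
  obtain b D where db: "L.dual_basis (2 * n) b D"
    and pf: "pfaffian LR n (gram_matrix (2 * n) LF b) = \<one>\<^bsub>LR\<^esub>"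
    using exists_pfaffian_one by blast
  show ?thesis
  proof
    show "subgroup (elem_group b D) X.Iso" by (rule elem_group_subgroup[OF db])
    show "locally_elementary R M F n I S \<alpha> \<longleftrightarrow> (\<exists>\<beta>\<in>elem_group b D. is_localized_map R M S \<alpha> \<beta>)" for \<alpha>
      unfolding locally_elementary_iff using db pf elem_group_indep by blast
    fix g \<beta> assume g: "g \<in> carrier Iso" and \<beta>: "\<beta> \<in> elem_group b D"
    let ?l = "loc_map g" and ?h = "L.poly_lift (loc_map g)"
    have l: "?l \<in> carrier L.Iso" by (rule loc_map_isometry[OF ds g])
    have h: "?h \<in> carrier X.Iso" by (rule L.poly_lift_isometry[OF l])
    show "?h \<otimes>\<^bsub>X.Iso\<^esub> \<beta> \<otimes>\<^bsub>X.Iso\<^esub> inv\<^bsub>X.Iso\<^esub> ?h \<in> elem_group b D"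
    proof (cases "n = 0")
      case True
      then show ?thesis using \<beta> h unfolding elem_group_def by simp
    next
      case False
      then have D0: "D 0 \<in> carrier LM" and b0: "b 0 \<in> carrier LM"
        using L.dual_basisD(1,2)[OF db] by auto
      have "\<beta> \<in> X.elementary (cM (D 0)) (cM (b 0)) JX" using \<beta> False by (simp add: elem_group_def)
      then have "?h \<otimes>\<^bsub>X.Iso\<^esub> \<beta> \<otimes>\<^bsub>X.Iso\<^esub> inv\<^bsub>X.Iso\<^esub> ?h
          \<in> X.elementary (?h (cM (D 0))) (?h (cM (b 0))) JX"
        unfolding X.elementary_conj[OF JX_ideal h cM_closed[OF D0] cM_closed[OF b0], symmetric] by (rule imageI)
      also have "\<dots> = elem_group (?l \<circ> b) (?l \<circ> D)"
        using False L.poly_lift_const[OF l D0] L.poly_lift_const[OF l b0] by (simp add: elem_group_def)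
      also have "\<dots> = elem_group b D"
        by (rule elem_group_indep[OF L.dual_basis_isometry[OF db l] db])
      finally show ?thesis .
    qed
  qed
qed

lemma locally_elementary_one: "locally_elementary R M F n I S \<one>\<^bsub>IsoX\<^esub>"
proof -
  obtain E where E: "subgroup E X.Iso"
    and iff: "\<And>\<alpha>. locally_elementary R M F n I S \<alpha> \<longleftrightarrow> (\<exists>\<beta>\<in>E. is_localized_map R M S \<alpha> \<beta>)"
    by (rule local_group) blast
  show ?thesis
    unfolding iff using is_localized_map_one subgroup.one_closed[OF E] by (rule bexI)
qed

lemma locally_elementary_mult:
  assumes \<alpha>: "\<alpha> \<in> carrier IsoX" "\<alpha>' \<in> carrier IsoX"
    and le: "locally_elementary R M F n I S \<alpha>" "locally_elementary R M F n I S \<alpha>'"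
  shows "locally_elementary R M F n I S (\<alpha> \<otimes>\<^bsub>IsoX\<^esub> \<alpha>')"
proof -
  obtain E where E: "subgroup E X.Iso"
    and iff: "\<And>\<alpha>. locally_elementary R M F n I S \<alpha> \<longleftrightarrow> (\<exists>\<beta>\<in>E. is_localized_map R M S \<alpha> \<beta>)"
    by (rule local_group) blast
  obtain \<beta> \<beta>' where \<beta>: "\<beta> \<in> E" "\<beta>' \<in> E"
    and loc: "is_localized_map R M S \<alpha> \<beta>" "is_localized_map R M S \<alpha>' \<beta>'"
    using le iff by blast
  show ?thesis
    unfolding iff
    using is_localized_map_mult[OF \<alpha> subgroup.mem_carrier[OF E \<beta>(1)] subgroup.mem_carrier[OF E \<beta>(2)] loc]
      subgroup.m_closed[OF E \<beta>] by (rule bexI)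
qed

lemma locally_elementary_inv:
  assumes \<alpha>: "\<alpha> \<in> carrier IsoX" and le: "locally_elementary R M F n I S \<alpha>"
  shows "locally_elementary R M F n I S (inv\<^bsub>IsoX\<^esub> \<alpha>)"
proof -
  obtain E where E: "subgroup E X.Iso"
    and iff: "\<And>\<alpha>. locally_elementary R M F n I S \<alpha> \<longleftrightarrow> (\<exists>\<beta>\<in>E. is_localized_map R M S \<alpha> \<beta>)"
    by (rule local_group) blast
  obtain \<beta> where \<beta>: "\<beta> \<in> E" "is_localized_map R M S \<alpha> \<beta>"
    using le iff by blast
  show ?thesis
    unfolding iff
    using is_localized_map_inv[OF \<alpha> subgroup.mem_carrier[OF E \<beta>(1)] \<beta>(2)]
      subgroup.m_inv_closed[OF E \<beta>(1)] by (rule bexI)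
qed

lemma locally_elementary_conj:
  assumes g: "g \<in> carrier Iso" and \<alpha>: "\<alpha> \<in> carrier IsoX" and le: "locally_elementary R M F n I S \<alpha>"
  shows "locally_elementary R M F n I S (poly_lift g \<otimes>\<^bsub>IsoX\<^esub> \<alpha> \<otimes>\<^bsub>IsoX\<^esub> inv\<^bsub>IsoX\<^esub> (poly_lift g))"
proof -
  interpret MX: form_module "UP R" PX FX by (rule poly_form_module)
  obtain E where E: "subgroup E X.Iso"
    and conj: "\<And>g \<beta>. g \<in> carrier Iso \<Longrightarrow> \<beta> \<in> E \<Longrightarrow>
      L.poly_lift (loc_map g) \<otimes>\<^bsub>X.Iso\<^esub> \<beta> \<otimes>\<^bsub>X.Iso\<^esub> inv\<^bsub>X.Iso\<^esub> (L.poly_lift (loc_map g)) \<in> E"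
    and iff: "\<And>\<alpha>. locally_elementary R M F n I S \<alpha> \<longleftrightarrow> (\<exists>\<beta>\<in>E. is_localized_map R M S \<alpha> \<beta>)"
    by (rule local_group) blast
  obtain \<beta> where \<beta>: "\<beta> \<in> E" "is_localized_map R M S \<alpha> \<beta>" using le iff by blast
  have \<beta>X: "\<beta> \<in> carrier X.Iso" using \<beta>(1) E by (rule subgroup.mem_carrier[rotated])
  let ?h = "L.poly_lift (loc_map g)"
  have h: "?h \<in> carrier X.Iso" by (rule L.poly_lift_isometry[OF loc_map_isometry[OF ds g]])
  have l: "poly_lift g \<in> carrier IsoX" by (rule poly_lift_isometry[OF g])
  have "is_localized_map R M S (poly_lift g \<otimes>\<^bsub>IsoX\<^esub> \<alpha> \<otimes>\<^bsub>IsoX\<^esub> inv\<^bsub>IsoX\<^esub> (poly_lift g))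
    (?h \<otimes>\<^bsub>X.Iso\<^esub> \<beta> \<otimes>\<^bsub>X.Iso\<^esub> inv\<^bsub>X.Iso\<^esub> ?h)"
    using h l \<alpha> \<beta>X is_localized_map_lift[OF g] \<beta>(2)
    by (intro is_localized_map_mult is_localized_map_inv) auto
  then show ?thesis using conj[OF g \<beta>(1)] iff by blast
qed

end

section \<open>Globalization and normality\<close>

theorem lemma7p2:
  fixes R :: "('a, 'm) ring_scheme"
    and P :: "('a, 'b, 'u) module_scheme"
    and B :: "'b \<Rightarrow> 'b \<Rightarrow> 'a"
    and I :: "'a set"
    and n :: nat
  assumes "cring R"
    and "ideal I R"
    and "symplectic_module R P B"
    and "has_rank R P (2 * n)"
  shows "vaserstein_group R P B n I \<lhd> isometry_group R P B"
proof -
  interpret form_module R P B by (rule symplectic_module_form(1)[OF assms(3)])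
  interpret MX: form_module "UP R" PX FX by (rule poly_form_module)
  obtain k p q where ds: "dual_system k p q" using symplectic_module_form(2)[OF assms(3)] by blast
  have loc: "symplectic_localization R (prime_compl R \<pp>) P B \<pp> I n k p q" if "primeideal \<pp> R" for \<pp>
  proof -
    have "localized_form R (prime_compl R \<pp>) P B"
      by (intro localized_form.intro localized_module.intro prime_mult_subset[OF assms(1) that]
          is_module form_module_axioms)
    moreover have "\<exists>b. module_basis (loc_ring R (prime_compl R \<pp>)) (loc_module R (prime_compl R \<pp>) P) (2 * n) b"
      using assms(4) that by (simp add: has_rank_def)
    ultimately show ?thesis
      using that assms(2) ds by (intro symplectic_localization.intro symplectic_localization_axioms.intro refl)
  qed
  interpret e1: group_hom IsoX Iso "\<lambda>\<alpha>. eval_map R P \<alpha> \<one>\<^bsub>R\<^esub>" by (rule eval_map_hom) simp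
  interpret e0: group_hom IsoX Iso "\<lambda>\<alpha>. eval_map R P \<alpha> \<zero>\<^bsub>R\<^esub>" by (rule eval_map_hom) simp
  let ?LE = "\<lambda>\<alpha>. \<forall>\<pp>. primeideal \<pp> R \<longrightarrow> locally_elementary R P B n I (prime_compl R \<pp>) \<alpha>"
  \<comment> \<open>The paths form a subgroup of the isometries of \<open>P[X]\<close>: the
    condition at 0 is the kernel of one evaluation, the others are local. The group in question is
    the image of \<open>W\<close> under evaluation at 1.\<close>
  define W where "W = {\<alpha> \<in> carrier IsoX. eval_map R P \<alpha> \<zero>\<^bsub>R\<^esub> = \<one>\<^bsub>Iso\<^esub> \<and> ?LE \<alpha>}"
  have V: "vaserstein_group R P B n I = (\<lambda>\<alpha>. eval_map R P \<alpha> \<one>\<^bsub>R\<^esub>) ` W"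
    by (auto simp: vaserstein_group_def W_def)
  have "subgroup W IsoX"
  proof (rule MX.I.subgroupI)
    have "\<one>\<^bsub>IsoX\<^esub> \<in> W"
      using symplectic_localization.locally_elementary_one[OF loc] by (simp add: W_def)
    then show "W \<noteq> {}" by blast
    show "inv\<^bsub>IsoX\<^esub> \<alpha> \<in> W" if "\<alpha> \<in> W" for \<alpha>
      using that symplectic_localization.locally_elementary_inv[OF loc, of _ \<alpha>] by (simp add: W_def)
    show "\<alpha> \<otimes>\<^bsub>IsoX\<^esub> \<beta> \<in> W" if "\<alpha> \<in> W" "\<beta> \<in> W" for \<alpha> \<beta>
      using that symplectic_localization.locally_elementary_mult[OF loc, of _ \<alpha> \<beta>] by (simp add: W_def)
  qed (auto simp: W_def)
  then have sub: "subgroup (vaserstein_group R P B n I) Iso"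
    unfolding V by (rule e1.subgroup_img_is_subgroup)
  moreover have "g \<otimes>\<^bsub>Iso\<^esub> h \<otimes>\<^bsub>Iso\<^esub> inv\<^bsub>Iso\<^esub> g \<in> vaserstein_group R P B n I"
    if g: "g \<in> carrier Iso" and h: "h \<in> vaserstein_group R P B n I" for g h
  proof -
    obtain \<alpha> where \<alpha>: "\<alpha> \<in> W" "h = eval_map R P \<alpha> \<one>\<^bsub>R\<^esub>" using h V by blast
    then have \<alpha>X: "\<alpha> \<in> carrier IsoX" by (simp add: W_def)
    let ?l = "poly_lift g"
    have l: "?l \<in> carrier IsoX" by (rule poly_lift_isometry[OF g])
    \<comment> \<open>\<open>?l\<close> has the value \<open>g\<close> at 0 and at 1, so the
      conjugated path still starts at the identity and ends at the conjugate of \<open>h\<close> by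
      \<open>g\<close>.\<close>
    let ?\<gamma> = "?l \<otimes>\<^bsub>IsoX\<^esub> \<alpha> \<otimes>\<^bsub>IsoX\<^esub> inv\<^bsub>IsoX\<^esub> ?l"
    have "?LE ?\<gamma>"
      using symplectic_localization.locally_elementary_conj[OF loc g \<alpha>X] \<alpha> by (simp add: W_def)
    then have "?\<gamma> \<in> W" using \<alpha> \<alpha>X l g by (simp add: W_def eval_poly_lift)
    moreover have "eval_map R P ?\<gamma> \<one>\<^bsub>R\<^esub> = g \<otimes>\<^bsub>Iso\<^esub> h \<otimes>\<^bsub>Iso\<^esub> inv\<^bsub>Iso\<^esub> g"
      using \<alpha> \<alpha>X l g by (simp add: eval_poly_lift)
    ultimately show ?thesis unfolding V by (intro image_eqI) simp_all
  qed
  ultimately show ?thesis unfolding I.normal_inv_iff by blast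
qed

end
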